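(* Let $(T_1,\ldots,T_n,T_{n+1})$ be an $(n+1)$-tuple of commuting contractions on $\mathcal{H}$ such that $(T_1,\ldots,T_n)\in\mathfrak{B}^n_0(\mathcal{H})$. Then $(T_1,\ldots,T_n,T_{n+1})$ has an isometric dilation and, consequently, satisfies the von Neumann inequality $$\|p(T_1,\ldots,T_{n+1})\|\le\sup_{\boldsymbol{z}\in\overline{\mathbb{D}}^{n+1}}|p(\boldsymbol{z})|\qquad (p\in\mathbb{C}[z_1,\ldots,z_{n+1}]).$$
   Context: All Hilbert spaces are complex and separable; $n\ge2$; $\mathbb{D}$ is the open unit disc. A contraction $S$ is called pure if $S^{*k}\to 0$ in the strong operator topology as $k\to\infty$. The class $\mathfrak{B}^n_0(\mathcal{H})$ is the set of all $n$-tuples $(T_1,\ldots,T_n)$ of commuting contractions on $\mathcal{H}$ such that $I-T_iT_i^*-T_jT_j^*+T_iT_jT_i^*T_j^*=0$ for all $i\neq j$, and the product $T_1\cdots T_n$ is pure. An isometric dilation of an $m$-tuple of commuting contractions $(T_1,\ldots,T_m)$ on $\mathcal{H}$ is an $m$-tuple of commuting isometries $(V_1,\ldots,V_m)$ on a Hilbert space $\mathcal{K}\supseteq\mathcal{H}$ such that $T_1^{\alpha_1}\cdots T_m^{\alpha_m}=P_{\mathcal{H}}V_1^{\alpha_1}\cdots V_m^{\alpha_m}|_{\mathcal{H}}$ for all $(\alpha_1,\ldots,\alpha_m)\in\mathbb{Z}_+^m$. *)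

theory Defs
  imports "HOL-Analysis.Analysis" "HOL-Library.Poly_Mapping"
begin

section \<open>Complex Hilbert spaces\<close>

text \<open>
  A complex Hilbert space is a complete real inner product space with a compatible complex
  structure; the norm and the topology are those of \<^class>\<open>real_inner\<close>, and
  \<open>scaleR_scaleC\<close> and \<open>inner_eq_Re_cinner\<close> tie them to the complex operations. The complex
  inner product is linear in the first argument. The zero space is allowed.
\<close>

class complex_hilbert_space = real_inner + complete_space +
  fixes scaleC :: "complex \<Rightarrow> 'a \<Rightarrow> 'a" (infixr \<open>*\<^sub>C\<close> 75)
    and cinner :: "'a \<Rightarrow> 'a \<Rightarrow> complex"
  assumes scaleC_add_right: "c *\<^sub>C (x + y) = c *\<^sub>C x + c *\<^sub>C y"
    and scaleC_add_left: "(c + d) *\<^sub>C x = c *\<^sub>C x + d *\<^sub>C x"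
    and scaleC_scaleC: "c *\<^sub>C d *\<^sub>C x = (c * d) *\<^sub>C x"
    and scaleR_scaleC: "r *\<^sub>R x = complex_of_real r *\<^sub>C x"
    and cinner_add_left: "cinner (x + y) z = cinner x z + cinner y z"
    and cinner_scaleC_left: "cinner (c *\<^sub>C x) y = c * cinner x y"
    and cinner_commute: "cinner x y = cnj (cinner y x)"
    and inner_eq_Re_cinner: "inner x y = Re (cinner x y)"


section \<open>The Hilbert space of square-summable sequences\<close>

typedef ell2 = "{f :: nat \<Rightarrow> complex. summable (\<lambda>n. (cmod (f n))\<^sup>2)}"
  morphisms ell2_nth Abs_ell2
  by (rule exI[of _ "\<lambda>_. 0"]) simp

setup_lifting type_definition_ell2

lemma ell2_eqI: "(\<And>n. ell2_nth f n = ell2_nth g n) \<Longrightarrow> f = g"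
  by (metis ell2_nth_inject ext)

lemma summable_ell2: "summable (\<lambda>n. (cmod (ell2_nth f n))\<^sup>2)"
  using ell2_nth[of f] by simp

lemma cmod_mult_le_squares: "cmod (a * b) \<le> (cmod a)\<^sup>2 + (cmod b)\<^sup>2"
proof -
  have "0 \<le> (cmod a - cmod b)\<^sup>2" by simp
  then have "2 * (cmod a * cmod b) \<le> (cmod a)\<^sup>2 + (cmod b)\<^sup>2"
    by (simp add: power2_diff)
  moreover have "0 \<le> cmod a * cmod b" by simp
  ultimately show ?thesis unfolding norm_mult by linarith
qed

lemma cmod_add_squared_le: "(cmod (a + b))\<^sup>2 \<le> 2 * (cmod a)\<^sup>2 + 2 * (cmod b)\<^sup>2"
proof -
  have "(cmod (a + b))\<^sup>2 \<le> (cmod a + cmod b)\<^sup>2"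
    by (intro power_mono norm_triangle_ineq) auto
  moreover have "0 \<le> (cmod a - cmod b)\<^sup>2" by simp
  ultimately show ?thesis by (simp add: power2_diff power2_sum)
qed

lemma summable_ell2_product: "summable (\<lambda>n. ell2_nth f n * cnj (ell2_nth g n))"
proof (rule summable_comparison_test)
  show "summable (\<lambda>n. (cmod (ell2_nth f n))\<^sup>2 + (cmod (ell2_nth g n))\<^sup>2)"
    by (intro summable_add summable_ell2)
  show "\<exists>N. \<forall>n\<ge>N. norm (ell2_nth f n * cnj (ell2_nth g n))
          \<le> (cmod (ell2_nth f n))\<^sup>2 + (cmod (ell2_nth g n))\<^sup>2"
    using cmod_mult_le_squares[of "ell2_nth f _" "cnj (ell2_nth g _)"] by auto
qed

instantiation ell2 :: ab_group_add
begin

lift_definition zero_ell2 :: ell2 is "\<lambda>_. 0" by simp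

lift_definition plus_ell2 :: "ell2 \<Rightarrow> ell2 \<Rightarrow> ell2" is "\<lambda>f g n. f n + g n"
proof -
  fix f g :: "nat \<Rightarrow> complex"
  assume "summable (\<lambda>n. (cmod (f n))\<^sup>2)" "summable (\<lambda>n. (cmod (g n))\<^sup>2)"
  then have "summable (\<lambda>n. 2 * (cmod (f n))\<^sup>2 + 2 * (cmod (g n))\<^sup>2)"
    by (intro summable_add summable_mult)
  then show "summable (\<lambda>n. (cmod (f n + g n))\<^sup>2)"
    by (rule summable_comparison_test'[where N = 0]) (simp add: cmod_add_squared_le)
qed

lift_definition uminus_ell2 :: "ell2 \<Rightarrow> ell2" is "\<lambda>f n. - f n" by simp

definition minus_ell2 :: "ell2 \<Rightarrow> ell2 \<Rightarrow> ell2" where "minus_ell2 f g = f + - g"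

instance
  by standard (simp_all add: minus_ell2_def, (transfer, simp add: algebra_simps)+)

end

instantiation ell2 :: real_inner
begin

lift_definition scaleR_ell2 :: "real \<Rightarrow> ell2 \<Rightarrow> ell2" is "\<lambda>r f n. complex_of_real r * f n"
  by (simp add: norm_mult power_mult_distrib summable_mult)

definition inner_ell2 :: "ell2 \<Rightarrow> ell2 \<Rightarrow> real"
  where "inner_ell2 f g = Re (suminf (\<lambda>n. ell2_nth f n * cnj (ell2_nth g n)))"

definition norm_ell2 :: "ell2 \<Rightarrow> real" where "norm_ell2 f = sqrt (inner f f)"

definition sgn_ell2 :: "ell2 \<Rightarrow> ell2" where "sgn_ell2 f = inverse (norm f) *\<^sub>R f"

definition dist_ell2 :: "ell2 \<Rightarrow> ell2 \<Rightarrow> real" where "dist_ell2 f g = norm (f - g)"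

definition uniformity_ell2 :: "(ell2 \<times> ell2) filter"
  where "uniformity_ell2 = (INF e\<in>{0<..}. principal {(f, g). dist f g < e})"

definition open_ell2 :: "ell2 set \<Rightarrow> bool"
  where "open_ell2 U = (\<forall>f\<in>U. eventually (\<lambda>(f', g). f' = f \<longrightarrow> g \<in> U) uniformity)"

lemma inner_ell2_self: "inner f f = suminf (\<lambda>n. (cmod (ell2_nth f n))\<^sup>2)" for f :: ell2
proof -
  have "suminf (\<lambda>n. ell2_nth f n * cnj (ell2_nth f n))
          = suminf (\<lambda>n. complex_of_real ((cmod (ell2_nth f n))\<^sup>2))"
    by (simp only: complex_norm_square)
  also have "\<dots> = complex_of_real (suminf (\<lambda>n. (cmod (ell2_nth f n))\<^sup>2))"
    by (rule suminf_of_real[OF summable_ell2, symmetric])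
  finally show ?thesis by (simp add: inner_ell2_def)
qed

instance
proof
  fix f g h :: ell2 and r s :: real
  show "r *\<^sub>R (f + g) = r *\<^sub>R f + r *\<^sub>R g"
    by transfer (simp add: algebra_simps)
  show "(r + s) *\<^sub>R f = r *\<^sub>R f + s *\<^sub>R f"
    by transfer (simp add: algebra_simps)
  show "r *\<^sub>R s *\<^sub>R f = (r * s) *\<^sub>R f"
    by transfer (simp add: algebra_simps)
  show "1 *\<^sub>R f = f"
    by transfer simp
  show "sgn f = inverse (norm f) *\<^sub>R f" by (rule sgn_ell2_def)
  show "dist f g = norm (f - g)" by (rule dist_ell2_def)
  show "(uniformity :: (ell2 \<times> ell2) filter) = (INF e\<in>{0<..}. principal {(f, g). dist f g < e})"
    by (rule uniformity_ell2_def)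
  show "open U = (\<forall>f\<in>U. eventually (\<lambda>(f', g). f' = f \<longrightarrow> g \<in> U) uniformity)" for U :: "ell2 set"
    by (rule open_ell2_def)
  have "suminf (\<lambda>n. ell2_nth g n * cnj (ell2_nth f n))
          = cnj (suminf (\<lambda>n. ell2_nth f n * cnj (ell2_nth g n)))"
    using bounded_linear.suminf[OF bounded_linear_cnj summable_ell2_product[of f g]]
    by (simp add: mult.commute)
  then show "inner f g = inner g f" by (simp add: inner_ell2_def)
  show "inner (f + g) h = inner f h + inner g h"
    by (simp add: inner_ell2_def plus_ell2.rep_eq distrib_right
        suminf_add[OF summable_ell2_product summable_ell2_product, symmetric])
  show "inner (r *\<^sub>R f) g = r * inner f g"
    by (simp add: inner_ell2_def scaleR_ell2.rep_eq mult.assoc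
        suminf_mult[OF summable_ell2_product])
  show "0 \<le> inner f f"
    unfolding inner_ell2_self by (rule suminf_nonneg[OF summable_ell2]) simp
  have "inner f f = 0 \<longleftrightarrow> (\<forall>n. ell2_nth f n = 0)"
    unfolding inner_ell2_self by (subst suminf_eq_zero_iff[OF summable_ell2]) auto
  also have "\<dots> \<longleftrightarrow> f = 0"
    using ell2_eqI[of f 0] by (auto simp: zero_ell2.rep_eq)
  finally show "inner f f = 0 \<longleftrightarrow> f = 0" .
  show "norm f = sqrt (inner f f)" by (rule norm_ell2_def)
qed

end

lemma norm_ell2_squared: "(norm f)\<^sup>2 = suminf (\<lambda>n. (cmod (ell2_nth f n))\<^sup>2)" for f :: ell2
  using inner_ell2_self[of f] by (simp add: power2_norm_eq_inner)

lemma ell2_nth_diff: "ell2_nth (f - g) n = ell2_nth f n - ell2_nth g n"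
  by (simp add: minus_ell2_def plus_ell2.rep_eq uminus_ell2.rep_eq del: add_uminus_conv_diff)

lemma sum_le_norm_ell2_squared:
  "finite A \<Longrightarrow> (\<Sum>n\<in>A. (cmod (ell2_nth f n))\<^sup>2) \<le> (norm f)\<^sup>2"
  unfolding norm_ell2_squared by (rule sum_le_suminf[OF summable_ell2]) auto

lemma cmod_ell2_nth_le_norm: "cmod (ell2_nth f n) \<le> norm f"
  using sum_le_norm_ell2_squared[of "{n}" f] by (simp add: power2_le_iff_abs_le)

instance ell2 :: complete_space
proof
  fix X :: "nat \<Rightarrow> ell2"
  assume "Cauchy X"
  have "Cauchy (\<lambda>k. ell2_nth (X k) n)" for n
  proof (rule metric_CauchyI)
    fix e :: real assume "0 < e"
    then obtain M where "\<forall>k\<ge>M. \<forall>l\<ge>M. dist (X k) (X l) < e"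
      using metric_CauchyD[OF \<open>Cauchy X\<close>] by blast
    then show "\<exists>M. \<forall>k\<ge>M. \<forall>l\<ge>M. dist (ell2_nth (X k) n) (ell2_nth (X l) n) < e"
      by (metis cmod_ell2_nth_le_norm dist_norm ell2_nth_diff order_le_less_trans)
  qed
  then have "\<exists>l. \<forall>n. (\<lambda>k. ell2_nth (X k) n) \<longlonglongrightarrow> l n"
    by (intro choice) (auto simp: Cauchy_convergent_iff convergent_def)
  then obtain l where l: "\<And>n. (\<lambda>k. ell2_nth (X k) n) \<longlonglongrightarrow> l n" by blast
  have partial: "\<exists>M. \<forall>k\<ge>M. \<forall>N. (\<Sum>n<N. (cmod (ell2_nth (X k) n - l n))\<^sup>2) \<le> e\<^sup>2"
    if "0 < e" for e :: real
  proof -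
    obtain M where M: "\<And>k j. k \<ge> M \<Longrightarrow> j \<ge> M \<Longrightarrow> dist (X k) (X j) < e"
      using metric_CauchyD[OF \<open>Cauchy X\<close> \<open>0 < e\<close>] by blast
    have "(\<Sum>n<N. (cmod (ell2_nth (X k) n - l n))\<^sup>2) \<le> e\<^sup>2" if "k \<ge> M" for k N
    proof (rule tendsto_upperbound)
      show "(\<lambda>j. \<Sum>n<N. (cmod (ell2_nth (X k) n - ell2_nth (X j) n))\<^sup>2)
              \<longlonglongrightarrow> (\<Sum>n<N. (cmod (ell2_nth (X k) n - l n))\<^sup>2)"
        by (intro tendsto_intros l)
      have "(\<Sum>n<N. (cmod (ell2_nth (X k) n - ell2_nth (X j) n))\<^sup>2) \<le> e\<^sup>2" if "j \<ge> M" for j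
      proof -
        have "(\<Sum>n<N. (cmod (ell2_nth (X k) n - ell2_nth (X j) n))\<^sup>2) \<le> (norm (X k - X j))\<^sup>2"
          using sum_le_norm_ell2_squared[of "{..<N}" "X k - X j"] by (simp add: ell2_nth_diff)
        also have "\<dots> \<le> e\<^sup>2"
          using M[OF \<open>k \<ge> M\<close> that] by (intro power_mono) (auto simp: dist_norm)
        finally show ?thesis .
      qed
      then show "\<forall>\<^sub>F j in sequentially.
          (\<Sum>n<N. (cmod (ell2_nth (X k) n - ell2_nth (X j) n))\<^sup>2) \<le> e\<^sup>2"
        by (auto simp: eventually_sequentially)
    qed simp
    then show ?thesis by blast
  qed
  obtain M where M: "\<And>N. (\<Sum>n<N. (cmod (ell2_nth (X M) n - l n))\<^sup>2) \<le> 1"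
    using partial[of 1] by auto
  have diff: "summable (\<lambda>n. (cmod (ell2_nth (X M) n - l n))\<^sup>2)"
    by (rule bounded_imp_summable[where B = 1]) (use M[of "Suc _"] in \<open>auto simp: lessThan_Suc_atMost\<close>)
  have "summable (\<lambda>n. 2 * (cmod (ell2_nth (X M) n))\<^sup>2 + 2 * (cmod (ell2_nth (X M) n - l n))\<^sup>2)"
    by (intro summable_add summable_mult summable_ell2 diff)
  then have "summable (\<lambda>n. (cmod (l n))\<^sup>2)"
  proof (rule summable_comparison_test'[where N = 0])
    fix n
    show "norm ((cmod (l n))\<^sup>2)
        \<le> 2 * (cmod (ell2_nth (X M) n))\<^sup>2 + 2 * (cmod (ell2_nth (X M) n - l n))\<^sup>2"
      using cmod_add_squared_le[of "ell2_nth (X M) n" "- (ell2_nth (X M) n - l n)"]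
      by (simp add: norm_minus_commute)
  qed
  then have L: "ell2_nth (Abs_ell2 l) = l" by (simp add: Abs_ell2_inverse)
  have "X \<longlonglongrightarrow> Abs_ell2 l"
  proof (rule metric_LIMSEQ_I)
    fix e :: real assume "0 < e"
    then obtain M where M: "\<And>k N. k \<ge> M \<Longrightarrow> (\<Sum>n<N. (cmod (ell2_nth (X k) n - l n))\<^sup>2) \<le> (e / 2)\<^sup>2"
      using partial[of "e / 2"] by auto
    have "dist (X k) (Abs_ell2 l) < e" if "k \<ge> M" for k
    proof -
      have "(norm (X k - Abs_ell2 l))\<^sup>2 \<le> (e / 2)\<^sup>2"
        unfolding norm_ell2_squared
        by (rule suminf_le_const[OF summable_ell2]) (use M[OF that] in \<open>simp add: ell2_nth_diff L\<close>)
      then have "norm (X k - Abs_ell2 l) \<le> e / 2"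
        using \<open>0 < e\<close> by (simp add: power2_le_iff_abs_le)
      then show ?thesis using \<open>0 < e\<close> by (simp add: dist_norm)
    qed
    then show "\<exists>M. \<forall>k\<ge>M. dist (X k) (Abs_ell2 l) < e" by blast
  qed
  then show "convergent X" by (auto simp: convergent_def)
qed

instantiation ell2 :: complex_hilbert_space
begin

lift_definition scaleC_ell2 :: "complex \<Rightarrow> ell2 \<Rightarrow> ell2" is "\<lambda>c f n. c * f n"
  by (simp add: norm_mult power_mult_distrib summable_mult)

definition cinner_ell2 :: "ell2 \<Rightarrow> ell2 \<Rightarrow> complex"
  where "cinner_ell2 f g = suminf (\<lambda>n. ell2_nth f n * cnj (ell2_nth g n))"

instance
proof
  fix f g h :: ell2 and c d :: complex and r :: real
  show "c *\<^sub>C (f + g) = c *\<^sub>C f + c *\<^sub>C g"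
    by transfer (simp add: algebra_simps)
  show "(c + d) *\<^sub>C f = c *\<^sub>C f + d *\<^sub>C f"
    by transfer (simp add: algebra_simps)
  show "c *\<^sub>C d *\<^sub>C f = (c * d) *\<^sub>C f"
    by transfer (simp add: algebra_simps)
  show "r *\<^sub>R f = complex_of_real r *\<^sub>C f"
    by transfer simp
  show "cinner f g = cnj (cinner g f)"
    using bounded_linear.suminf[OF bounded_linear_cnj summable_ell2_product[of g f]]
    by (simp add: cinner_ell2_def mult.commute)
  show "cinner (f + g) h = cinner f h + cinner g h"
    by (simp add: cinner_ell2_def plus_ell2.rep_eq distrib_right
        suminf_add[OF summable_ell2_product summable_ell2_product, symmetric])
  show "cinner (c *\<^sub>C f) g = c * cinner f g"
    by (simp add: cinner_ell2_def scaleC_ell2.rep_eq mult.assoc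
        suminf_mult[OF summable_ell2_product])
  show "inner f g = Re (cinner f g)"
    by (simp add: inner_ell2_def cinner_ell2_def)
qed

end


section \<open>Operators\<close>

definition bounded_clinear ::
    "('a::complex_hilbert_space \<Rightarrow> 'b::complex_hilbert_space) \<Rightarrow> bool"
  where "bounded_clinear T \<longleftrightarrow> bounded_linear T \<and> (\<forall>c x. T (c *\<^sub>C x) = c *\<^sub>C T x)"

definition contraction :: "('a::complex_hilbert_space \<Rightarrow> 'a) \<Rightarrow> bool"
  where "contraction T \<longleftrightarrow> bounded_clinear T \<and> onorm T \<le> 1"

text \<open>
  The Hilbert space adjoint: for a bounded operator exactly one such \<open>S\<close> exists, by the Riesz
  representation theorem.
\<close>

definition cadjoint :: "('a::complex_hilbert_space \<Rightarrow> 'b::complex_hilbert_space) \<Rightarrow> 'b \<Rightarrow> 'a"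
  where "cadjoint T = (THE S. \<forall>x y. cinner (T x) y = cinner x (S y))"

definition pure_contraction :: "('a::complex_hilbert_space \<Rightarrow> 'a) \<Rightarrow> bool"
  where "pure_contraction S \<longleftrightarrow> contraction S \<and> (\<forall>x. (\<lambda>k. (cadjoint S ^^ k) x) \<longlonglongrightarrow> 0)"

text \<open>
  An \<open>m\<close>-tuple is a function on indices of which only \<open>1, \<dots>, m\<close> are used;
  \<open>op_monomial m T \<alpha>\<close> is the operator monomial with factors \<open>T i ^^ \<alpha> i\<close>, in the order
  \<open>i = 1, \<dots>, m\<close>; with all exponents \<open>1\<close> it is the product of the tuple.
\<close>

primrec op_monomial :: "nat \<Rightarrow> (nat \<Rightarrow> 'a \<Rightarrow> 'a) \<Rightarrow> (nat \<Rightarrow> nat) \<Rightarrow> 'a \<Rightarrow> 'a"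
  where
    "op_monomial 0 T \<alpha> = id"
  | "op_monomial (Suc m) T \<alpha> = op_monomial m T \<alpha> \<circ> (T (Suc m) ^^ \<alpha> (Suc m))"

definition commuting_contractions :: "nat \<Rightarrow> (nat \<Rightarrow> 'a::complex_hilbert_space \<Rightarrow> 'a) \<Rightarrow> bool"
  where "commuting_contractions m T \<longleftrightarrow>
    (\<forall>i\<in>{1..m}. contraction (T i)) \<and> (\<forall>i\<in>{1..m}. \<forall>j\<in>{1..m}. T i \<circ> T j = T j \<circ> T i)"

definition class_B0 :: "nat \<Rightarrow> (nat \<Rightarrow> 'a::complex_hilbert_space \<Rightarrow> 'a) set"
  where "class_B0 n = {T. commuting_contractions n T \<and>
    (\<forall>i\<in>{1..n}. \<forall>j\<in>{1..n}. i \<noteq> j \<longrightarrow>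
      (\<forall>x. x - T i (cadjoint (T i) x) - T j (cadjoint (T j) x)
             + T i (T j (cadjoint (T i) (cadjoint (T j) x))) = 0)) \<and>
    pure_contraction (op_monomial n T (\<lambda>_. 1))}"


section \<open>Isometric dilations\<close>

definition closed_csubspace :: "'a::complex_hilbert_space set \<Rightarrow> bool"
  where "closed_csubspace K \<longleftrightarrow> closed K \<and> 0 \<in> K \<and>
    (\<forall>x\<in>K. \<forall>y\<in>K. x + y \<in> K) \<and> (\<forall>c. \<forall>x\<in>K. c *\<^sub>C x \<in> K)"

definition isometry_on :: "'a::complex_hilbert_space set \<Rightarrow> ('a \<Rightarrow> 'b::complex_hilbert_space) \<Rightarrow> bool"
  where "isometry_on K V \<longleftrightarrow>
    (\<forall>x\<in>K. \<forall>y\<in>K. V (x + y) = V x + V y) \<and> (\<forall>c. \<forall>x\<in>K. V (c *\<^sub>C x) = c *\<^sub>C V x) \<and>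
    (\<forall>x\<in>K. norm (V x) = norm x)"

definition commuting_isometries :: "nat \<Rightarrow> 'a::complex_hilbert_space set \<Rightarrow> (nat \<Rightarrow> 'a \<Rightarrow> 'a) \<Rightarrow> bool"
  where "commuting_isometries m K V \<longleftrightarrow>
    (\<forall>i\<in>{1..m}. V i ` K \<subseteq> K \<and> isometry_on K (V i)) \<and>
    (\<forall>i\<in>{1..m}. \<forall>j\<in>{1..m}. \<forall>x\<in>K. V i (V j x) = V j (V i x))"

text \<open>The orthogonal projection onto \<open>S\<close>, meaningful when \<open>S\<close> is a closed complex subspace.\<close>

definition orth_proj :: "'a::complex_hilbert_space set \<Rightarrow> 'a \<Rightarrow> 'a"
  where "orth_proj S x = (THE y. y \<in> S \<and> (\<forall>s\<in>S. cinner (x - y) s = 0))"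

text \<open>
  The dilation space \<open>K\<close> is a Hilbert space in its own right, given as a closed subspace of a
  Hilbert space type. The inclusion of \<open>\<H>\<close> in \<open>K\<close> is a linear isometry \<open>J\<close>, so that
  \<open>\<H>\<close> is identified with \<open>range J\<close>.
\<close>

definition isometric_dilation_on ::
    "nat \<Rightarrow> (nat \<Rightarrow> 'a::complex_hilbert_space \<Rightarrow> 'a) \<Rightarrow>
     'k::complex_hilbert_space set \<Rightarrow> ('a \<Rightarrow> 'k) \<Rightarrow> (nat \<Rightarrow> 'k \<Rightarrow> 'k) \<Rightarrow> bool"
  where "isometric_dilation_on m T K J V \<longleftrightarrow>
    closed_csubspace K \<and> isometry_on UNIV J \<and> range J \<subseteq> K \<and> commuting_isometries m K V \<and>
    (\<forall>\<alpha> h. J (op_monomial m T \<alpha> h) = orth_proj (range J) (op_monomial m V \<alpha> (J h)))"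

text \<open>
  Every separable complex Hilbert space is isometrically isomorphic to a closed subspace of
  \<^typ>\<open>ell2\<close>, so quantifying over closed subspaces of \<^typ>\<open>ell2\<close> quantifies, up to isomorphism,
  over all separable Hilbert spaces \<open>K\<close>.
\<close>

definition has_isometric_dilation :: "nat \<Rightarrow> (nat \<Rightarrow> 'a::complex_hilbert_space \<Rightarrow> 'a) \<Rightarrow> bool"
  where "has_isometric_dilation m T \<longleftrightarrow>
    (\<exists>(K :: ell2 set) J V. isometric_dilation_on m T K J V)"


section \<open>Polynomials in several variables\<close>

text \<open>
  \<open>polynomials m\<close> is the ring of complex polynomials in the variables \<open>z\<^sub>1, \<dots>, z\<^sub>m\<close>: a polynomial
  is the finitely supported map from exponents to coefficients, and an exponent is a finitely
  supported map from variable indices to powers.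
\<close>

definition polynomials :: "nat \<Rightarrow> ((nat \<Rightarrow>\<^sub>0 nat) \<Rightarrow>\<^sub>0 complex) set"
  where "polynomials m = {p. \<forall>\<alpha>\<in>Poly_Mapping.keys p. Poly_Mapping.keys \<alpha> \<subseteq> {1..m}}"

definition poly_eval :: "nat \<Rightarrow> ((nat \<Rightarrow>\<^sub>0 nat) \<Rightarrow>\<^sub>0 complex) \<Rightarrow> (nat \<Rightarrow> complex) \<Rightarrow> complex"
  where "poly_eval m p z = (\<Sum>\<alpha>\<in>Poly_Mapping.keys p.
    Poly_Mapping.lookup p \<alpha> * (\<Prod>i\<in>{1..m}. z i ^ Poly_Mapping.lookup \<alpha> i))"

definition poly_op :: "nat \<Rightarrow> ((nat \<Rightarrow>\<^sub>0 nat) \<Rightarrow>\<^sub>0 complex) \<Rightarrow>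
    (nat \<Rightarrow> 'a::complex_hilbert_space \<Rightarrow> 'a) \<Rightarrow> 'a \<Rightarrow> 'a"
  where "poly_op m p T x = (\<Sum>\<alpha>\<in>Poly_Mapping.keys p.
    Poly_Mapping.lookup p \<alpha> *\<^sub>C op_monomial m T (Poly_Mapping.lookup \<alpha>) x)"

definition closed_polydisc :: "nat \<Rightarrow> (nat \<Rightarrow> complex) set"
  where "closed_polydisc m = {1..m} \<rightarrow>\<^sub>E cball 0 1"

end

theory Submission
  imports Defs
begin

text \<open>
  Write \<open>S\<^sub>i = T\<^sub>i\<^sup>*\<close>. The relations of \<open>\<B>\<^sup>n\<^sub>0\<close> say that \<open>I - T\<^sub>i T\<^sub>i\<^sup>*\<close> is fixed by \<open>X \<mapsto> T\<^sub>j X T\<^sub>j\<^sup>*\<close> for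
  \<open>j \<noteq> i\<close>; with the purity of the product this gives \<open>I = P\<^sub>1 + \<dots> + P\<^sub>n\<close>, where \<open>P\<^sub>j\<close> is the strong
  limit of \<open>R\<^sub>j\<^sup>*\<^sup>k R\<^sub>j\<^sup>k\<close> and \<open>R\<^sub>j\<close> is the product of the \<open>S\<^sub>i\<close> with \<open>i \<noteq> j\<close>. Every operator commuting with
  \<open>R\<^sub>j\<close>, in particular \<open>S\<^sub>n\<^sub>+\<^sub>1\<close>, is contractive for the form \<open>P\<^sub>j\<close>. In the \<open>j\<close>-th summand the \<open>S\<^sub>i\<close> with
  \<open>i \<noteq> j\<close> are isometric and extend to commuting unitaries, \<open>S\<^sub>j\<close> is a pure contraction (its powers tend
  strongly to \<open>0\<close>), and only the commuting pair \<open>S\<^sub>j, S\<^sub>n\<^sub>+\<^sub>1\<close> remains to be dilated. This is done by an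
  equivariant form of Ando's argument: \<open>S\<^sub>j\<^sup>*\<close> lifts to a shift, \<open>S\<^sub>n\<^sub>+\<^sub>1\<^sup>*\<close> lifts to the transfer
  function of a contractive colligation, and the Schaeffer dilation of the latter commutes with all
  other isometries. Hilbert spaces are constructed inside \<^typ>\<open>ell2\<close> by realizing positive
  semidefinite kernels. The von Neumann inequality for commuting isometries follows by averaging over
  roots of unity.
\<close>

section \<open>Complex Hilbert space basics\<close>

text \<open>Three commuting contractions need not have an isometric dilation, so the relations must
  leave only a pair to treat. They say that the norm lost under \<open>S i\<close>, that is
  \<open>(norm x)^2 - (norm (S i x))^2\<close>, does not change when \<open>x\<close> is replaced by
  \<open>S j x\<close> with \<open>j\<close> different from \<open>i\<close>. Taking out factors one
  at a time, the loss under a product of N-th powers becomes the sum of the losses under the single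
  powers. With all n factors the limit is the decomposition of \<open>I\<close>; with the factor j
  omitted it gives a second description of the j-th summand, \<open>I\<close> minus the asymptotic
  limit of \<open>S j\<close>, and this is what makes \<open>S j\<close> pure there. Dilations are
  produced on the adjoint side: an isometry whose adjoint extends \<open>S i\<close> compresses to
  \<open>T i\<close>. Purity of \<open>S j\<close> provides a shift, while the last operator is
  lifted only to a contraction whose adjoint commutes with all the isometries already found; this
  commutation is all that the Schaeffer step requires. The summands are glued on the level of Gram
  kernels: n kernels are added, and only the sum is realized by vectors.\<close>

lemma scaleC_one [simp]: "1 *\<^sub>C (x::'a::complex_hilbert_space) = x"
  using scaleR_scaleC[of 1 x] by simp

lemma scaleC_zero_left [simp]: "0 *\<^sub>C (x::'a::complex_hilbert_space) = 0"
  using scaleR_scaleC[of 0 x] by simp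

lemma scaleC_zero_right [simp]: "c *\<^sub>C (0::'a::complex_hilbert_space) = 0"
  using scaleC_add_right[of c 0 "0::'a"] by simp

lemma scaleC_minus_one: "(-1) *\<^sub>C (x::'a::complex_hilbert_space) = - x"
  using scaleR_scaleC[of "-1" x] by simp

lemma scaleC_minus_right: "c *\<^sub>C (- x::'a::complex_hilbert_space) = - (c *\<^sub>C x)"
  by (metis add_eq_0_iff scaleC_add_right scaleC_zero_right right_minus)

lemma scaleC_diff_right: "c *\<^sub>C (x - y::'a::complex_hilbert_space) = c *\<^sub>C x - c *\<^sub>C y"
  using scaleC_add_right[of c x "- y"] by (simp add: scaleC_minus_right)

lemma cinner_add_right: "cinner x (y + z::'a::complex_hilbert_space) = cinner x y + cinner x z"
  by (metis cinner_add_left cinner_commute complex_cnj_add)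

lemma cinner_scaleC_right: "cinner x (c *\<^sub>C y::'a::complex_hilbert_space) = cnj c * cinner x y"
  by (metis cinner_scaleC_left cinner_commute complex_cnj_mult)

lemma cinner_zero_left [simp]: "cinner 0 (y::'a::complex_hilbert_space) = 0"
  using cinner_add_left[of 0 0 y] by simp

lemma cinner_zero_right [simp]: "cinner (y::'a::complex_hilbert_space) 0 = 0"
  using cinner_add_right[of y 0 0] by simp

lemma cinner_minus_left: "cinner (- x) (y::'a::complex_hilbert_space) = - cinner x y"
  using cinner_add_left[of x "- x" y] by (simp add: eq_neg_iff_add_eq_0 add.commute)

lemma cinner_minus_right: "cinner x (- y::'a::complex_hilbert_space) = - cinner x y"
  using cinner_add_right[of x y "- y"] by (simp add: eq_neg_iff_add_eq_0 add.commute)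

lemma cinner_diff_left: "cinner (x - y) (z::'a::complex_hilbert_space) = cinner x z - cinner y z"
  using cinner_add_left[of x "- y" z] by (simp add: cinner_minus_left)

lemma cinner_diff_right: "cinner x (y - z::'a::complex_hilbert_space) = cinner x y - cinner x z"
  using cinner_add_right[of x y "- z"] by (simp add: cinner_minus_right)

lemmas cinner_simps = cinner_add_left cinner_add_right cinner_diff_left cinner_diff_right
  cinner_scaleC_left cinner_scaleC_right cinner_minus_left cinner_minus_right

lemma cinner_sum_left: "cinner (\<Sum>i\<in>A. f i) (y::'a::complex_hilbert_space) = (\<Sum>i\<in>A. cinner (f i) y)"
  by (induction A rule: infinite_finite_induct) (auto simp: cinner_add_left)

lemma cinner_sum_right: "cinner (y::'a::complex_hilbert_space) (\<Sum>i\<in>A. f i) = (\<Sum>i\<in>A. cinner y (f i))"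
  by (induction A rule: infinite_finite_induct) (auto simp: cinner_add_right)

lemma cinner_self: "cinner x (x::'a::complex_hilbert_space) = complex_of_real ((norm x)\<^sup>2)"
proof -
  have "Im (cinner x x) = 0" using cinner_commute[of x x] by (metis equal_neg_zero cnj.sel(2))
  then show ?thesis
    by (simp add: complex_eq_iff inner_eq_Re_cinner[symmetric] power2_norm_eq_inner)
qed

lemma norm_scaleC: "norm (c *\<^sub>C x::'a::complex_hilbert_space) = cmod c * norm x"
proof -
  have "complex_of_real ((norm (c *\<^sub>C x))\<^sup>2) = (c * cnj c) * complex_of_real ((norm x)\<^sup>2)"
    unfolding cinner_self[symmetric] by (simp add: cinner_simps)
  also have "\<dots> = complex_of_real ((cmod c * norm x)\<^sup>2)"
    by (simp add: complex_norm_square[symmetric] power_mult_distrib)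
  finally have "complex_of_real ((norm (c *\<^sub>C x))\<^sup>2) = complex_of_real ((cmod c * norm x)\<^sup>2)" .
  then show ?thesis by (simp only: of_real_eq_iff) simp
qed

lemma cinner_ext: "(\<And>y. cinner x y = cinner x' y) \<Longrightarrow> x = (x'::'a::complex_hilbert_space)"
  using cinner_self[of "x - x'"] by (simp add: cinner_simps)

lemma cinner_cauchy_schwarz: "cmod (cinner x y) \<le> norm x * norm (y::'a::complex_hilbert_space)"
proof -
  \<comment> \<open>The conjugate phase makes the inner product real and nonnegative, which reduces
    the claim to the real Cauchy-Schwarz inequality. As \<open>sgn 0 = 0\<close>, only
    \<open>cmod s \<le> 1\<close> is available in general.\<close>
  define s where "s = cnj (sgn (cinner x y))"
  have 1: "s * cinner x y = of_real (cmod (cinner x y))"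
    by (cases "cinner x y = 0")
      (simp_all add: s_def sgn_eq complex_norm_square[symmetric] power2_eq_square mult.commute[of "cnj _"])
  have s: "cmod s \<le> 1" unfolding s_def by (simp add: norm_sgn)
  have "cmod (cinner x y) = Re (s * cinner x y)" by (simp add: 1)
  also have "\<dots> = inner (s *\<^sub>C x) y" by (simp add: inner_eq_Re_cinner cinner_simps)
  also have "\<dots> \<le> norm (s *\<^sub>C x) * norm y" by (rule norm_cauchy_schwarz)
  also have "\<dots> \<le> norm x * norm y"
    using s by (simp add: norm_scaleC mult_right_mono mult_left_le_one_le)
  finally show ?thesis .
qed

lemma bounded_bilinear_cinner: "bounded_bilinear (cinner :: 'a::complex_hilbert_space \<Rightarrow> 'a \<Rightarrow> complex)"
  by standard
    (auto simp: cinner_simps scaleR_scaleC scaleR_conv_of_real intro!: exI[of _ 1] cinner_cauchy_schwarz)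

lemmas tendsto_cinner = bounded_bilinear.tendsto[OF bounded_bilinear_cinner]

lemma bounded_linear_scaleC: "bounded_linear (\<lambda>x::'a::complex_hilbert_space. c *\<^sub>C x)"
  by (rule bounded_linear_intro[where K = "cmod c"])
    (simp_all add: scaleC_add_right scaleR_scaleC scaleC_scaleC norm_scaleC mult.commute)

lemma norm_add_squared:
  "(norm (x + y))\<^sup>2 = (norm x)\<^sup>2 + (norm y)\<^sup>2 + 2 * Re (cinner x (y::'a::complex_hilbert_space))"
  by (simp add: power2_norm_eq_inner inner_add_left inner_add_right inner_commute
      inner_eq_Re_cinner[symmetric])

lemma norm_diff_squared:
  "(norm (x - y))\<^sup>2 = (norm x)\<^sup>2 + (norm y)\<^sup>2 - 2 * Re (cinner x (y::'a::complex_hilbert_space))"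
  using norm_add_squared[of x "- y"] by (simp add: cinner_simps)


section \<open>Projections and adjoints\<close>

lemma parallelogram_law: "(norm (x + y))\<^sup>2 + (norm (x - y))\<^sup>2 = 2 * (norm x)\<^sup>2 + 2 * (norm (y::'a::complex_hilbert_space))\<^sup>2"
  by (simp add: norm_add_squared norm_diff_squared)

text \<open>A minimizing sequence for the distance is Cauchy, because the parallelogram law compares
  it with the midpoints, which stay in \<open>K\<close>. Its limit is the foot of the
  perpendicular.\<close>

lemma orthogonal_projection_exists:
  fixes K :: "'a::complex_hilbert_space set"
  assumes K: "closed_csubspace K"
  shows "\<exists>p\<in>K. \<forall>s\<in>K. cinner (x - p) s = 0"
proof -
  define d where "d = (INF y\<in>K. (norm (x - y))\<^sup>2)"
  have K0: "0 \<in> K" and Kadd: "\<And>u v. u \<in> K \<Longrightarrow> v \<in> K \<Longrightarrow> u + v \<in> K"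
    and Ksc: "\<And>c u. u \<in> K \<Longrightarrow> c *\<^sub>C u \<in> K" and Kcl: "closed K"
    using K by (auto simp: closed_csubspace_def)
  have bdd: "bdd_below ((\<lambda>y. (norm (x - y))\<^sup>2) ` K)" by (rule bdd_belowI2[of _ 0]) simp
  have d_le: "d \<le> (norm (x - y))\<^sup>2" if "y \<in> K" for y
    unfolding d_def by (rule cINF_lower[OF bdd that])
  have "\<exists>y\<in>K. (norm (x - y))\<^sup>2 < d + 1 / Suc n" for n
    using cINF_less_iff[OF _ bdd, of "d + 1 / Suc n"] K0 unfolding d_def[symmetric] by auto
  then obtain y where yK: "\<And>n. y n \<in> K" and y: "\<And>n. (norm (x - y n))\<^sup>2 < d + 1 / Suc n" by metis
  have close: "(norm (y m - y n))\<^sup>2 \<le> 4 / Suc N" if "m \<ge> N" "n \<ge> N" for m n N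
  proof -
    have "(1/2) *\<^sub>C (y m + y n) \<in> K" by (intro Ksc Kadd yK)
    then have "d \<le> (norm (x - (1/2) *\<^sub>C (y m + y n)))\<^sup>2" by (rule d_le)
    moreover have "(x - y m) + (x - y n) = 2 *\<^sub>R (x - (1/2) *\<^sub>C (y m + y n))"
      using scaleR_scaleC[of "1/2" "y m + y n", symmetric]
      by (simp add: algebra_simps scaleR_2 flip: scaleR_add_left)
    ultimately have "4 * d \<le> (norm ((x - y m) + (x - y n)))\<^sup>2" by (simp add: power_mult_distrib)
    moreover have "norm ((x - y m) - (x - y n)) = norm (y m - y n)" by (simp add: norm_minus_commute)
    moreover have "1 / Suc m \<le> 1 / Suc N" "1 / Suc n \<le> 1 / Suc N" using that by (auto simp: frac_le)
    ultimately show ?thesis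
      using parallelogram_law[of "x - y m" "x - y n"] y[of m] y[of n] by simp
  qed
  have "Cauchy y"
  proof (rule metric_CauchyI)
    fix e :: real assume "0 < e"
    then obtain N where N: "4 / e\<^sup>2 < Suc N" by (meson reals_Archimedean2 lessI of_nat_less_iff less_trans)
    have "dist (y m) (y n) < e" if "m \<ge> N" "n \<ge> N" for m n
    proof -
      have "4 / Suc N < e\<^sup>2" using N \<open>0 < e\<close> by (simp add: field_simps)
      then have "(norm (y m - y n))\<^sup>2 < e\<^sup>2" using close[OF that] by linarith
      then show ?thesis using \<open>0 < e\<close> by (simp add: dist_norm power2_less_imp_less)
    qed
    then show "\<exists>M. \<forall>m\<ge>M. \<forall>n\<ge>M. dist (y m) (y n) < e" by blast
  qed
  then obtain p where p: "y \<longlonglongrightarrow> p" by (auto simp: Cauchy_convergent_iff convergent_def)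
  have pK: "p \<in> K" using closed_sequentially[OF Kcl _ p] yK by blast
  have "(norm (x - p))\<^sup>2 \<le> d"
  proof (rule LIMSEQ_le)
    show "(\<lambda>n. (norm (x - y n))\<^sup>2) \<longlonglongrightarrow> (norm (x - p))\<^sup>2" by (intro tendsto_intros p)
    show "(\<lambda>n. d + 1 / Suc n) \<longlonglongrightarrow> d" using LIMSEQ_inverse_real_of_nat_add[of d] by (simp add: inverse_eq_divide)
  qed (use y less_imp_le in blast)
  then have min: "(norm (x - p))\<^sup>2 \<le> (norm (x - p - s))\<^sup>2" if "s \<in> K" for s
    using d_le[OF Kadd[OF pK that]] unfolding diff_diff_eq by linarith
  have "cinner (x - p) s = 0" if s: "s \<in> K" for s
  proof (rule ccontr)
    define z where "z = cinner (x - p) s"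
    assume "cinner (x - p) s \<noteq> 0"
    then have z: "z \<noteq> 0" "s \<noteq> 0" by (auto simp: z_def)
    \<comment> \<open>The coefficient that minimizes the distance along \<open>s\<close>: it would
      lower the squared distance by \<open>(cmod z / norm s)^2\<close>.\<close>
    define t where "t = z / of_real ((norm s)\<^sup>2)"
    have "(norm (x - p - t *\<^sub>C s))\<^sup>2 = (norm (x - p))\<^sup>2 + (cmod t * norm s)\<^sup>2 - 2 * Re (cnj t * z)"
      unfolding z_def norm_diff_squared[of "x - p" "t *\<^sub>C s"] norm_scaleC cinner_scaleC_right ..
    moreover have "Re (cnj t * z) = (cmod z)\<^sup>2 / (norm s)\<^sup>2"
      by (simp add: t_def complex_norm_square[symmetric] mult.commute[of "cnj z"] del: of_real_power of_real_divide flip: of_real_divide)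
    moreover have "(cmod t * norm s)\<^sup>2 = (cmod z)\<^sup>2 / (norm s)\<^sup>2"
      using z by (simp add: t_def norm_divide norm_mult norm_power power2_eq_square field_simps)
    moreover have "(cmod z)\<^sup>2 / (norm s)\<^sup>2 > 0" using z by simp
    ultimately show False using min[OF Ksc[OF s, of t]] by linarith
  qed
  with pK show ?thesis by blast
qed

section \<open>Riesz representation, adjoints and contractions\<close>

lemma riesz_representation:
  fixes f :: "'a::complex_hilbert_space \<Rightarrow> complex"
  assumes add: "\<And>x y. f (x + y) = f x + f y" and sc: "\<And>c x. f (c *\<^sub>C x) = c * f x"
    and bd: "\<And>x. cmod (f x) \<le> B * norm x"
  shows "\<exists>y. \<forall>x. f x = cinner x y"
proof (cases "\<forall>x. f x = 0")
  case True
  then show ?thesis by (intro exI[of _ 0]) simp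
next
  case False
  then obtain x where x: "f x \<noteq> 0" by blast
  have bl: "bounded_linear f"
    by (rule bounded_linear_intro[where K = B])
      (use add sc bd in \<open>auto simp: scaleR_scaleC scaleR_conv_of_real mult.commute\<close>)
  have "closed_csubspace {x. f x = 0}"
    unfolding closed_csubspace_def
    using closed_Collect_eq[OF linear_continuous_on[OF bl] continuous_on_const] linear_0[OF bounded_linear.linear[OF bl]]
    by (auto simp: add sc)
  from orthogonal_projection_exists[OF this, of x] obtain p
    where p: "f p = 0" and orth: "\<And>s. f s = 0 \<Longrightarrow> cinner (x - p) s = 0" by auto
  \<comment> \<open>\<open>u\<close> spans the orthogonal complement of the kernel of
    \<open>f\<close>, so every \<open>z\<close> differs from a multiple of \<open>u\<close> by an
    element of the kernel.\<close>
  define u where "u = x - p"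
  have fu: "f u \<noteq> 0" using x p linear_diff[OF bounded_linear.linear[OF bl]] by (simp add: u_def)
  then have u0: "cinner u u \<noteq> 0" using linear_0[OF bounded_linear.linear[OF bl]] by (auto simp: cinner_self)
  have "f z = cinner z ((cnj (f u) / cnj (cinner u u)) *\<^sub>C u)" for z
  proof -
    have "f (z - (f z / f u) *\<^sub>C u) = 0"
      using fu linear_diff[OF bounded_linear.linear[OF bl]] by (simp add: sc)
    then have "cinner u (z - (f z / f u) *\<^sub>C u) = 0" using orth by (simp add: u_def)
    then have "cinner (z - (f z / f u) *\<^sub>C u) u = 0" by (metis cinner_commute complex_cnj_zero)
    then have "cinner z u = f z / f u * cinner u u" by (simp add: cinner_simps)
    then show ?thesis using fu u0 by (simp add: cinner_simps)
  qed
  then show ?thesis by blast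
qed

lemma bounded_clinearD:
  assumes "bounded_clinear T"
  shows "T (x + y) = T x + T y" "T (c *\<^sub>C x) = c *\<^sub>C T x" "T (x - y) = T x - T y" "T 0 = 0"
    "T (- x) = - T x" "bounded_linear T"
proof -
  have bl: "bounded_linear T" and c: "T (c *\<^sub>C x) = c *\<^sub>C T x" using assms by (auto simp: bounded_clinear_def)
  note l = bounded_linear.linear[OF bl]
  show "T (x + y) = T x + T y" "T (c *\<^sub>C x) = c *\<^sub>C T x" "T (x - y) = T x - T y" "T 0 = 0" "T (- x) = - T x" "bounded_linear T"
    using linear_add[OF l] linear_diff[OF l] linear_0[OF l] linear_neg[OF l] c bl by auto
qed

lemma bounded_clinear_sum:
  "bounded_clinear T \<Longrightarrow> T (\<Sum>i\<in>A. f i) = (\<Sum>i\<in>A. T (f i))"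
  using bounded_clinearD(6) bounded_linear.linear linear_sum by blast

lemma bounded_clinearI:
  assumes "\<And>x y. T (x + y) = T x + T y" "\<And>c x. T (c *\<^sub>C x) = c *\<^sub>C T x" "\<And>x. norm (T x) \<le> B * norm x"
  shows "bounded_clinear T"
  unfolding bounded_clinear_def
  by (intro conjI allI bounded_linear_intro[where K = B]) (use assms in \<open>auto simp: scaleR_scaleC mult.commute\<close>)

lemma bounded_clinear_compose: "bounded_clinear S \<Longrightarrow> bounded_clinear T \<Longrightarrow> bounded_clinear (\<lambda>x. S (T x))"
  unfolding bounded_clinear_def by (auto intro: bounded_linear_compose)

lemma bounded_clinear_add: "bounded_clinear S \<Longrightarrow> bounded_clinear T \<Longrightarrow> bounded_clinear (\<lambda>x. S x + T x)"
  unfolding bounded_clinear_def by (auto intro: bounded_linear_add simp: scaleC_add_right)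

lemma bounded_clinear_diff: "bounded_clinear S \<Longrightarrow> bounded_clinear T \<Longrightarrow> bounded_clinear (\<lambda>x. S x - T x)"
  unfolding bounded_clinear_def by (auto intro: bounded_linear_sub simp: scaleC_diff_right)

lemma bounded_clinear_zero: "bounded_clinear (\<lambda>x. 0)"
  unfolding bounded_clinear_def by (auto intro: bounded_linear_zero)

lemma bounded_clinear_ident: "bounded_clinear (\<lambda>x. x)"
  unfolding bounded_clinear_def by (auto intro: bounded_linear_ident)

text \<open>Riesz gives existence and nondegeneracy gives uniqueness, so the definite description in
  \<open>cadjoint\<close> denotes the adjoint.\<close>

lemma cinner_adjoint:
  assumes "bounded_clinear T"
  shows "cinner (T x) y = cinner x (cadjoint T y)"
proof -
  obtain B where B: "\<And>x. norm (T x) \<le> norm x * B"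
    using bounded_linear.bounded[OF bounded_clinearD(6)[OF assms]] by blast
  have "\<exists>z. \<forall>x. cinner (T x) y = cinner x z" for y
  proof (rule riesz_representation)
    show "cmod (cinner (T x) y) \<le> (B * norm y) * norm x" for x
    proof -
      have "cmod (cinner (T x) y) \<le> norm (T x) * norm y" by (rule cinner_cauchy_schwarz)
      also have "\<dots> \<le> (norm x * B) * norm y" by (intro mult_right_mono B) auto
      finally show ?thesis by (simp add: mult_ac)
    qed
  qed (simp_all add: bounded_clinearD[OF assms] cinner_simps)
  then obtain S where S: "\<forall>x y. cinner (T x) y = cinner x (S y)" by metis
  have "\<forall>x y. cinner (T x) y = cinner x (cadjoint T y)"
    unfolding cadjoint_def
  proof (rule theI[of _ S])
    fix S' assume "\<forall>x y. cinner (T x) y = cinner x (S' y)"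
    with S have "cinner (S' y) x = cinner (S y) x" for x y by (metis cinner_commute)
    then show "S' = S" by (intro ext cinner_ext)
  qed (rule S)
  then show ?thesis by blast
qed

lemma cinner_adjoint':
  assumes "bounded_clinear T"
  shows "cinner (cadjoint T x) y = cinner x (T y)"
  using cinner_adjoint[OF assms, of y x] by (metis cinner_commute)

lemma cadjoint_eqI:
  assumes "\<And>x y. cinner (T x) y = cinner x (S y)"
  shows "cadjoint T = S"
  unfolding cadjoint_def
proof (rule the_equality)
  fix S' assume "\<forall>x y. cinner (T x) y = cinner x (S' y)"
  with assms have "cinner (S' y) x = cinner (S y) x" for x y by (metis cinner_commute)
  then show "S' = S" by (intro ext cinner_ext)
qed (use assms in blast)

definition nonexpansive :: "('a::complex_hilbert_space \<Rightarrow> 'b::complex_hilbert_space) \<Rightarrow> bool"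
  where "nonexpansive T \<longleftrightarrow> bounded_clinear T \<and> (\<forall>x. norm (T x) \<le> norm x)"

lemma contraction_iff_nonexpansive: "contraction T \<longleftrightarrow> nonexpansive T"
proof
  assume "contraction T"
  then have T: "bounded_clinear T" "onorm T \<le> 1" by (auto simp: contraction_def)
  have "norm (T x) \<le> norm x" for x
    using onorm[OF bounded_clinearD(6)[OF T(1)], of x] mult_right_mono[OF T(2), of "norm x"] by simp
  with T show "nonexpansive T" by (simp add: nonexpansive_def)
next
  assume "nonexpansive T"
  then show "contraction T" by (auto simp: contraction_def nonexpansive_def intro!: onorm_bound)
qed

lemma nonexpansiveI:
  assumes "\<And>x y. T (x + y) = T x + T y" "\<And>c x. T (c *\<^sub>C x) = c *\<^sub>C T x" "\<And>x. norm (T x) \<le> norm x"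
  shows "nonexpansive T"
  using assms bounded_clinearI[of T 1] by (simp add: nonexpansive_def)

lemma nonexpansive_norm: "nonexpansive T \<Longrightarrow> norm (T x) \<le> norm x"
  by (simp add: nonexpansive_def)

lemma nonexpansive_bounded_clinear: "nonexpansive T \<Longrightarrow> bounded_clinear T"
  by (simp add: nonexpansive_def)

lemmas nonexpansiveD = bounded_clinearD[OF nonexpansive_bounded_clinear]

lemma nonexpansive_adjoint:
  assumes "nonexpansive T"
  shows "nonexpansive (cadjoint T)"
proof (rule nonexpansiveI)
  have T: "bounded_clinear T" using assms by (simp add: nonexpansive_def)
  note a = cinner_adjoint'[OF T]
  show "cadjoint T (x + y) = cadjoint T x + cadjoint T y" for x y
    by (rule cinner_ext) (simp add: a cinner_simps)
  show "cadjoint T (c *\<^sub>C x) = c *\<^sub>C cadjoint T x" for c x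
    by (rule cinner_ext) (simp add: a cinner_simps)
  show "norm (cadjoint T x) \<le> norm x" for x
  proof (cases "cadjoint T x = 0")
    case False
    have "(norm (cadjoint T x))\<^sup>2 = cmod (cinner (cadjoint T x) (cadjoint T x))"
      by (simp add: cinner_self norm_power)
    also have "\<dots> = cmod (cinner x (T (cadjoint T x)))" by (simp add: a)
    also have "\<dots> \<le> norm x * norm (T (cadjoint T x))" by (rule cinner_cauchy_schwarz)
    also have "\<dots> \<le> norm x * norm (cadjoint T x)" by (intro mult_left_mono nonexpansive_norm assms) auto
    finally show ?thesis using False by (simp add: power2_eq_square)
  qed simp
qed

lemma nonexpansive_compose: "nonexpansive S \<Longrightarrow> nonexpansive T \<Longrightarrow> nonexpansive (\<lambda>x. S (T x))"
  unfolding nonexpansive_def by (auto intro: bounded_clinear_compose order_trans)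

lemma nonexpansive_funpow: "nonexpansive (T::'a::complex_hilbert_space \<Rightarrow> 'a) \<Longrightarrow> nonexpansive (T ^^ k)"
proof (induction k)
  case 0
  show ?case by (rule nonexpansiveI) simp_all
next
  case (Suc k)
  then show ?case using nonexpansive_compose[of T "T ^^ k"] by (simp add: o_def)
qed

text \<open>Norms of sums determine the real part of the inner product; the imaginary part is the
  real part with \<open>y\<close> multiplied by the imaginary unit.\<close>

lemma cinner_polarization_eq:
  fixes f g :: "'x \<Rightarrow> 'b::complex_hilbert_space"
  assumes norm: "\<And>u :: 'a::complex_hilbert_space. norm (S u) = norm (R u)"
    and S: "bounded_clinear S" and R: "bounded_clinear R"
  shows "cinner (S x) (S y) = cinner (R x) (R y)"
proof (rule complex_eqI)
  have re: "Re (cinner (S x) (S y)) = Re (cinner (R x) (R y))" for x y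
    using norm_add_squared[of "S x" "S y"] norm_add_squared[of "R x" "R y"] norm[of "x + y"]
    by (simp add: norm bounded_clinearD[OF S] bounded_clinearD[OF R])
  show "Re (cinner (S x) (S y)) = Re (cinner (R x) (R y))" by (rule re)
  show "Im (cinner (S x) (S y)) = Im (cinner (R x) (R y))"
    using re[of x "\<i> *\<^sub>C y"] by (simp add: bounded_clinearD[OF S] bounded_clinearD[OF R] cinner_simps)
qed

section \<open>Extending operators from a generating family\<close>

text \<open>Formal combinations are lists with repetitions allowed: addition is concatenation, and
  proofs go by list induction without normal forms.\<close>

definition lin_comb :: "('x \<Rightarrow> 'a::complex_hilbert_space) \<Rightarrow> (complex \<times> 'x) list \<Rightarrow> 'a"
  where "lin_comb v xs = (\<Sum>(c, x)\<leftarrow>xs. c *\<^sub>C v x)"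

lemma lin_comb_Nil [simp]: "lin_comb v [] = 0"
  and lin_comb_Cons [simp]: "lin_comb v ((c, x) # xs) = c *\<^sub>C v x + lin_comb v xs"
  and lin_comb_append [simp]: "lin_comb v (xs @ ys) = lin_comb v xs + lin_comb v ys"
  by (simp_all add: lin_comb_def)

definition lc_scale :: "complex \<Rightarrow> (complex \<times> 'x) list \<Rightarrow> (complex \<times> 'x) list"
  where "lc_scale d = map (\<lambda>(c, x). (d * c, x))"

lemma lin_comb_scale [simp]: "lin_comb v (lc_scale d xs) = d *\<^sub>C lin_comb v xs"
  by (induction xs) (auto simp: lc_scale_def scaleC_add_right scaleC_scaleC)

lemma bounded_clinear_lin_comb:
  "bounded_clinear T \<Longrightarrow> T (lin_comb v xs) = lin_comb (\<lambda>x. T (v x)) xs"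
  by (induction xs) (auto simp: bounded_clinearD)

lemma cinner_lin_comb_zero: "(\<And>x. cinner u (v x) = 0) \<Longrightarrow> cinner u (lin_comb v xs) = 0"
  by (induction xs) (auto simp: cinner_simps)

lemma closed_csubspace_closure_lin_comb:
  fixes v :: "'x \<Rightarrow> 'a::complex_hilbert_space"
  shows "closed_csubspace (closure (range (lin_comb v)))"
proof -
  have "lin_comb v [] \<in> range (lin_comb v)" by (rule rangeI)
  then have 0: "0 \<in> closure (range (lin_comb v))" using closure_subset[of "range (lin_comb v)"] by auto
  have add: "x + y \<in> closure (range (lin_comb v))"
    if x: "x \<in> closure (range (lin_comb v))" and y: "y \<in> closure (range (lin_comb v))" for x y
  proof -
    obtain X where X: "\<And>n. X n \<in> range (lin_comb v)" "X \<longlonglongrightarrow> x"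
      using x unfolding closure_sequential by blast
    obtain Y where Y: "\<And>n. Y n \<in> range (lin_comb v)" "Y \<longlonglongrightarrow> y"
      using y unfolding closure_sequential by blast
    have "X n + Y n \<in> range (lin_comb v)" for n
    proof -
      obtain xs ys where "X n = lin_comb v xs" "Y n = lin_comb v ys" using X(1)[of n] Y(1)[of n] by blast
      then have "X n + Y n = lin_comb v (xs @ ys)" by simp
      then show ?thesis by blast
    qed
    then show ?thesis
      unfolding closure_sequential using tendsto_add[OF X(2) Y(2)] by (intro exI[of _ "\<lambda>n. X n + Y n"]) blast
  qed
  have scale: "c *\<^sub>C x \<in> closure (range (lin_comb v))"
    if x: "x \<in> closure (range (lin_comb v))" for c x
  proof -
    obtain X where X: "\<And>n. X n \<in> range (lin_comb v)" "X \<longlonglongrightarrow> x"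
      using x unfolding closure_sequential by blast
    have "c *\<^sub>C X n \<in> range (lin_comb v)" for n
    proof -
      obtain xs where "X n = lin_comb v xs" using X(1)[of n] by blast
      then have "c *\<^sub>C X n = lin_comb v (lc_scale c xs)" by simp
      then show ?thesis by blast
    qed
    moreover have "(\<lambda>n. c *\<^sub>C X n) \<longlonglongrightarrow> c *\<^sub>C x"
      by (rule bounded_linear.tendsto[OF bounded_linear_scaleC X(2)])
    ultimately show ?thesis
      unfolding closure_sequential by (intro exI[of _ "\<lambda>n. c *\<^sub>C X n"]) blast
  qed
  from 0 add scale show ?thesis by (simp add: closed_csubspace_def)
qed

text \<open>Projection onto the closed span of \<open>v\<close>, with the projected vector presented
  as a limit of combinations so that operators can be evaluated on it termwise.\<close>

lemma lin_comb_decomposition: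
  fixes v :: "'x \<Rightarrow> 'a::complex_hilbert_space"
  obtains X u where "(\<lambda>n. lin_comb v (X n)) \<longlonglongrightarrow> y - u" and "\<And>x. cinner u (v x) = 0"
    and "cinner u (y - u) = 0"
proof -
  obtain p where p: "p \<in> closure (range (lin_comb v))"
    and orth: "\<And>s. s \<in> closure (range (lin_comb v)) \<Longrightarrow> cinner (y - p) s = 0"
    using orthogonal_projection_exists[OF closed_csubspace_closure_lin_comb, of v y] by blast
  from p obtain P where P: "\<And>n. P n \<in> range (lin_comb v)" "P \<longlonglongrightarrow> p"
    unfolding closure_sequential by blast
  have "\<exists>xs. P n = lin_comb v xs" for n using P(1)[of n] by blast
  then obtain X where X: "\<And>n. P n = lin_comb v (X n)" by metis
  have lim: "(\<lambda>n. lin_comb v (X n)) \<longlonglongrightarrow> y - (y - p)"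
    using P(2) by (simp add: X[symmetric])
  have "v x \<in> range (lin_comb v)" for x
    by (rule range_eqI[of _ _ "[(1, x)]"]) simp
  then have "v x \<in> closure (range (lin_comb v))" for x
    using closure_subset by blast
  then have perp: "cinner (y - p) (v x) = 0" for x by (rule orth)
  have "cinner (y - p) (y - (y - p)) = 0" using orth[OF p] by simp
  with lim perp show thesis by (rule that)
qed

text \<open>The family \<open>v\<close> is not assumed to be total, so agreement on its orthogonal
  complement is a separate obligation.\<close>

lemma bounded_clinear_eqI:
  fixes v :: "'x \<Rightarrow> 'a::complex_hilbert_space"
  assumes S: "bounded_clinear S" and T: "bounded_clinear T"
    and v: "\<And>x. S (v x) = T (v x)"
    and perp: "\<And>u. (\<And>x. cinner u (v x) = 0) \<Longrightarrow> S u = T u"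
  shows "S y = T y"
proof -
  obtain X u where X: "(\<lambda>n. lin_comb v (X n)) \<longlonglongrightarrow> y - u" and u: "\<And>x. cinner u (v x) = 0"
    using lin_comb_decomposition[of v y] by metis
  have "(\<lambda>n. S (lin_comb v (X n))) \<longlonglongrightarrow> S (y - u)" "(\<lambda>n. T (lin_comb v (X n))) \<longlonglongrightarrow> T (y - u)"
    by (rule bounded_linear.tendsto[OF bounded_clinearD(6)[OF S] X]
        bounded_linear.tendsto[OF bounded_clinearD(6)[OF T] X])+
  moreover have "(\<lambda>n. S (lin_comb v (X n))) = (\<lambda>n. T (lin_comb v (X n)))"
    by (simp add: bounded_clinear_lin_comb[OF S] bounded_clinear_lin_comb[OF T] v)
  ultimately have "S (y - u) = T (y - u)" using LIMSEQ_unique by metis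
  with perp[OF u] show ?thesis by (simp add: bounded_clinearD[OF S] bounded_clinearD[OF T])
qed

text \<open>The inequality makes the assignment of \<open>w x\<close> to \<open>v x\<close> well
  defined on the span as well as contractive. It then extends by continuity to the closed span and
  by zero to the complement.\<close>

lemma contraction_extension:
  fixes v :: "'x \<Rightarrow> 'a::complex_hilbert_space" and w :: "'x \<Rightarrow> 'b::complex_hilbert_space"
  assumes le: "\<And>xs. norm (lin_comb w xs) \<le> norm (lin_comb v xs)"
  shows "\<exists>T. nonexpansive T \<and> (\<forall>x. T (v x) = w x) \<and> (\<forall>u. (\<forall>x. cinner u (v x) = 0) \<longrightarrow> T u = 0)"
proof -
  \<comment> \<open>The closure of the graph on the span. Working with a relation avoids choosing a
    representation of each vector as a combination.\<close>
  define good where "good p q \<longleftrightarrow> (\<exists>X. (\<lambda>n. lin_comb v (X n)) \<longlonglongrightarrow> p \<and> (\<lambda>n. lin_comb w (X n)) \<longlonglongrightarrow> q)" for p q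
  have good_add: "good (p + p') (q + q')" if g: "good p q" "good p' q'" for p p' q q'
  proof -
    obtain X Y where "(\<lambda>n. lin_comb v (X n)) \<longlonglongrightarrow> p" "(\<lambda>n. lin_comb w (X n)) \<longlonglongrightarrow> q"
      "(\<lambda>n. lin_comb v (Y n)) \<longlonglongrightarrow> p'" "(\<lambda>n. lin_comb w (Y n)) \<longlonglongrightarrow> q'"
      using g unfolding good_def by blast
    then show ?thesis unfolding good_def
      by (intro exI[of _ "\<lambda>n. X n @ Y n"]) (auto intro: tendsto_add)
  qed
  have good_scale: "good (c *\<^sub>C p) (c *\<^sub>C q)" if g: "good p q" for c p q
  proof -
    obtain X where "(\<lambda>n. lin_comb v (X n)) \<longlonglongrightarrow> p" "(\<lambda>n. lin_comb w (X n)) \<longlonglongrightarrow> q"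
      using g unfolding good_def by blast
    then show ?thesis unfolding good_def
      by (intro exI[of _ "\<lambda>n. lc_scale c (X n)"])
        (auto intro: bounded_linear.tendsto[OF bounded_linear_scaleC])
  qed
  have good_norm: "norm q \<le> norm p" if "good p q" for p q
  proof -
    obtain X where X: "(\<lambda>n. lin_comb v (X n)) \<longlonglongrightarrow> p" "(\<lambda>n. lin_comb w (X n)) \<longlonglongrightarrow> q"
      using \<open>good p q\<close> unfolding good_def by blast
    show ?thesis by (rule LIMSEQ_le[OF tendsto_norm[OF X(2)] tendsto_norm[OF X(1)]]) (use le in blast)
  qed
  have good_diff: "good (p - p') (q - q')" if "good p q" "good p' q'" for p p' q q'
    using good_add[OF that(1) good_scale[OF that(2), of "-1"]] by (simp add: scaleC_minus_one)
  \<comment> \<open>The orthogonal part \<open>u\<close> of \<open>y\<close> is discarded; this is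
    the extension by zero.\<close>
  define rel where "rel y q \<longleftrightarrow> (\<exists>u. good (y - u) q \<and> (\<forall>x. cinner u (v x) = 0) \<and> cinner u (y - u) = 0)" for y q
  have perp_good: "cinner u p = 0" if u: "\<And>x. cinner u (v x) = 0" and g: "good p q" for u p q
  proof -
    obtain X where X: "(\<lambda>n. lin_comb v (X n)) \<longlonglongrightarrow> p" using g unfolding good_def by blast
    have "(\<lambda>n. cinner u (lin_comb v (X n))) \<longlonglongrightarrow> cinner u p" by (intro tendsto_cinner X tendsto_const)
    then show ?thesis using cinner_lin_comb_zero[of u v] u by (simp add: LIMSEQ_const_iff)
  qed
  have rel_norm: "norm q \<le> norm y" if "rel y q" for y q
  proof -
    obtain u where u: "good (y - u) q" "cinner u (y - u) = 0" using \<open>rel y q\<close> unfolding rel_def by blast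
    have "(norm y)\<^sup>2 = (norm (u + (y - u)))\<^sup>2" by simp
    also have "\<dots> = (norm u)\<^sup>2 + (norm (y - u))\<^sup>2" unfolding norm_add_squared using u by simp
    finally have "(norm (y - u))\<^sup>2 \<le> (norm y)\<^sup>2" by simp
    then show ?thesis using good_norm[OF u(1)] by (meson norm_ge_zero order_trans power2_le_imp_le)
  qed
  have rel_add: "rel (y + y') (q + q')" if r: "rel y q" "rel y' q'" for y y' q q'
  proof -
    obtain u u'
      where u: "good (y - u) q" "\<And>x. cinner u (v x) = 0" "good (y' - u') q'" "\<And>x. cinner u' (v x) = 0"
      using r unfolding rel_def by blast
    have g: "good (y + y' - (u + u')) (q + q')" using good_add[OF u(1,3)] by (simp add: algebra_simps)
    moreover have p: "cinner (u + u') (v x) = 0" for x using u by (simp add: cinner_simps)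
    ultimately show ?thesis unfolding rel_def using perp_good[OF p g] by blast
  qed
  have rel_scale: "rel (c *\<^sub>C y) (c *\<^sub>C q)" if r: "rel y q" for c y q
  proof -
    obtain u where u: "good (y - u) q" "\<And>x. cinner u (v x) = 0"
      using r unfolding rel_def by blast
    have g: "good (c *\<^sub>C y - c *\<^sub>C u) (c *\<^sub>C q)" using good_scale[OF u(1)] by (simp add: scaleC_diff_right)
    moreover have p: "cinner (c *\<^sub>C u) (v x) = 0" for x using u by (simp add: cinner_simps)
    ultimately show ?thesis unfolding rel_def using perp_good[OF p g] by blast
  qed
  \<comment> \<open>By linearity the difference of two values is related to \<open>0\<close>, and
    the norm bound then makes it vanish.\<close>
  have rel_unique: "q = q'" if "rel y q" "rel y q'" for y q q'
  proof -
    have "rel (y + (-1) *\<^sub>C y) (q + (-1) *\<^sub>C q')" by (intro rel_add rel_scale that)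
    then have "rel 0 (q - q')" by (simp add: scaleC_minus_one)
    from rel_norm[OF this] show ?thesis by simp
  qed
  have rel_v: "rel (v x) (w x)" for x
    unfolding rel_def good_def by (intro exI[of _ 0] conjI exI[of _ "\<lambda>_. [(1, x)]"]) simp_all
  have rel_perp: "rel u 0" if "\<forall>x. cinner u (v x) = 0" for u
    unfolding rel_def good_def using that by (intro exI[of _ u] conjI exI[of _ "\<lambda>_. []"]) simp_all
  have rel_ex: "\<exists>q. rel y q" for y
  proof -
    obtain X u
      where X: "(\<lambda>n. lin_comb v (X n)) \<longlonglongrightarrow> y - u" and u: "\<And>x. cinner u (v x) = 0" "cinner u (y - u) = 0"
      using lin_comb_decomposition[of v y] by metis
    have d: "dist (lin_comb w (X m)) (lin_comb w (X n)) \<le> dist (lin_comb v (X m)) (lin_comb v (X n))" for m n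
      using le[of "X m @ lc_scale (-1) (X n)"] by (simp add: dist_norm scaleC_minus_one)
    have "Cauchy (\<lambda>n. lin_comb v (X n))" using X by (rule LIMSEQ_imp_Cauchy)
    then have "Cauchy (\<lambda>n. lin_comb w (X n))" unfolding Cauchy_def by (meson d le_less_trans)
    then obtain q where "(\<lambda>n. lin_comb w (X n)) \<longlonglongrightarrow> q" by (auto simp: Cauchy_convergent_iff convergent_def)
    then show ?thesis using X u unfolding rel_def good_def by blast
  qed
  then obtain T where T: "\<And>y. rel y (T y)" by metis
  have "nonexpansive T"
    by (rule nonexpansiveI) (meson T rel_unique rel_add rel_scale rel_norm)+
  then show ?thesis using T rel_v rel_perp rel_unique by blast
qed

text \<open>If the index set is itself a vector space and both families are linear, a combination of
  values is a single value, so the bound is needed only pointwise. This is the Douglas factorization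
  of \<open>w\<close> through \<open>v\<close>.\<close>

lemma contraction_extension_linear:
  fixes v :: "'c::complex_hilbert_space \<Rightarrow> 'a::complex_hilbert_space" and w :: "'c \<Rightarrow> 'b::complex_hilbert_space"
  assumes v: "bounded_clinear v" and w: "bounded_clinear w" and le: "\<And>x. norm (w x) \<le> norm (v x)"
  shows "\<exists>T. nonexpansive T \<and> (\<forall>x. T (v x) = w x) \<and> (\<forall>u. (\<forall>x. cinner u (v x) = 0) \<longrightarrow> T u = 0)"
proof (rule contraction_extension)
  show "norm (lin_comb w xs) \<le> norm (lin_comb v xs)" for xs
    using le[of "lin_comb (\<lambda>x. x) xs"]
    by (simp add: bounded_clinear_lin_comb[OF v] bounded_clinear_lin_comb[OF w])
qed

lemma cinner_lin_comb_cong: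
  assumes "\<And>x y. cinner (w x) (w y) = cinner (v x) (v y)"
  shows "cinner (lin_comb w xs) (lin_comb w ys) = cinner (lin_comb v xs) (lin_comb v ys)"
proof -
  have "cinner (w x) (lin_comb w ys) = cinner (v x) (lin_comb v ys)" for x
    by (induction ys) (auto simp: cinner_simps assms)
  then show ?thesis by (induction xs) (auto simp: cinner_simps)
qed

lemma norm_eq_cinner: "cinner x x = cinner y y \<Longrightarrow> norm (x::'a::complex_hilbert_space) = norm (y::'b::complex_hilbert_space)"
  by (simp add: cinner_self del: of_real_power)

section \<open>Isometries and their extension\<close>

definition isometric :: "('a::complex_hilbert_space \<Rightarrow> 'b::complex_hilbert_space) \<Rightarrow> bool"
  where "isometric V \<longleftrightarrow> bounded_clinear V \<and> (\<forall>x. norm (V x) = norm x)"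

lemma isometric_cinner: "isometric V \<Longrightarrow> cinner (V x) (V y) = cinner x y"
  using cinner_polarization_eq[of V "\<lambda>x. x" x y] by (simp add: isometric_def bounded_clinear_ident)

lemma isometric_nonexpansive: "isometric V \<Longrightarrow> nonexpansive V"
  by (simp add: isometric_def nonexpansive_def)

text \<open>Extension by zero would not be isometric, so the identity is used on the complement of
  the span: \<open>V = T + (I - P)\<close>, with \<open>P\<close> the projection. Since the images
  are again members of the family, the two parts remain orthogonal.\<close>

lemma isometric_extension:
  fixes v :: "'x \<Rightarrow> 'a::complex_hilbert_space" and \<sigma> :: "'x \<Rightarrow> 'x"
  assumes \<sigma>: "\<And>x y. cinner (v (\<sigma> x)) (v (\<sigma> y)) = cinner (v x) (v y)"
  shows "\<exists>V. isometric V \<and> (\<forall>x. V (v x) = v (\<sigma> x)) \<and> (\<forall>u. (\<forall>x. cinner u (v x) = 0) \<longrightarrow> V u = u)"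
proof -
  define w where "w x = v (\<sigma> x)" for x
  have cin: "cinner (lin_comb w xs) (lin_comb w ys) = cinner (lin_comb v xs) (lin_comb v ys)" for xs ys
    by (rule cinner_lin_comb_cong) (simp add: w_def \<sigma>)
  have "norm (lin_comb w xs) \<le> norm (lin_comb v xs)" for xs
    by (rule eq_refl[OF norm_eq_cinner[OF cin]])
  from contraction_extension[OF this] obtain T where T: "nonexpansive T" "\<And>x. T (v x) = w x"
    "\<And>u. (\<And>x. cinner u (v x) = 0) \<Longrightarrow> T u = 0" by blast
  from contraction_extension[OF order_refl, of v] obtain P where P: "nonexpansive P" "\<And>x. P (v x) = v x"
    "\<And>u. (\<And>x. cinner u (v x) = 0) \<Longrightarrow> P u = 0" by blast
  define V where "V y = T y + (y - P y)" for y
  have bcV: "bounded_clinear V"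
    unfolding V_def
    by (intro bounded_clinear_add bounded_clinear_diff bounded_clinear_ident nonexpansive_bounded_clinear T P)
  have Vv: "V (v x) = w x" for x by (simp add: V_def T P)
  have Vu: "V u = u" if "\<And>x. cinner u (v x) = 0" for u using T(3) P(3) that by (simp add: V_def)
  have "norm (V y) = norm y" for y
  proof -
    obtain X u where X: "(\<lambda>n. lin_comb v (X n)) \<longlonglongrightarrow> y - u" and u: "\<And>x. cinner u (v x) = 0"
      using lin_comb_decomposition[of v y] by metis
    have "(\<lambda>n. V (lin_comb v (X n))) \<longlonglongrightarrow> V (y - u)"
      by (rule bounded_linear.tendsto[OF bounded_clinearD(6)[OF bcV] X])
    moreover have "V (lin_comb v (X n)) = lin_comb w (X n)" for n
      unfolding bounded_clinear_lin_comb[OF bcV] Vv ..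
    moreover have "V (y - u) = V y - u"
      unfolding bounded_clinearD(3)[OF bcV] Vu[OF u] ..
    ultimately have "(\<lambda>n. lin_comb w (X n)) \<longlonglongrightarrow> V y - u" by simp
    then have 1: "(\<lambda>n. norm (u + lin_comb w (X n))) \<longlonglongrightarrow> norm (u + (V y - u))"
      by (intro tendsto_intros)
    have 2: "(\<lambda>n. norm (u + lin_comb v (X n))) \<longlonglongrightarrow> norm (u + (y - u))"
      by (intro tendsto_intros X)
    \<comment> \<open>The values \<open>w x\<close> belong to the family \<open>v\<close>, so
      \<open>u\<close> is orthogonal to them too and Pythagoras gives the same norm before and
      after.\<close>
    have "cinner u (w x) = 0" for x by (simp add: w_def u)
    then have "(norm (u + lin_comb w (X n)))\<^sup>2 = (norm (u + lin_comb v (X n)))\<^sup>2" for n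
      using cinner_lin_comb_zero[of u w "X n"] cinner_lin_comb_zero[of u v "X n"] u
      by (simp add: norm_add_squared norm_eq_cinner[OF cin])
    then have "norm (u + lin_comb w (X n)) = norm (u + lin_comb v (X n))" for n
      by simp
    with 1 have "(\<lambda>n. norm (u + lin_comb v (X n))) \<longlonglongrightarrow> norm (u + (V y - u))" by simp
    from LIMSEQ_unique[OF this 2] have "norm (u + (V y - u)) = norm (u + (y - u))" .
    then show ?thesis by simp
  qed
  then have "isometric V" using bcV by (simp add: isometric_def)
  with Vv Vu show ?thesis unfolding w_def by blast
qed

section \<open>Realizing positive semidefinite kernels by vectors\<close>

definition kernel_form :: "('x \<Rightarrow> 'x \<Rightarrow> complex) \<Rightarrow> (complex \<times> 'x) list \<Rightarrow> (complex \<times> 'x) list \<Rightarrow> complex"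
  where "kernel_form k xs ys = (\<Sum>(c, x)\<leftarrow>xs. \<Sum>(d, y)\<leftarrow>ys. c * cnj d * k x y)"

definition psd_kernel :: "('x \<Rightarrow> 'x \<Rightarrow> complex) \<Rightarrow> bool"
  where "psd_kernel k \<longleftrightarrow> (\<forall>x y. k x y = cnj (k y x)) \<and> (\<forall>xs. 0 \<le> Re (kernel_form k xs xs))"

lemma psd_kernelD:
  assumes "psd_kernel k"
  shows "k x y = cnj (k y x)" "0 \<le> Re (kernel_form k xs xs)"
  using assms unfolding psd_kernel_def by blast+

lemma kernel_form_Nil [simp]: "kernel_form k [] ys = 0" "kernel_form k xs [] = 0"
  by (simp_all add: kernel_form_def case_prod_unfold)

lemma kernel_form_Cons_left:
  "kernel_form k ((c, x) # xs) ys = c * kernel_form k [(1, x)] ys + kernel_form k xs ys"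
  by (simp add: kernel_form_def case_prod_unfold sum_list_const_mult[symmetric] mult.assoc)

lemma kernel_form_append_left: "kernel_form k (xs @ ys) zs = kernel_form k xs zs + kernel_form k ys zs"
  by (simp add: kernel_form_def)

lemma kernel_form_append_right: "kernel_form k zs (xs @ ys) = kernel_form k zs xs + kernel_form k zs ys"
  by (simp add: kernel_form_def case_prod_unfold sum_list_addf)

lemma kernel_form_Cons_right:
  "kernel_form k zs ((c, x) # xs) = cnj c * kernel_form k zs [(1, x)] + kernel_form k zs xs"
  by (simp add: kernel_form_def case_prod_unfold sum_list_addf sum_list_const_mult[symmetric] mult_ac)

lemma kernel_form_single: "kernel_form k [(c, x)] [(d, y)] = c * cnj d * k x y"
  by (simp add: kernel_form_def)

lemma kernel_form_hermitian:
  assumes "\<And>x y. k x y = cnj (k y x)"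
  shows "kernel_form k ys xs = cnj (kernel_form k xs ys)"
proof -
  have 1: "kernel_form k ys [(1, x)] = cnj (kernel_form k [(1, x)] ys)" for x ys
  proof (induction ys)
    case (Cons a ys)
    obtain c y where "a = (c, y)" by (cases a)
    with Cons assms[of y x] show ?case
      by (simp add: kernel_form_Cons_left[of k c y ys] kernel_form_Cons_right[of k _ c y ys] kernel_form_single)
  qed simp
  show ?thesis
  proof (induction xs)
    case (Cons a xs)
    obtain c y where "a = (c, y)" by (cases a)
    with Cons show ?case using 1
      by (simp add: kernel_form_Cons_left[of k c y xs] kernel_form_Cons_right[of k _ c y xs])
  qed simp
qed

lemma kernel_form_cinner:
  "kernel_form (\<lambda>x y. cinner (v x) (v y)) xs ys = cinner (lin_comb v xs) (lin_comb v ys)"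
proof -
  have 1: "kernel_form (\<lambda>x y. cinner (v x) (v y)) [(1, x)] ys = cinner (v x) (lin_comb v ys)" for x
    by (induction ys) (auto simp: kernel_form_def cinner_simps)
  show ?thesis
  proof (induction xs)
    case (Cons a xs)
    obtain c y where "a = (c, y)" by (cases a)
    with Cons show ?case by (simp add: kernel_form_Cons_left[of _ c y xs] 1 cinner_simps)
  qed simp
qed

lemma kernel_form_map: "kernel_form (\<lambda>i j. k (g i) (g j)) xs ys = kernel_form k (map (map_prod id g) xs) (map (map_prod id g) ys)"
  by (simp add: kernel_form_def case_prod_unfold o_def)

lemma psd_kernel_compose: "psd_kernel k \<Longrightarrow> psd_kernel (\<lambda>i j. k (g i) (g j))"
  unfolding psd_kernel_def kernel_form_map by blast

text \<open>Positivity on \<open>xs\<close> with the entry \<open>(- l, y)\<close> adjoined is a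
  quadratic inequality in \<open>l\<close>. The usual optimal \<open>l\<close> settles
  \<open>b > 0\<close>; for \<open>b = 0\<close> the inequality is affine along the direction of
  \<open>z\<close>, which forces \<open>z = 0\<close>.\<close>

lemma psd_kernel_cauchy_schwarz:
  assumes k: "psd_kernel k"
  shows "(cmod (kernel_form k xs [(1, y)]))\<^sup>2 \<le> Re (kernel_form k xs xs) * Re (k y y)"
proof -
  define z where "z = kernel_form k xs [(1, y)]"
  define a where "a = Re (kernel_form k xs xs)"
  define b where "b = Re (k y y)"
  have herm: "k x y = cnj (k y x)" for x y by (rule psd_kernelD(1)[OF k])
  have pos: "0 \<le> a - 2 * Re (cnj l * z) + (cmod l)\<^sup>2 * b" for l
  proof -
    have "0 \<le> Re (kernel_form k (xs @ [(- l, y)]) (xs @ [(- l, y)]))" by (rule psd_kernelD(2)[OF k])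
    also have "kernel_form k (xs @ [(- l, y)]) (xs @ [(- l, y)])
      = kernel_form k xs xs - cnj l * z - l * cnj z + l * cnj l * k y y"
      unfolding z_def
      by (simp add: kernel_form_append_left kernel_form_append_right kernel_form_Cons_right[of k xs "- l"]
          kernel_form_Cons_left[of k "- l" y "[]" xs] kernel_form_single kernel_form_hermitian[OF herm,
            where ys = "[(1, y)]"])
    also have "Re \<dots> = a - 2 * Re (cnj l * z) + (cmod l)\<^sup>2 * b"
      by (simp add: a_def b_def complex_norm_square[symmetric])
    finally show ?thesis .
  qed
  have b0: "0 \<le> b" using psd_kernelD(2)[OF k, where xs = "[(1, y)]"]
    by (simp add: b_def kernel_form_single)
  show ?thesis
  proof (cases "b = 0")
    case False
    define l where "l = z / of_real b"
    have "Re (cnj l * z) = (cmod z)\<^sup>2 / b"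
      by (simp add: l_def complex_norm_square[symmetric] mult.commute[of "cnj z"] del: of_real_divide of_real_power flip: of_real_divide)
    moreover have "(cmod l)\<^sup>2 * b = (cmod z)\<^sup>2 / b" using False
      by (simp add: l_def norm_divide power2_eq_square)
    ultimately have "(cmod z)\<^sup>2 / b \<le> a" using pos[of l] by simp
    then show ?thesis using b0 False by (simp add: z_def a_def b_def field_simps)
  next
    case True
    have "0 \<le> a - 2 * (t * (cmod z)\<^sup>2)" for t :: real
      using pos[of "of_real t * z"] True
      by (simp add: complex_norm_square[symmetric] mult.assoc mult.commute[of "cnj z"])
    \<comment> \<open>For nonzero \<open>z\<close> this choice turns the bound into
      \<open>0 \<le> - 1\<close>.\<close>
    from this[of "(a + 1) / (2 * (cmod z)\<^sup>2)"] have "z = 0" by (cases "z = 0") simp_all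
    then show ?thesis using True by (simp add: z_def b_def)
  qed
qed

section \<open>Factorization of kernels by vectors of \<open>ell2\<close>\<close>

lift_definition ket :: "nat \<Rightarrow> ell2" is "\<lambda>m i. if i = m then 1 else 0"
  by (rule summable_finite[of "{m}" for m]) auto

lemma cinner_ket_right: "cinner f (ket m) = ell2_nth f m"
proof -
  have "(\<lambda>n. ell2_nth f n * cnj (ell2_nth (ket m) n)) = (\<lambda>n. if n = m then ell2_nth f m else 0)"
    by (auto simp: ket.rep_eq)
  then show ?thesis unfolding cinner_ell2_def using sums_single[of m "\<lambda>_. ell2_nth f m"]
    by (simp add: sums_iff)
qed

lemma norm_ket: "norm (ket m) = 1"
proof -
  have "(norm (ket m))\<^sup>2 = 1"
    using cinner_self[of "ket m"] by (simp add: cinner_ket_right ket.rep_eq flip: of_real_power)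
  then show ?thesis by (simp add: power2_eq_1_iff) (metis norm_ge_zero neg_0_le_iff_le not_one_le_zero)
qed

text \<open>One row of a Cholesky factorization. The prescribed inner products with the old vectors
  define a functional of norm at most \<open>C\<close> by Cauchy-Schwarz; its Riesz vector
  \<open>u\<close> lies in the first \<open>n\<close> coordinates, and the missing norm is placed in
  the fresh coordinate \<open>n\<close>. A singular kernel causes no difficulty.\<close>

lemma cholesky_step:
  fixes k :: "nat \<Rightarrow> nat \<Rightarrow> complex" and v :: "nat \<Rightarrow> ell2"
  assumes k: "psd_kernel k"
    and v: "\<And>i j. i < n \<Longrightarrow> j < n \<Longrightarrow> cinner (v i) (v j) = k i j"
    and v0: "\<And>i. i \<ge> n \<Longrightarrow> v i = 0"
    and supp: "\<And>i m. m \<ge> n \<Longrightarrow> ell2_nth (v i) m = 0"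
  shows "\<exists>a. cinner a a = k n n \<and> (\<forall>i<n. cinner (v i) a = k i n) \<and> (\<forall>m>n. ell2_nth a m = 0)"
proof -
  have herm: "k x y = cnj (k y x)" for x y by (rule psd_kernelD(1)[OF k])
  define C where "C = sqrt (Re (k n n))"
  have "0 \<le> Re (k n n)" using psd_kernelD(2)[OF k, where xs = "[(1, n)]"]
    by (simp add: kernel_form_single)
  then have C: "C \<ge> 0" "C\<^sup>2 = Re (k n n)" by (auto simp: C_def)
  have knn: "k n n = of_real (C\<^sup>2)" using herm[of n n] by (simp add: complex_eq_iff C)
  \<comment> \<open>The line through \<open>ket 0\<close> stands for the scalars, so that the
    functional can be treated by \<open>contraction_extension\<close>. If \<open>C = 0\<close>, the
    quotient is \<open>0\<close>, which is the right value because Cauchy-Schwarz gives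
    \<open>k i n = 0\<close>.\<close>
  define w where "w i = (if i < n then (k i n / of_real C) *\<^sub>C ket 0 else 0)" for i
  have "norm (lin_comb w xs) \<le> norm (lin_comb v xs)" for xs
  proof -
    define ys where "ys = filter (\<lambda>(c, i). i < n) xs"
    have ys: "snd p < n" if "p \<in> set ys" for p using that by (auto simp: ys_def)
    have 1: "lin_comb w xs = lin_comb w ys" "lin_comb v xs = lin_comb v ys"
      unfolding ys_def by (induction xs) (auto simp: w_def v0)
    have 2: "lin_comb w ys = (kernel_form k ys [(1, n)] / of_real C) *\<^sub>C ket 0"
      using ys
    proof (induction ys)
      case (Cons a ys)
      obtain c y where a: "a = (c, y)" by (cases a)
      with Cons.prems[of a] have "y < n" by simp
      with Cons a show ?case
        by (simp add: kernel_form_Cons_left[of k c y ys] kernel_form_single w_def scaleC_scaleC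
            scaleC_add_left add_divide_distrib)
    qed simp
    have 3: "cinner (v x) (lin_comb v ys) = kernel_form k [(1, x)] ys" if "x < n" for x
      using ys
    proof (induction ys)
      case (Cons a ys)
      obtain c y where a: "a = (c, y)" by (cases a)
      with Cons.prems[of a] have "y < n" by simp
      with a Cons that show ?case
        by (simp add: kernel_form_Cons_right[of k _ c y ys] kernel_form_single cinner_simps v)
    qed simp
    have "cinner (lin_comb v zs) (lin_comb v ys) = kernel_form k zs ys" if "set zs \<subseteq> set ys" for zs
      using that
    proof (induction zs)
      case (Cons a zs)
      obtain c y where a: "a = (c, y)" by (cases a)
      with Cons.prems ys have "y < n" by fastforce
      with Cons a show ?case
        by (simp add: kernel_form_Cons_left[of k c y zs] cinner_simps 3)
    qed simp
    from this[of ys] have "(norm (lin_comb v ys))\<^sup>2 = Re (kernel_form k ys ys)"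
      by (simp add: cinner_self)
        (metis Re_complex_of_real cinner_self of_real_power)
    then have "(cmod (kernel_form k ys [(1, n)]))\<^sup>2 \<le> (norm (lin_comb v ys) * C)\<^sup>2"
      using psd_kernel_cauchy_schwarz[OF k, of ys n] by (simp add: power_mult_distrib C)
    then have "cmod (kernel_form k ys [(1, n)]) \<le> norm (lin_comb v ys) * C"
      using C(1) by (auto intro: power2_le_imp_le)
    then show ?thesis using C(1)
      by (cases "C = 0") (auto simp: 1 2 norm_scaleC norm_ket norm_divide field_simps)
  qed
  from contraction_extension[OF this] obtain T where T: "nonexpansive T" "\<And>x. T (v x) = w x"
    "\<And>u. (\<And>x. cinner u (v x) = 0) \<Longrightarrow> T u = 0" by blast
  define u where "u = of_real C *\<^sub>C cadjoint T (ket 0)"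
  note adj = cinner_adjoint[OF nonexpansive_bounded_clinear[OF T(1)]]
  note adj' = cinner_adjoint'[OF nonexpansive_bounded_clinear[OF T(1)]]
  have vu: "cinner (v i) u = k i n" if "i < n" for i
  proof -
    have "(cmod (k i n))\<^sup>2 \<le> Re (k i i) * C\<^sup>2"
      using psd_kernel_cauchy_schwarz[OF k, of "[(1, i)]" n] by (simp add: kernel_form_single C)
    then have "C = 0 \<Longrightarrow> k i n = 0" by simp
    then show ?thesis using that
      by (auto simp: u_def cinner_simps adj[symmetric] T w_def cinner_ket_right ket.rep_eq scaleC_ell2.rep_eq)
  qed
  have u_nth: "ell2_nth u m = 0" if "m \<ge> n" for m
  proof -
    have "cinner (v i) (ket m) = 0" for i using supp[OF that] by (simp add: cinner_ket_right)
    then have "cinner (ket m) (v i) = 0" for i by (metis cinner_commute complex_cnj_zero)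
    then have "T (ket m) = 0" by (rule T(3))
    then have "cinner u (ket m) = 0" by (simp add: u_def cinner_simps adj')
    then show ?thesis by (simp add: cinner_ket_right)
  qed
  have "norm u \<le> C"
    using nonexpansive_norm[OF nonexpansive_adjoint[OF T(1)], of "ket 0"] C(1)
    by (simp add: u_def norm_scaleC norm_ket mult_left_le)
  then have t: "(norm u)\<^sup>2 \<le> C\<^sup>2" by (intro power_mono) auto
  \<comment> \<open>The norm that \<open>u\<close> lacks; the coordinate \<open>n\<close> is
    orthogonal to all earlier vectors, so it does not disturb their inner products with
    \<open>a\<close>.\<close>
  define t where "t = sqrt (C\<^sup>2 - (norm u)\<^sup>2)"
  define a where "a = u + of_real t *\<^sub>C ket n"
  have ukn: "cinner u (ket n) = 0" by (simp add: cinner_ket_right u_nth)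
  have "(norm a)\<^sup>2 = (norm u)\<^sup>2 + t\<^sup>2"
    unfolding a_def norm_add_squared by (simp add: cinner_simps ukn norm_scaleC norm_ket power_mult_distrib)
  also have "\<dots> = C\<^sup>2" using t by (simp add: t_def)
  finally have "cinner a a = k n n" by (simp add: cinner_self knn flip: of_real_power)
  moreover have "cinner (v i) a = k i n" if "i < n" for i
    using vu[OF that] supp[of n i] by (simp add: a_def cinner_simps cinner_ket_right)
  moreover have "ell2_nth a m = 0" if "m > n" for m
    using u_nth[of m] that by (simp add: a_def plus_ell2.rep_eq scaleC_ell2.rep_eq ket.rep_eq)
  ultimately show ?thesis by blast
qed

lemma cholesky:
  fixes k :: "nat \<Rightarrow> nat \<Rightarrow> complex"
  assumes k: "psd_kernel k"
  shows "\<exists>v :: nat \<Rightarrow> ell2. \<forall>i j. cinner (v i) (v j) = k i j"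
proof -
  \<comment> \<open>Row \<open>n\<close> is \<open>0\<close> before stage \<open>n\<close>, and
    stage \<open>n\<close> changes only that row; hence row \<open>i\<close> is final from stage
    \<open>Suc i\<close> on.\<close>
  define P where "P n v \<longleftrightarrow> (\<forall>i<n. \<forall>j<n. cinner (v i) (v j) = k i j) \<and> (\<forall>i\<ge>n. v i = 0) \<and>
    (\<forall>i. \<forall>m\<ge>n. ell2_nth (v i) m = 0)" for n and v :: "nat \<Rightarrow> ell2"
  have herm: "k x y = cnj (k y x)" for x y by (rule psd_kernelD(1)[OF k])
  have "\<exists>f. \<forall>n. P n (f n) \<and> (\<forall>i. i \<noteq> n \<longrightarrow> f (Suc n) i = f n i)"
  proof (rule dependent_nat_choice)
    show "\<exists>v. P 0 v" by (intro exI[of _ "\<lambda>_. 0"]) (auto simp: P_def zero_ell2.rep_eq)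
  next
    fix v n assume v: "P n v"
    then obtain a
      where a: "cinner a a = k n n" "\<And>i. i < n \<Longrightarrow> cinner (v i) a = k i n" "\<And>m. m > n \<Longrightarrow> ell2_nth a m = 0"
      using cholesky_step[OF k, of n v] unfolding P_def by blast
    have "cinner a (v i) = k n i" if "i < n" for i
      using a(2)[OF that] herm[of n i] cinner_commute[of a "v i"] by simp
    then have "P (Suc n) (v(n := a))"
      using v a unfolding P_def by (auto simp: less_Suc_eq)
    then show "\<exists>v'. P (Suc n) v' \<and> (\<forall>i. i \<noteq> n \<longrightarrow> v' i = v i)" by (intro exI[of _ "v(n := a)"]) auto
  qed
  then obtain f where f: "\<And>n. P n (f n)" "\<And>n i. i \<noteq> n \<Longrightarrow> f (Suc n) i = f n i" by blast
  have stable: "f (Suc i + d) i = f (Suc i) i" for i d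
    by (induction d) (simp_all add: f(2))
  have eq: "f n i = f (Suc i) i" if "i < n" for i n
    using stable[of i "n - Suc i"] that by simp
  have "cinner (f (Suc i) i) (f (Suc j) j) = k i j" for i j
  proof -
    define m where "m = Suc (max i j)"
    have "i < m" "j < m" by (auto simp: m_def)
    then have "cinner (f m i) (f m j) = k i j" using f(1)[of m] unfolding P_def by blast
    then show ?thesis using eq[OF \<open>i < m\<close>] eq[OF \<open>j < m\<close>] by simp
  qed
  then show ?thesis by (intro exI[of _ "\<lambda>i. f (Suc i) i"]) blast
qed

text \<open>Cholesky handles countable index sets only. The remaining indices are reached as limits
  from \<open>D\<close> in the pseudometric of the kernel, the expression in \<open>dense\<close>
  being the squared distance between the vectors sought.\<close>

lemma kernel_representation:
  fixes k :: "'x \<Rightarrow> 'x \<Rightarrow> complex"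
  assumes k: "psd_kernel k" and D: "countable D"
    and dense: "\<And>x e. e > 0 \<Longrightarrow> \<exists>d\<in>D. Re (k x x) + Re (k d d) - 2 * Re (k x d) < e"
  shows "\<exists>v :: 'x \<Rightarrow> ell2. \<forall>x y. cinner (v x) (v y) = k x y"
proof -
  define d where "d = from_nat_into D"
  have "D \<noteq> {}" using dense[of 1] by fastforce
  then have range_d: "range d = D" unfolding d_def by (rule range_from_nat_into[OF _ D])
  obtain vN :: "nat \<Rightarrow> ell2" where vN: "\<And>i j. cinner (vN i) (vN j) = k (d i) (d j)"
    using cholesky[OF psd_kernel_compose[OF k, of d]] by blast
  have "\<exists>i. Re (k x x) + Re (k (d i) (d i)) - 2 * Re (k x (d i)) < 1 / Suc n" for x n
    using dense[of "1 / Suc n" x] range_d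
    by (metis divide_pos_pos of_nat_0_less_iff rangeE zero_less_Suc zero_less_one)
  then obtain s
    where s: "\<And>x n. Re (k x x) + Re (k (d (s x n)) (d (s x n))) - 2 * Re (k x (d (s x n))) < 1 / Suc n"
    by metis
  \<comment> \<open>An auxiliary factorization over \<open>D\<close> together with \<open>x\<close>
    and \<open>y\<close>, in which both already have vectors. It has the same Gram matrix on
    \<open>D\<close> as \<open>vN\<close>, so Cauchy sequences and limits of inner products can be
    read off there and carried over to \<open>vN\<close>.\<close>
  have approx: "\<exists>u :: nat \<Rightarrow> ell2. cinner (u 0) (u 1) = k x y \<and> (\<forall>i j. cinner (u (i + 2)) (u (j + 2)) = cinner (vN i) (vN j))
      \<and> (\<lambda>n. u (s x n + 2)) \<longlonglongrightarrow> u 0 \<and> (\<lambda>n. u (s y n + 2)) \<longlonglongrightarrow> u 1" for x y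
  proof -
    define g where "g i = (if i = 0 then x else if i = 1 then y else d (i - 2))" for i :: nat
    obtain u :: "nat \<Rightarrow> ell2" where u: "\<And>i j. cinner (u i) (u j) = k (g i) (g j)"
      using cholesky[OF psd_kernel_compose[OF k, of g]] by blast
    have lim: "(\<lambda>n. u (s (g i) n + 2)) \<longlonglongrightarrow> u i" for i
    proof -
      have n2: "(norm (u j))\<^sup>2 = Re (k (g j) (g j))" for j using u[of j j]
        by (metis Re_complex_of_real cinner_self)
      have "(norm (u i - u (s (g i) n + 2)))\<^sup>2 < 1 / Suc n" for n
        unfolding norm_diff_squared n2 u using s[of "g i" n] by (simp add: g_def)
      then have "(norm (u (s (g i) n + 2) - u i))\<^sup>2 \<le> 1 / Suc n" for n
        by (metis norm_minus_commute less_imp_le)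
      then have "(\<lambda>n. (norm (u (s (g i) n + 2) - u i))\<^sup>2) \<longlonglongrightarrow> 0"
        by (intro tendsto_sandwich[OF _ _ tendsto_const LIMSEQ_Suc[OF lim_1_over_n]] always_eventually allI) auto
      then have "(\<lambda>n. sqrt ((norm (u (s (g i) n + 2) - u i))\<^sup>2)) \<longlonglongrightarrow> sqrt 0" by (rule tendsto_real_sqrt)
      then show ?thesis by (simp add: tendsto_norm_zero_iff LIM_zero_iff)
    qed
    from lim[of 0] lim[of 1] u show ?thesis by (intro exI[of _ u]) (simp add: g_def vN)
  qed
  have "convergent (\<lambda>n. vN (s x n))" for x
  proof -
    obtain u :: "nat \<Rightarrow> ell2" where u: "\<And>i j. cinner (u (i + 2)) (u (j + 2)) = cinner (vN i) (vN j)"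
      "(\<lambda>n. u (s x n + 2)) \<longlonglongrightarrow> u 0" using approx[of x x] by blast
    have "dist (vN i) (vN j) = dist (u (i + 2)) (u (j + 2))" for i j
      unfolding dist_norm by (rule norm_eq_cinner) (simp add: cinner_simps u(1)[simplified])
    then have "Cauchy (\<lambda>n. vN (s x n)) \<longleftrightarrow> Cauchy (\<lambda>n. u (s x n + 2))" unfolding Cauchy_def by simp
    then show ?thesis using LIMSEQ_imp_Cauchy[OF u(2)] by (simp add: Cauchy_convergent_iff)
  qed
  then obtain v where v: "\<And>x. (\<lambda>n. vN (s x n)) \<longlonglongrightarrow> v x" unfolding convergent_def by metis
  have "cinner (v x) (v y) = k x y" for x y
  proof -
    obtain u :: "nat \<Rightarrow> ell2"
      where u: "cinner (u 0) (u 1) = k x y" "\<And>i j. cinner (u (i + 2)) (u (j + 2)) = cinner (vN i) (vN j)"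
      "(\<lambda>n. u (s x n + 2)) \<longlonglongrightarrow> u 0" "(\<lambda>n. u (s y n + 2)) \<longlonglongrightarrow> u 1" using approx[of x y] by blast
    have "(\<lambda>n. cinner (u (s x n + 2)) (u (s y n + 2))) \<longlonglongrightarrow> k x y"
      using tendsto_cinner[OF u(3,4)] by (simp add: u(1)[simplified])
    moreover have "(\<lambda>n. cinner (vN (s x n)) (vN (s y n))) \<longlonglongrightarrow> cinner (v x) (v y)"
      by (rule tendsto_cinner[OF v v])
    ultimately show ?thesis unfolding u(2) using LIMSEQ_unique by blast
  qed
  then show ?thesis by blast
qed

section \<open>Defect operators\<close>

instance complex_hilbert_space \<subseteq> banach ..

text \<open>The Taylor coefficients of \<open>(1 - t) powr (1 / 2)\<close>; summing the series at \<open>A\<^sup>* A\<close> gives the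
  defect operator of \<open>A\<close>.\<close>

definition sqrt_coeff :: "nat \<Rightarrow> real"
  where "sqrt_coeff k = ((1/2) gchoose k) * (- 1) ^ k"

lemma sqrt_coeff_nonpos: "k \<ge> 1 \<Longrightarrow> sqrt_coeff k \<le> 0"
proof -
  assume "k \<ge> 1"
  then obtain j where "k = Suc j" by (cases k) auto
  moreover have "sqrt_coeff k = pochhammer (-1/2) k / fact k"
    unfolding sqrt_coeff_def gbinomial_pochhammer by (simp flip: power_mult_distrib)
  moreover have "pochhammer (1/2 :: real) j \<ge> 0" by (rule pochhammer_nonneg) simp
  ultimately show ?thesis by (simp add: pochhammer_rec)
qed

text \<open>Only the constant coefficient is positive, so the sums of absolute values are
  \<open>2\<close> minus the partial sums of the coefficients, and these have a nonnegative closed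
  form.\<close>

lemma summable_sqrt_coeff: "summable (\<lambda>k. \<bar>sqrt_coeff k\<bar>)"
proof (rule bounded_imp_summable[where B = 2])
  show "(\<Sum>k\<le>n. \<bar>sqrt_coeff k\<bar>) \<le> 2" for n
  proof -
    have "(\<Sum>k\<le>n. \<bar>sqrt_coeff k\<bar>) = (\<Sum>k\<le>n. (if k = 0 then 2 else 0) - sqrt_coeff k)"
      using sqrt_coeff_nonpos by (intro sum.cong) (auto simp: sqrt_coeff_def)
    also have "\<dots> = 2 - (\<Sum>k\<le>n. sqrt_coeff k)" by (simp add: sum_subtractf)
    also have "(\<Sum>k\<le>n. sqrt_coeff k) = (- 1) ^ n * ((-1/2) gchoose n)"
      unfolding sqrt_coeff_def gbinomial_sum_lower_neg by simp
    also have "\<dots> = pochhammer (1/2) n / fact n"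
      unfolding gbinomial_pochhammer by (simp flip: power_mult_distrib)
    finally show ?thesis using pochhammer_nonneg[of "1/2 :: real" n] by simp
  qed
qed simp

text \<open>The square of the series is \<open>1 - t\<close>: Vandermonde with both upper arguments
  equal to one half.\<close>

lemma sqrt_coeff_convolution:
  "(\<Sum>i\<le>n. sqrt_coeff i * sqrt_coeff (n - i)) = (if n = 0 then 1 else if n = 1 then -1 else 0)"
proof -
  have "(\<Sum>i\<le>n. sqrt_coeff i * sqrt_coeff (n - i))
    = (\<Sum>i\<le>n. ((1/2) gchoose i) * ((1/2) gchoose (n - i)) * (- 1) ^ n)"
    unfolding sqrt_coeff_def by (intro sum.cong refl) (simp add: power_add[symmetric] mult_ac)
  also have "\<dots> = ((1/2 + 1/2 :: real) gchoose n) * (- 1) ^ n"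
    unfolding sum_distrib_right[symmetric] atMost_atLeast0 gbinomial_Vandermonde ..
  also have "(1/2 + 1/2 :: real) gchoose n = real (1 choose n)" by (simp add: binomial_gbinomial)
  also have "real (1 choose n) * (- 1) ^ n = (if n = 0 then 1 else if n = 1 then -1 else 0)"
    by (cases "n \<le> 1") (auto simp: le_Suc_eq)
  finally show ?thesis .
qed

text \<open>The triangle \<open>k + l < N\<close> is evaluated exactly by the convolution identity.
  The rest of the square contributes nothing in the limit, since the coefficients are absolutely
  summable and \<open>t\<close> is bounded. In the application \<open>t n\<close> is the n-th moment
  of a positive contraction at a vector.\<close>

lemma sqrt_series_limit:
  fixes t :: "nat \<Rightarrow> real"
  assumes t: "\<And>n. \<bar>t n\<bar> \<le> M"
  shows "(\<lambda>N. \<Sum>k<N. \<Sum>l<N. sqrt_coeff k * sqrt_coeff l * t (k + l)) \<longlonglongrightarrow> t 0 - t 1"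
proof -
  define c where "c = sqrt_coeff"
  define S where "S N = {..<N} \<times> {..<N}" for N :: nat
  define Tr where "Tr N = {(i, j). i + j < N}" for N :: nat
  have sub: "Tr N \<subseteq> S N" and fin: "finite (S N)" for N by (auto simp: S_def Tr_def)
  have finT: "finite (Tr N)" for N by (rule finite_subset[OF sub fin])
  define f where "f = (\<lambda>(k, l). c k * c l * t (k + l))"
  define g where "g = (\<lambda>(k, l). \<bar>c k\<bar> * \<bar>c l\<bar>)"
  have M0: "0 \<le> M" using t[of 0] by linarith
  have fg: "\<bar>f p\<bar> \<le> M * g p" for p
    using mult_left_mono[OF t, of "\<bar>c (fst p)\<bar> * \<bar>c (snd p)\<bar>" "fst p + snd p"]
    by (auto simp: f_def g_def case_prod_unfold abs_mult mult_ac)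
  have sumS: "sum f (S N) = (\<Sum>k<N. \<Sum>l<N. c k * c l * t (k + l))" for N
    unfolding S_def f_def by (simp add: sum.cartesian_product)
  have gS: "sum g (S N) = (\<Sum>k<N. \<bar>c k\<bar>) * (\<Sum>k<N. \<bar>c k\<bar>)" for N
    unfolding S_def g_def by (simp add: sum_product sum.cartesian_product)
  have gT: "sum g (Tr N) = (\<Sum>n<N. \<Sum>i\<le>n. \<bar>c i\<bar> * \<bar>c (n - i)\<bar>)" for N
    unfolding Tr_def g_def by (rule sum.triangle_reindex)
  have fT: "sum f (Tr N) = t 0 - t 1" if "N \<ge> 2" for N
  proof -
    have "sum f (Tr N) = (\<Sum>n<N. \<Sum>i\<le>n. c i * c (n - i) * t (i + (n - i)))"
      unfolding Tr_def f_def by (rule sum.triangle_reindex)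
    also have "\<dots> = (\<Sum>n<N. (\<Sum>i\<le>n. c i * c (n - i)) * t n)"
      unfolding sum_distrib_right by (intro sum.cong refl) simp
    also have "\<dots> = (\<Sum>n<N. (if n = 0 then t 0 else 0) + (if n = 1 then - t 1 else 0))"
      unfolding c_def sqrt_coeff_convolution by (intro sum.cong refl) auto
    also have "\<dots> = t 0 - t 1" using that by (simp add: sum.distrib)
    finally show ?thesis .
  qed
  have sc: "summable (\<lambda>k. norm \<bar>c k\<bar>)" using summable_sqrt_coeff by (simp add: c_def)
  define s where "s = suminf (\<lambda>k. \<bar>c k\<bar>)"
  have "(\<lambda>N. \<Sum>k<N. \<bar>c k\<bar>) \<longlonglongrightarrow> s"
    using sc unfolding s_def by (simp add: summable_LIMSEQ)
  then have 1: "(\<lambda>N. sum g (S N)) \<longlonglongrightarrow> s * s" unfolding gS by (intro tendsto_mult)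
  have 2: "(\<lambda>N. sum g (Tr N)) \<longlonglongrightarrow> s * s"
    using Cauchy_product_sums[OF sc sc] unfolding gT s_def sums_def by simp
  have "(\<lambda>N. M * (sum g (S N) - sum g (Tr N))) \<longlonglongrightarrow> M * (s * s - s * s)"
    by (intro tendsto_intros 1 2)
  then have lim0: "(\<lambda>N. M * (sum g (S N) - sum g (Tr N))) \<longlonglongrightarrow> 0" by simp
  have bound: "\<bar>sum f (S N) - sum f (Tr N)\<bar> \<le> M * (sum g (S N) - sum g (Tr N))" for N
  proof -
    have "sum f (S N) - sum f (Tr N) = sum f (S N - Tr N)"
      using sum_diff[OF fin sub, of f] by simp
    also have "\<bar>\<dots>\<bar> \<le> (\<Sum>p\<in>S N - Tr N. M * g p)" by (rule order_trans[OF sum_abs sum_mono[OF fg]])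
    also have "\<dots> = M * (sum g (S N) - sum g (Tr N))"
      using sum_diff[OF fin sub, of g] by (simp add: sum_distrib_left[symmetric])
    finally show ?thesis .
  qed
  have "(\<lambda>N. sum f (S N) - sum f (Tr N)) \<longlonglongrightarrow> 0"
    by (rule Lim_null_comparison[OF _ lim0]) (simp add: bound)
  moreover have "(\<lambda>N. sum f (Tr N)) \<longlonglongrightarrow> t 0 - t 1"
    by (rule tendsto_eventually) (use fT eventually_ge_at_top in \<open>auto elim!: eventually_mono simp: eventually_sequentially\<close>)
  ultimately have "(\<lambda>N. (sum f (S N) - sum f (Tr N)) + sum f (Tr N)) \<longlonglongrightarrow> 0 + (t 0 - t 1)" by (rule tendsto_add)
  then show ?thesis by (simp add: sumS c_def)
qed

lemma funpow_adjoint_self: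
  fixes T :: "'a::complex_hilbert_space \<Rightarrow> 'a"
  assumes "\<And>x y. cinner (T x) y = cinner x (T y)"
  shows "cinner ((T ^^ k) x) ((T ^^ l) y) = cinner ((T ^^ (k + l)) x) y"
proof (induction l arbitrary: k)
  case (Suc l)
  have "cinner ((T ^^ k) x) ((T ^^ Suc l) y) = cinner ((T ^^ Suc k) x) ((T ^^ l) y)" by (simp add: assms)
  also have "\<dots> = cinner ((T ^^ (Suc k + l)) x) y" by (rule Suc)
  finally show ?case by simp
qed simp

text \<open>The power series exhibits \<open>D\<close> as a strong limit of polynomials in the
  product of the adjoint of \<open>A\<close> with \<open>A\<close>. This yields the last clause,
  commutation with everything that commutes with that product, on which the equivariance of the
  colligation rests.\<close>

lemma defect_operator_exists:
  fixes A :: "'a::complex_hilbert_space \<Rightarrow> 'b::complex_hilbert_space"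
  assumes A: "nonexpansive A"
  shows "\<exists>D :: 'a \<Rightarrow> 'a. bounded_clinear D \<and> (\<forall>x. (norm (D x))\<^sup>2 = (norm x)\<^sup>2 - (norm (A x))\<^sup>2) \<and>
    (\<forall>W. bounded_clinear W \<and> (\<forall>x. cadjoint A (A (W x)) = W (cadjoint A (A x))) \<longrightarrow> (\<forall>x. D (W x) = W (D x)))"
proof -
  define T where "T x = cadjoint A (A x)" for x
  note adj = cinner_adjoint'[OF nonexpansive_bounded_clinear[OF A]]
  have T: "nonexpansive T" unfolding T_def by (rule nonexpansive_compose[OF nonexpansive_adjoint[OF A] A])
  have sa: "cinner (T x) y = cinner x (T y)" for x y
    unfolding T_def adj cinner_adjoint[OF nonexpansive_bounded_clinear[OF A], symmetric] ..
  define P where "P N x = (\<Sum>k<N. sqrt_coeff k *\<^sub>R (T ^^ k) x)" for N x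
  define D where "D x = suminf (\<lambda>k. sqrt_coeff k *\<^sub>R (T ^^ k) x)" for x
  note Tk = nonexpansive_funpow[OF T]
  have "summable (\<lambda>k. sqrt_coeff k *\<^sub>R (T ^^ k) x)" for x
  proof (rule summable_comparison_test'[where N = 0])
    show "summable (\<lambda>k. \<bar>sqrt_coeff k\<bar> * norm x)" by (intro summable_mult2 summable_sqrt_coeff)
    show "norm (sqrt_coeff k *\<^sub>R (T ^^ k) x) \<le> \<bar>sqrt_coeff k\<bar> * norm x" for k
      using nonexpansive_norm[OF Tk] by (simp add: mult_left_mono)
  qed
  then have lim: "(\<lambda>N. P N x) \<longlonglongrightarrow> D x" for x
    unfolding P_def D_def by (rule summable_LIMSEQ)
  have norm: "(norm (D x))\<^sup>2 = (norm x)\<^sup>2 - (norm (A x))\<^sup>2" for x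
  proof -
    define t where "t n = inner ((T ^^ n) x) x" for n
    have "\<bar>t n\<bar> \<le> (norm x)\<^sup>2" for n
      using Cauchy_Schwarz_ineq2[of "(T ^^ n) x" x] mult_right_mono[OF nonexpansive_norm[OF Tk], of "norm x" n x]
      unfolding t_def power2_eq_square by (meson norm_ge_zero order_trans)
    from sqrt_series_limit[OF this]
    have 1: "(\<lambda>N. \<Sum>k<N. \<Sum>l<N. sqrt_coeff k * sqrt_coeff l * t (k + l)) \<longlonglongrightarrow> t 0 - t 1" .
    have "inner (P N x) (P N x) = (\<Sum>k<N. \<Sum>l<N. sqrt_coeff k * sqrt_coeff l * t (k + l))" for N
      unfolding P_def t_def inner_sum_left inner_sum_right inner_scaleR_left inner_scaleR_right
      by (simp add: inner_eq_Re_cinner funpow_adjoint_self[OF sa] mult.assoc sum_distrib_left add.commute)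
    with 1 have "(\<lambda>N. inner (P N x) (P N x)) \<longlonglongrightarrow> t 0 - t 1" by simp
    moreover have "(\<lambda>N. inner (P N x) (P N x)) \<longlonglongrightarrow> inner (D x) (D x)" by (intro tendsto_inner lim)
    ultimately have "inner (D x) (D x) = t 0 - t 1" by (rule LIMSEQ_unique[OF _, symmetric])
    also have "t 1 = (norm (A x))\<^sup>2"
      by (simp add: t_def T_def inner_eq_Re_cinner adj cinner_self flip: of_real_power)
    finally show ?thesis by (simp add: power2_norm_eq_inner t_def)
  qed
  have Padd: "P N (x + y) = P N x + P N y" for N x y
    by (simp add: P_def nonexpansiveD[OF Tk] scaleR_add_right sum.distrib)
  have Psc: "P N (c *\<^sub>C x) = c *\<^sub>C P N x" for N c x
    unfolding P_def linear_sum[OF bounded_linear.linear[OF bounded_linear_scaleC]]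
    by (simp add: nonexpansiveD[OF Tk] scaleR_scaleC scaleC_scaleC mult.commute)
  have "bounded_clinear D"
  proof (rule bounded_clinearI[where B = 1])
    show "D (x + y) = D x + D y" for x y
      using LIMSEQ_unique[OF lim[of "x + y"]] tendsto_add[OF lim[of x] lim[of y]] by (simp add: Padd)
    show "D (c *\<^sub>C x) = c *\<^sub>C D x" for c x
      using LIMSEQ_unique[OF lim[of "c *\<^sub>C x"]] bounded_linear.tendsto[OF bounded_linear_scaleC lim[of x], of c] by (simp add: Psc)
    have le: "(norm (D x))\<^sup>2 \<le> (norm x)\<^sup>2" for x unfolding norm by simp
    show "norm (D x) \<le> 1 * norm x" for x using power2_le_imp_le[OF le norm_ge_zero] by simp
  qed
  moreover have "D (W x) = W (D x)"
    if W: "bounded_clinear W" and comm: "\<And>x. cadjoint A (A (W x)) = W (cadjoint A (A x))" for W x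
  proof -
    have "(T ^^ k) (W x) = W ((T ^^ k) x)" for k
      by (induction k) (simp_all add: comm[folded T_def])
    then have "P N (W x) = W (P N x)" for N
      unfolding P_def
      by (simp add: bounded_clinear_sum[OF W] linear_scale[OF bounded_linear.linear[OF bounded_clinearD(6)[OF W]]])
    then have "(\<lambda>N. W (P N x)) \<longlonglongrightarrow> D (W x)" using lim[of "W x"] by simp
    moreover have "(\<lambda>N. W (P N x)) \<longlonglongrightarrow> W (D x)"
      by (rule bounded_linear.tendsto[OF bounded_clinearD(6)[OF W] lim])
    ultimately show ?thesis by (rule LIMSEQ_unique)
  qed
  ultimately show ?thesis using norm by blast
qed

section \<open>Direct sums\<close>

instantiation prod :: (complex_hilbert_space, complex_hilbert_space) complex_hilbert_space
begin

definition scaleC_prod :: "complex \<Rightarrow> 'a \<times> 'b \<Rightarrow> 'a \<times> 'b"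
  where "scaleC_prod c p = (c *\<^sub>C fst p, c *\<^sub>C snd p)"

definition cinner_prod :: "'a \<times> 'b \<Rightarrow> 'a \<times> 'b \<Rightarrow> complex"
  where "cinner_prod p q = cinner (fst p) (fst q) + cinner (snd p) (snd q)"

instance
proof
  fix p q :: "'a \<times> 'b"
  show "cinner p q = cnj (cinner q p)"
    unfolding cinner_prod_def complex_cnj_add
    using cinner_commute[of "fst p" "fst q"] cinner_commute[of "snd p" "snd q"] by simp
qed (auto simp: scaleC_prod_def cinner_prod_def inner_prod_def inner_eq_Re_cinner cinner_simps prod_eq_iff
      scaleC_add_right scaleC_add_left scaleC_scaleC scaleR_scaleC algebra_simps)

end

lemma norm_prod_squared: "(norm p)\<^sup>2 = (norm (fst p))\<^sup>2 + (norm (snd p))\<^sup>2"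
  by (simp add: norm_prod_def)

lemma strict_mono_prod_encode: "strict_mono (\<lambda>m. prod_encode (i, m))"
  by (simp add: strict_mono_Suc_iff prod_encode_def)

text \<open>\<open>block i\<close> embeds \<^typ>\<open>ell2\<close> as the \<open>i\<close>-th summand of \<^typ>\<open>ell2\<close>, viewed as a countable
  direct sum of copies of itself; \<open>component\<close> is its adjoint.\<close>

lift_definition block :: "nat \<Rightarrow> ell2 \<Rightarrow> ell2"
  is "\<lambda>i f N. if fst (prod_decode N) = i then f (snd (prod_decode N)) else 0"
proof -
  fix i and f :: "nat \<Rightarrow> complex"
  assume f: "summable (\<lambda>n. (cmod (f n))\<^sup>2)"
  let ?h = "\<lambda>N. (cmod (if fst (prod_decode N) = i then f (snd (prod_decode N)) else 0))\<^sup>2"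
  have "?h N = 0" if "N \<notin> range (\<lambda>m. prod_encode (i, m))" for N
    using that by (auto simp: image_iff) (metis prod.collapse prod_decode_inverse)
  from summable_mono_reindex[of _ ?h, OF strict_mono_prod_encode[of i] this] f
  show "summable ?h" by simp
qed

lift_definition component :: "nat \<Rightarrow> ell2 \<Rightarrow> ell2"
  is "\<lambda>i f m. f (prod_encode (i, m))"
proof -
  fix i and f :: "nat \<Rightarrow> complex"
  assume f: "summable (\<lambda>n. (cmod (f n))\<^sup>2)"
  have "inj (\<lambda>m. prod_encode (i, m))" by (rule strict_mono_imp_inj_on[OF strict_mono_prod_encode])
  from summable_reindex[OF f this] show "summable (\<lambda>m. (cmod (f (prod_encode (i, m))))\<^sup>2)"
    by (simp add: o_def)
qed

lemma cinner_block_left: "cinner (block i x) f = cinner x (component i f)"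
proof -
  let ?h = "\<lambda>N. ell2_nth (block i x) N * cnj (ell2_nth f N)"
  have "?h N = 0" if "N \<notin> range (\<lambda>m. prod_encode (i, m))" for N
    using that by (auto simp: image_iff block.rep_eq) (metis prod.collapse prod_decode_inverse)
  from suminf_mono_reindex[of _ ?h, OF strict_mono_prod_encode[of i] this]
  show ?thesis by (simp add: cinner_ell2_def block.rep_eq component.rep_eq)
qed

lemma cinner_block_right: "cinner f (block i x) = cinner (component i f) x"
  using cinner_block_left[of i x f] by (metis cinner_commute)

lemma component_block: "component j (block i x) = (if i = j then x else 0)"
  by (rule ell2_eqI) (simp add: component.rep_eq block.rep_eq zero_ell2.rep_eq)

lemma component_eqI: "(\<And>i. component i f = component i g) \<Longrightarrow> f = g"
proof (rule ell2_eqI)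
  fix N assume "\<And>i. component i f = component i g"
  then have "ell2_nth (component (fst (prod_decode N)) f) (snd (prod_decode N)) = ell2_nth (component (fst (prod_decode N)) g) (snd (prod_decode N))" by simp
  then show "ell2_nth f N = ell2_nth g N" by (simp add: component.rep_eq)
qed

lemma block_total: "(\<And>i x. cinner f (block i x) = 0) \<Longrightarrow> f = 0"
proof (rule component_eqI)
  fix i assume "\<And>i x. cinner f (block i x) = 0"
  then have "cinner (component i f) (component i f) = 0" by (simp flip: cinner_block_right)
  moreover have "component i 0 = 0" by (rule ell2_eqI) (simp add: component.rep_eq zero_ell2.rep_eq)
  ultimately show "component i f = component i 0" by (simp add: cinner_self)
qed

lemma norm_block: "norm (block i x) = norm x"
  by (rule norm_eq_cinner) (simp add: cinner_block_left component_block)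

lemma isometric_block: "isometric (block i)"
proof -
  have "bounded_clinear (block i)"
  proof (rule bounded_clinearI[where B = 1])
    show "block i (x + y) = block i x + block i y" for x y
      by (rule ell2_eqI) (simp add: block.rep_eq plus_ell2.rep_eq)
    show "block i (c *\<^sub>C x) = c *\<^sub>C block i x" for c x
      by (rule ell2_eqI) (simp add: block.rep_eq scaleC_ell2.rep_eq)
  qed (simp add: norm_block)
  then show ?thesis by (simp add: isometric_def norm_block)
qed

lemma nonexpansive_component: "nonexpansive (component i)"
proof -
  have "cadjoint (block i) = component i" by (rule cadjoint_eqI) (rule cinner_block_left)
  then show ?thesis using nonexpansive_adjoint[OF isometric_nonexpansive[OF isometric_block]] by metis
qed

lemmas blockD = nonexpansiveD[OF isometric_nonexpansive[OF isometric_block]]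
lemmas componentD = nonexpansiveD[OF nonexpansive_component]

lemma component_sum: "component i (\<Sum>k\<in>A. f k) = (\<Sum>k\<in>A. component i (f k))"
  by (rule bounded_clinear_sum[OF nonexpansive_bounded_clinear[OF nonexpansive_component]])

lemma norm_block_sum: "(norm (\<Sum>k\<in>A. block k (f k)))\<^sup>2 = (\<Sum>k\<in>A. (norm (f k))\<^sup>2)"
proof (cases "finite A")
  case True
  have "cinner (\<Sum>k\<in>A. block k (f k)) (\<Sum>k\<in>A. block k (f k)) = (\<Sum>k\<in>A. cinner (f k) (f k))"
    using True
    by (simp add: cinner_sum_left cinner_sum_right cinner_block_left component_block if_distrib[of "cinner _"]
        sum.delta cong: if_cong)
  then show ?thesis by (simp add: cinner_self flip: of_real_sum of_real_power)
qed simp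

lemma finite_block_expansion:
  assumes "\<And>k. k \<ge> N \<Longrightarrow> component k f = 0"
  shows "f = (\<Sum>k<N. block k (component k f))"
  by (rule component_eqI) (auto simp: component_sum component_block assms not_less)

lemma norm_finite_block:
  assumes "\<And>k. k \<ge> N \<Longrightarrow> component k f = 0"
  shows "(norm f)\<^sup>2 = (\<Sum>k<N. (norm (component k f))\<^sup>2)"
  unfolding norm_block_sum[symmetric]
  by (rule arg_cong[where f = "\<lambda>x. (norm x)\<^sup>2"], rule finite_block_expansion, rule assms)

section \<open>Commutant lifting for a pure contraction\<close>

lemma isometric_inverse_adjoint:
  assumes "isometric U" "\<And>y. U (U' y) = y"
  shows "cinner (U x) y = cinner x (U' y)"
  using isometric_cinner[OF assms(1), of x "U' y"] by (simp add: assms(2))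

lemma isometricD:
  assumes "isometric U"
  shows "bounded_clinear U" "norm (U x) = norm x"
  using assms by (auto simp: isometric_def)

text \<open>A contractive colligation: the defining identity on its domain is the equality of
  \<open>\<parallel>D x\<parallel>\<^sup>2 + \<parallel>F (A x)\<parallel>\<^sup>2\<close> and \<open>\<parallel>D (B x)\<parallel>\<^sup>2 + \<parallel>F x\<parallel>\<^sup>2\<close>, both being \<open>\<parallel>x\<parallel>\<^sup>2 - \<parallel>A (B x)\<parallel>\<^sup>2\<close>.\<close>

lemma colligation_exists:
  fixes A B D F :: "'h::complex_hilbert_space \<Rightarrow> 'h"
  assumes bc: "bounded_clinear A" "bounded_clinear B" "bounded_clinear D" "bounded_clinear F"
    and AB: "\<And>x. A (B x) = B (A x)"
    and D: "\<And>x. (norm (D x))\<^sup>2 = (norm x)\<^sup>2 - (norm (A x))\<^sup>2"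
    and F: "\<And>x. (norm (F x))\<^sup>2 = (norm x)\<^sup>2 - (norm (B x))\<^sup>2"
    and U: "\<And>i. i \<in> I \<Longrightarrow> isometric (U i)" and U': "\<And>i. i \<in> I \<Longrightarrow> isometric (U' i)"
    and UU': "\<And>i x. i \<in> I \<Longrightarrow> U i (U' i x) = x"
    and c: "\<And>i x. i \<in> I \<Longrightarrow> A (U i x) = U i (A x)" "\<And>i x. i \<in> I \<Longrightarrow> A (U' i x) = U' i (A x)"
      "\<And>i x. i \<in> I \<Longrightarrow> B (U i x) = U i (B x)"
      "\<And>i x. i \<in> I \<Longrightarrow> D (U i x) = U i (D x)" "\<And>i x. i \<in> I \<Longrightarrow> D (U' i x) = U' i (D x)"
      "\<And>i x. i \<in> I \<Longrightarrow> F (U i x) = U i (F x)" "\<And>i x. i \<in> I \<Longrightarrow> F (U' i x) = U' i (F x)"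
  shows "\<exists>\<tau> :: 'h \<times> 'h \<Rightarrow> 'h \<times> 'h. nonexpansive \<tau> \<and> (\<forall>x. \<tau> (D x, F (A x)) = (D (B x), F x)) \<and>
    (\<forall>i\<in>I. \<forall>p. \<tau> (U i (fst p), U i (snd p)) = (U i (fst (\<tau> p)), U i (snd (\<tau> p))))"
proof -
  define v where "v x = (D x, F (A x))" for x
  define w where "w x = (D (B x), F x)" for x
  have pair_bc: "bounded_clinear (\<lambda>x. (S x, T x))" if S: "bounded_clinear S" and T: "bounded_clinear T"
    for S T :: "'h \<Rightarrow> 'h"
    using S T unfolding bounded_clinear_def by (auto intro!: bounded_linear_Pair simp: scaleC_prod_def)
  have v: "bounded_clinear v" unfolding v_def[abs_def]
    by (rule pair_bc[OF bc(3) bounded_clinear_compose[OF bc(4,1)]])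
  have w: "bounded_clinear w" unfolding w_def[abs_def]
    by (rule pair_bc[OF bounded_clinear_compose[OF bc(3,2)] bc(4)])
  have "(norm (w x))\<^sup>2 = (norm (v x))\<^sup>2" for x
    unfolding norm_prod_squared by (simp add: v_def w_def D F AB)
  then have "norm (w x) \<le> norm (v x)" for x by (simp add: power2_eq_iff_nonneg)
  from contraction_extension_linear[OF v w this] obtain \<tau>
    where \<tau>: "nonexpansive \<tau>" "\<And>x. \<tau> (v x) = w x" "\<And>u. (\<And>x. cinner u (v x) = 0) \<Longrightarrow> \<tau> u = 0" by blast
  have "\<tau> (U i (fst p), U i (snd p)) = (U i (fst (\<tau> p)), U i (snd (\<tau> p)))" if i: "i \<in> I" for i p
  proof -
    define R where "R p = (U i (fst p), U i (snd p))" for p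
    note Ul = bounded_clinearD[OF isometricD(1)[OF U[OF i]]]
    have R: "bounded_clinear R"
    proof (rule bounded_clinearI[where B = 1])
      show "norm (R p) \<le> 1 * norm p" for p by (simp add: R_def norm_prod_def isometricD[OF U[OF i]])
    qed (simp_all add: R_def Ul scaleC_prod_def)
    have "\<tau> (R p) = R (\<tau> p)"
    proof (rule bounded_clinear_eqI[where v = v and S = "\<lambda>p. \<tau> (R p)" and T = "\<lambda>p. R (\<tau> p)"])
      show "bounded_clinear (\<lambda>p. \<tau> (R p))" "bounded_clinear (\<lambda>p. R (\<tau> p))"
        by (rule bounded_clinear_compose[OF nonexpansive_bounded_clinear[OF \<tau>(1)] R]
            bounded_clinear_compose[OF R nonexpansive_bounded_clinear[OF \<tau>(1)]])+
      have "R (v x) = v (U i x)" "R (w x) = w (U i x)" for x by (simp_all add: R_def v_def w_def c[OF i])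
      then show "\<tau> (R (v x)) = R (\<tau> (v x))" for x by (simp add: \<tau>)
      fix u assume u: "\<And>x. cinner u (v x) = 0"
      \<comment> \<open>The adjoint of \<open>R\<close> acts by \<open>U'\<close> and permutes the
        vectors \<open>v x\<close>, so \<open>R\<close> preserves their orthogonal complement, where
        \<open>\<tau>\<close> is zero.\<close>
      have "cinner (R u) (v x) = cinner u (v (U' i x))" for x
        by (simp add: R_def v_def cinner_prod_def isometric_inverse_adjoint[OF U[OF i] UU'[OF i]] c[OF i])
      then have "\<tau> (R u) = 0" using u by (intro \<tau>(3)) simp
      moreover have "\<tau> u = 0" using u by (intro \<tau>(3))
      ultimately show "\<tau> (R u) = R (\<tau> u)" by (simp add: bounded_clinearD[OF R])
    qed
    then show ?thesis by (simp add: R_def)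
  qed
  with \<tau> show ?thesis unfolding v_def w_def by blast
qed

text \<open>Taylor coefficients of the transfer function of the colligation \<open>\<tau>\<close>.\<close>

fun transfer_coeff :: "('h::complex_hilbert_space \<times> 'h \<Rightarrow> 'h \<times> 'h) \<Rightarrow> nat \<Rightarrow> 'h \<Rightarrow> 'h"
  where
    "transfer_coeff \<tau> 0 x = fst (\<tau> (x, 0))"
  | "transfer_coeff \<tau> (Suc k) x = fst (\<tau> (0, ((\<lambda>y. snd (\<tau> (0, y))) ^^ k) (snd (\<tau> (x, 0)))))"

lemma lin_comb_Pair: "lin_comb (\<lambda>x. (p x, q x)) xs = (lin_comb p xs, lin_comb q xs)"
  by (induction xs) (auto simp: scaleC_prod_def zero_prod_def)

lemma sum_telescope_le:
  fixes f g s :: "nat \<Rightarrow> real"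
  assumes "\<And>k. g k + s k \<le> f k + s (Suc k)"
  shows "sum g {..<N} + s 0 \<le> sum f {..<N} + s N"
proof (induction N)
  case (Suc N)
  then show ?case using assms[of N] by simp
qed simp

text \<open>\<open>G\<close> is the input-output map of the linear system with system matrix
  \<open>\<tau>\<close>, run from large indices down to small ones. Contractivity of
  \<open>\<tau>\<close> says that output energy plus new state energy is at most input energy plus
  old state energy. Summed over \<open>k\<close>, the states telescope; for a finite combination the
  state is zero above the largest input index.\<close>

lemma transfer_operator_exists:
  fixes \<tau> :: "ell2 \<times> ell2 \<Rightarrow> ell2 \<times> ell2"
  assumes \<tau>: "nonexpansive \<tau>"
  shows "\<exists>G. nonexpansive G \<and> (\<forall>i x. G (block i x) = (\<Sum>k\<le>i. block k (transfer_coeff \<tau> (i - k) x)))"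
proof -
  define v where "v = (\<lambda>(i, x). block i x)"
  define g where "g = (\<lambda>(i, x). \<Sum>k\<le>i. block k (transfer_coeff \<tau> (i - k) x))"
  define d where "d y = snd (\<tau> (0, y))" for y
  \<comment> \<open>The internal state at index \<open>k\<close> caused by the single input
    \<open>x\<close> at index \<open>i\<close>; it vanishes before the input arrives, that is for
    \<open>k > i\<close>.\<close>
  define st where "st k = (\<lambda>(i, x). if k \<le> i then (d ^^ (i - k)) (snd (\<tau> (x, 0))) else 0)" for k :: nat
  note bc\<tau> = nonexpansive_bounded_clinear[OF \<tau>]
  note bcc = nonexpansive_bounded_clinear[OF nonexpansive_component]
  have \<tau>0: "\<tau> (0, 0) = (0, 0)" using nonexpansiveD(4)[OF \<tau>] by (simp add: zero_prod_def)
  have coeff: "transfer_coeff \<tau> (Suc k) x = fst (\<tau> (0, (d ^^ k) (snd (\<tau> (x, 0)))))" for k x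
    by (simp add: d_def[abs_def])
  have comp_g: "component k (g (i, x)) = (if k \<le> i then transfer_coeff \<tau> (i - k) x else 0)" for k i x
    by (auto simp: g_def component_sum component_block)
  have step: "(component k (g \<xi>), st k \<xi>) = \<tau> (component k (v \<xi>), st (Suc k) \<xi>)" for k \<xi>
  proof -
    obtain i x where \<xi>: "\<xi> = (i, x)" by (cases \<xi>)
    consider "k = i" | "k > i" | j where "i = Suc (k + j)"
      by (metis less_imp_Suc_add linorder_neqE_nat)
    then show ?thesis
    proof cases
      case 3
      then have "i - k = Suc j" "i - Suc k = j" by auto
      with 3 show ?thesis
        by (simp add: \<xi> comp_g v_def component_block st_def coeff prod_eq_iff del: transfer_coeff.simps)
          (simp add: d_def)
    qed (simp_all add: \<xi> comp_g v_def component_block st_def \<tau>0 prod_eq_iff)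
  qed
  have "norm (lin_comb g xs) \<le> norm (lin_comb v xs)" for xs
  proof -
    define s where "s k = lin_comb (st k) xs" for k
    have lin: "(component k (lin_comb g xs), s k) = \<tau> (component k (lin_comb v xs), s (Suc k))" for k
      unfolding s_def bounded_clinear_lin_comb[OF bcc] lin_comb_Pair[symmetric] bounded_clinear_lin_comb[OF bc\<tau>] step ..
    define e where "e k = (norm (s k))\<^sup>2" for k
    have le: "(norm (component k (lin_comb g xs)))\<^sup>2 + e k \<le> (norm (component k (lin_comb v xs)))\<^sup>2 + e (Suc k)" for k
    proof -
      have "(norm (component k (lin_comb g xs), s k))\<^sup>2 \<le> (norm (component k (lin_comb v xs), s (Suc k)))\<^sup>2"
        unfolding lin by (intro power_mono nonexpansive_norm[OF \<tau>]) auto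
      then show ?thesis by (simp add: norm_prod_squared e_def)
    qed
    define N where "N = Suc (sum_list (map (fst \<circ> snd) xs))"
    have small: "fst (snd p) < N" if "p \<in> set xs" for p
      using member_le_sum_list[of "fst (snd p)" "map (fst \<circ> snd) xs"] that
      by (auto simp: N_def less_Suc_eq_le)
    have zero: "lin_comb h xs = 0" if "\<And>i x. i < N \<Longrightarrow> h (i, x) = 0" for h :: "nat \<times> ell2 \<Rightarrow> ell2"
      using small
    proof (induction xs)
      case (Cons a xs)
      obtain c i x where a: "a = (c, i, x)" by (cases a)
      with Cons.prems[of a] have "i < N" by simp
      with Cons a that show ?case by simp
    qed simp
    have z: "component k (lin_comb g xs) = 0" "component k (lin_comb v xs) = 0" if "k \<ge> N" for k
      unfolding bounded_clinear_lin_comb[OF bcc] using that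
      by (auto intro!: zero simp: comp_g) (simp add: v_def component_block)
    have "s N = 0" unfolding s_def by (rule zero) (simp add: st_def)
    then have eN: "e N = 0" by (simp add: e_def)
    have "(norm (lin_comb g xs))\<^sup>2 \<le> (norm (lin_comb v xs))\<^sup>2"
      using sum_telescope_le[where s = e, OF le, of N] norm_finite_block[of N "lin_comb g xs", OF z(1)]
        norm_finite_block[of N "lin_comb v xs", OF z(2)] eN zero_le_power2[of "norm (s 0)"]
      unfolding e_def by linarith
    then show ?thesis by (rule power2_le_imp_le) simp
  qed
  from contraction_extension[OF this] obtain G where "nonexpansive G" "\<And>\<xi>. G (v \<xi>) = g \<xi>" by blast
  then have "nonexpansive G \<and> (\<forall>i x. G (block i x) = (\<Sum>k\<le>i. block k (transfer_coeff \<tau> (i - k) x)))"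
    by (simp add: v_def g_def split_paired_all)
  then show ?thesis by blast
qed

section \<open>The shift model of a pure contraction and the lifting\<close>

lemma pure_embedding_exists:
  fixes A D :: "ell2 \<Rightarrow> ell2"
  assumes A: "bounded_clinear A" and D: "bounded_clinear D"
    and norm_D: "\<And>x. (norm (D x))\<^sup>2 = (norm x)\<^sup>2 - (norm (A x))\<^sup>2"
    and pure: "\<And>x. (\<lambda>k. (A ^^ k) x) \<longlonglongrightarrow> 0"
  shows "\<exists>L. isometric L \<and> (\<forall>x. (\<lambda>N. \<Sum>k<N. block k (D ((A ^^ k) x))) \<longlonglongrightarrow> L x) \<and>
    (\<forall>k x. component k (L x) = D ((A ^^ k) x))"
proof -
  define P where "P N x = (\<Sum>k<N. block k (D ((A ^^ k) x)))" for N x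
  have Ak: "bounded_clinear (A ^^ k)" for k
    by (induction k) (auto simp: o_def id_def bounded_clinear_ident intro: bounded_clinear_compose[OF A])
  \<comment> \<open>Each term is a difference of consecutive squared norms along the orbit of
    \<open>A\<close>; purity then says that the embedding loses no norm.\<close>
  have tele: "(\<Sum>k\<in>{M..<N}. (norm (D ((A ^^ k) x)))\<^sup>2) = (norm ((A ^^ M) x))\<^sup>2 - (norm ((A ^^ N) x))\<^sup>2"
    if "M \<le> N" for M N x
    using that by (induction rule: dec_induct) (simp_all add: norm_D)
  have diff: "(norm (P N x - P M x))\<^sup>2 = (norm ((A ^^ M) x))\<^sup>2 - (norm ((A ^^ N) x))\<^sup>2" if "M \<le> N" for M N x
  proof -
    have "P N x = P M x + (\<Sum>k\<in>{M..<N}. block k (D ((A ^^ k) x)))"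
      unfolding P_def using sum.atLeastLessThan_concat[of 0 M N "\<lambda>k. block k (D ((A ^^ k) x))"] that
      by (simp add: atLeast0LessThan)
    then show ?thesis by (simp add: norm_block_sum tele[OF that])
  qed
  have "convergent (\<lambda>N. P N x)" for x
  proof -
    have "Cauchy (\<lambda>N. P N x)"
    proof (rule metric_CauchyI)
      fix e :: real assume "0 < e"
      obtain K where K: "\<And>k. k \<ge> K \<Longrightarrow> norm ((A ^^ k) x) < e"
        using LIMSEQ_D[OF pure \<open>0 < e\<close>, of x] by auto
      have *: "dist (P n x) (P m x) < e" if "K \<le> m" "m \<le> n" for m n
      proof -
        have "(norm (P n x - P m x))\<^sup>2 \<le> (norm ((A ^^ m) x))\<^sup>2" by (simp add: diff[OF that(2)])
        then have "norm (P n x - P m x) \<le> norm ((A ^^ m) x)" by (rule power2_le_imp_le) simp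
        with K[OF that(1)] show ?thesis by (simp add: dist_norm)
      qed
      then have "dist (P m x) (P n x) < e" if "m \<ge> K" "n \<ge> K" for m n
        using that by (metis dist_commute nle_le)
      then show "\<exists>K. \<forall>m\<ge>K. \<forall>n\<ge>K. dist (P m x) (P n x) < e" by blast
    qed
    then show ?thesis by (simp add: Cauchy_convergent_iff)
  qed
  then obtain L where L: "\<And>x. (\<lambda>N. P N x) \<longlonglongrightarrow> L x" unfolding convergent_def by metis
  have norm_L: "norm (L x) = norm x" for x
  proof -
    have "(norm (P N x))\<^sup>2 = (norm x)\<^sup>2 - (norm ((A ^^ N) x))\<^sup>2" for N
      using diff[of 0 N x] by (simp add: P_def)
    moreover have "(\<lambda>N. (norm x)\<^sup>2 - (norm ((A ^^ N) x))\<^sup>2) \<longlonglongrightarrow> (norm x)\<^sup>2 - (norm (0::ell2))\<^sup>2"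
      by (intro tendsto_intros pure)
    moreover have "(\<lambda>N. (norm (P N x))\<^sup>2) \<longlonglongrightarrow> (norm (L x))\<^sup>2" by (intro tendsto_intros L)
    ultimately have "(norm (L x))\<^sup>2 = (norm x)\<^sup>2 - (norm (0::ell2))\<^sup>2" using LIMSEQ_unique by fastforce
    then show ?thesis by simp
  qed
  have bcs: "bounded_clinear (P N)" for N
  proof (induction N)
    case 0
    then show ?case by (simp add: P_def[abs_def] bounded_clinear_zero)
  next
    case (Suc N)
    show ?case
      using bounded_clinear_add[OF Suc bounded_clinear_compose[OF isometricD(1)[OF isometric_block] bounded_clinear_compose[OF D Ak]], of N N]
      by (simp add: P_def[abs_def])
  qed
  have "bounded_clinear L"
  proof (rule bounded_clinearI[where B = 1])
    show "L (x + y) = L x + L y" for x y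
      using LIMSEQ_unique[OF L[of "x + y"]] tendsto_add[OF L[of x] L[of y]]
      by (simp add: bounded_clinearD[OF bcs])
    show "L (c *\<^sub>C x) = c *\<^sub>C L x" for c x
      using LIMSEQ_unique[OF L[of "c *\<^sub>C x"]] bounded_linear.tendsto[OF bounded_linear_scaleC L[of x], of c]
      by (simp add: bounded_clinearD[OF bcs])
  qed (simp add: norm_L)
  moreover have "component k (L x) = D ((A ^^ k) x)" for k x
  proof -
    have "(\<lambda>N. component k (P N x)) \<longlonglongrightarrow> component k (L x)"
      by (rule bounded_linear.tendsto[OF componentD(6) L])
    moreover have "component k (P N x) = D ((A ^^ k) x)" if "N \<ge> Suc k" for N
      using that by (simp add: P_def component_sum component_block)
    then have "(\<lambda>N. component k (P N x)) \<longlonglongrightarrow> D ((A ^^ k) x)"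
      by (intro tendsto_eventually) (auto simp: eventually_sequentially)
    ultimately show ?thesis by (rule LIMSEQ_unique)
  qed
  ultimately show ?thesis using norm_L L unfolding isometric_def P_def by blast
qed

lemma commuting_adjoints:
  assumes S: "bounded_clinear S" and T: "bounded_clinear T"
    and comm: "\<And>x. S (T x) = T (S x)"
  shows "cadjoint S (cadjoint T x) = cadjoint T (cadjoint S x)"
  by (rule cinner_ext) (simp add: cinner_adjoint'[OF S] cinner_adjoint'[OF T] comm)

text \<open>\<open>M\<close> and \<open>W i\<close> coextend \<open>A\<^sup>*\<close> and \<open>(S i)\<^sup>*\<close> along \<open>\<Lambda>\<close>, and \<open>G\<^sup>*\<close> coextends \<open>B\<^sup>*\<close> within their
  commutant.\<close>

definition lift_model :: "'i set \<Rightarrow> ('a \<Rightarrow> 'a) \<Rightarrow> ('a \<Rightarrow> 'a) \<Rightarrow> ('i \<Rightarrow> 'a \<Rightarrow> 'a) \<Rightarrow>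
    ('a \<Rightarrow> 'k::complex_hilbert_space) \<Rightarrow> ('k \<Rightarrow> 'k) \<Rightarrow> ('k \<Rightarrow> 'k) \<Rightarrow> ('i \<Rightarrow> 'k \<Rightarrow> 'k) \<Rightarrow> bool"
  where "lift_model I A B S \<Lambda> G M W \<longleftrightarrow>
    nonexpansive G \<and> isometric M \<and> (\<forall>i\<in>I. isometric (W i)) \<and>
    (\<forall>i\<in>I. \<forall>x. W i (M x) = M (W i x)) \<and> (\<forall>i\<in>I. \<forall>j\<in>I. \<forall>x. W i (W j x) = W j (W i x)) \<and>
    (\<forall>x. cadjoint G (M x) = M (cadjoint G x)) \<and> (\<forall>i\<in>I. \<forall>x. cadjoint G (W i x) = W i (cadjoint G x)) \<and>
    (\<forall>h. cadjoint M (\<Lambda> h) = \<Lambda> (A h)) \<and> (\<forall>i\<in>I. \<forall>h. cadjoint (W i) (\<Lambda> h) = \<Lambda> (S i h)) \<and>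
    (\<forall>h. G (\<Lambda> h) = \<Lambda> (B h))"

text \<open>The colligation commutes with the \<open>U i\<close>, hence so does its transfer function; it need not be
  extended to a unitary one.\<close>

lemma commutant_lifting:
  fixes A B :: "ell2 \<Rightarrow> ell2" and U U' :: "'i \<Rightarrow> ell2 \<Rightarrow> ell2"
  assumes A: "nonexpansive A" and B: "nonexpansive B" and AB: "\<And>x. A (B x) = B (A x)"
    and pure: "\<And>x. (\<lambda>k. (A ^^ k) x) \<longlonglongrightarrow> 0"
    and U: "\<And>i. i \<in> I \<Longrightarrow> isometric (U i)" and U': "\<And>i. i \<in> I \<Longrightarrow> isometric (U' i)"
    and UU': "\<And>i x. i \<in> I \<Longrightarrow> U i (U' i x) = x" and U'U: "\<And>i x. i \<in> I \<Longrightarrow> U' i (U i x) = x"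
    and AU: "\<And>i x. i \<in> I \<Longrightarrow> A (U i x) = U i (A x)" and BU: "\<And>i x. i \<in> I \<Longrightarrow> B (U i x) = U i (B x)"
    and Ucomm: "\<And>i j x. i \<in> I \<Longrightarrow> j \<in> I \<Longrightarrow> U i (U j x) = U j (U i x)"
  shows "\<exists>(L :: ell2 \<Rightarrow> ell2) G M W. isometric L \<and> lift_model I A B U L G M W"
proof -
  note bA = nonexpansive_bounded_clinear[OF A] and bB = nonexpansive_bounded_clinear[OF B]
  obtain D where D: "bounded_clinear D" "\<And>x. (norm (D x))\<^sup>2 = (norm x)\<^sup>2 - (norm (A x))\<^sup>2"
    "\<And>W x. bounded_clinear W \<Longrightarrow> (\<And>x. cadjoint A (A (W x)) = W (cadjoint A (A x))) \<Longrightarrow> D (W x) = W (D x)"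
    using defect_operator_exists[OF A] by blast
  obtain F where F: "bounded_clinear F" "\<And>x. (norm (F x))\<^sup>2 = (norm x)\<^sup>2 - (norm (B x))\<^sup>2"
    "\<And>W x. bounded_clinear W \<Longrightarrow> (\<And>x. cadjoint B (B (W x)) = W (cadjoint B (B x))) \<Longrightarrow> F (W x) = W (F x)"
    using defect_operator_exists[OF B] by blast
  define v where "v = (\<lambda>(i, x). block i x)"
  have total: "u = 0" if "\<And>\<xi>. cinner u (v \<xi>) = 0" for u
    using that by (intro block_total) (auto simp: v_def)
  have cv: "cinner (v (i, x)) (v (j, y)) = (if i = j then cinner x y else 0)" for i j x y
    by (auto simp: v_def cinner_block_left component_block)
  have "cinner (v (case \<xi> of (i, x) \<Rightarrow> (Suc i, x))) (v (case \<eta> of (i, x) \<Rightarrow> (Suc i, x))) = cinner (v \<xi>) (v \<eta>)" for \<xi> \<eta>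
    by (cases \<xi>; cases \<eta>) (simp add: cv)
  from isometric_extension[of v "\<lambda>\<xi>. case \<xi> of (i, x) \<Rightarrow> (Suc i, x)", OF this]
  obtain M where M: "isometric M" "\<And>\<xi>. M (v \<xi>) = v (case \<xi> of (i, x) \<Rightarrow> (Suc i, x))" by blast
  have M_block: "M (block i x) = block (Suc i) x" for i x using M(2)[of "(i, x)"] by (simp add: v_def)
  \<comment> \<open>Diagonal with entries \<open>U' i\<close> rather than \<open>U i\<close>,
    because the adjoint of \<open>W i\<close> is what has to extend \<open>U i\<close> along
    \<open>L\<close>.\<close>
  have "\<exists>W. isometric W \<and> (\<forall>k x. W (block k x) = block k (U' i x))" if i: "i \<in> I" for i
  proof -
    have "cinner (v (case \<xi> of (k, x) \<Rightarrow> (k, U' i x))) (v (case \<eta> of (k, x) \<Rightarrow> (k, U' i x))) = cinner (v \<xi>) (v \<eta>)" for \<xi> \<eta>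
      by (cases \<xi>; cases \<eta>) (simp add: cv isometric_cinner[OF U'[OF i]])
    from isometric_extension[of v "\<lambda>\<xi>. case \<xi> of (k, x) \<Rightarrow> (k, U' i x)", OF this]
    obtain W where "isometric W" "\<And>\<xi>. W (v \<xi>) = v (case \<xi> of (k, x) \<Rightarrow> (k, U' i x))" by blast
    then show ?thesis by (intro exI[of _ W]) (auto simp: v_def split_paired_all)
  qed
  then obtain W where W: "\<And>i. i \<in> I \<Longrightarrow> isometric (W i)"
    and W_block: "\<And>i k x. i \<in> I \<Longrightarrow> W i (block k x) = block k (U' i x)" by metis
  have eqI: "S y = T y" if "bounded_clinear S" "bounded_clinear T" "\<And>k x. S (block k x) = T (block k x)"
    for S T :: "ell2 \<Rightarrow> ell2" and y
  proof (rule bounded_clinear_eqI[where v = v, OF that(1,2)])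
    show "S (v \<xi>) = T (v \<xi>)" for \<xi> using that(3) by (cases \<xi>) (simp add: v_def)
    show "S u = T u" if "\<And>\<xi>. cinner u (v \<xi>) = 0" for u
      using total[OF that] bounded_clinearD(4)[OF \<open>bounded_clinear S\<close>] bounded_clinearD(4)[OF \<open>bounded_clinear T\<close>] by simp
  qed
  note bM = isometricD(1)[OF M(1)] and bW = isometricD(1)[OF W]
  have comp_M: "component k (cadjoint M f) = component (Suc k) f" for k f
    by (rule cinner_ext) (simp add: cinner_block_right[symmetric] cinner_adjoint'[OF bM] M_block)
  have comp_W: "component k (cadjoint (W i) f) = U i (component k f)" if i: "i \<in> I" for i k f
  proof (rule cinner_ext)
    fix y
    have "cinner (component k (cadjoint (W i) f)) y = cinner (component k f) (U' i y)"
      by (simp add: cinner_block_right[symmetric] cinner_adjoint'[OF bW[OF i]] W_block[OF i])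
    then show "cinner (component k (cadjoint (W i) f)) y = cinner (U i (component k f)) y"
      by (simp add: isometric_inverse_adjoint[OF U[OF i] UU'[OF i]])
  qed
  have AU': "A (U' i x) = U' i (A x)" if "i \<in> I" for i x
    using AU[OF that, of "U' i x"] U'U[OF that, of "A (U' i x)"] by (simp add: UU'[OF that])
  have BU': "B (U' i x) = U' i (B x)" if "i \<in> I" for i x
    using BU[OF that, of "U' i x"] U'U[OF that, of "B (U' i x)"] by (simp add: UU'[OF that])
  have U'comm: "U' i (U' j x) = U' j (U' i x)" if "i \<in> I" "j \<in> I" for i j x
  proof -
    have "x = U i (U j (U' j (U' i x)))" by (simp add: UU' that)
    also have "\<dots> = U j (U i (U' j (U' i x)))" by (rule Ucomm[OF that])
    finally show ?thesis by (metis U'U that)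
  qed
  have adjU: "cadjoint C (U i x) = U i (cadjoint C x)"
    if i: "i \<in> I" and C: "nonexpansive C" "\<And>x. C (U' i x) = U' i (C x)" for C i x
    by (rule cinner_ext) (simp add: cinner_adjoint'[OF nonexpansive_bounded_clinear[OF C(1)]]
        isometric_inverse_adjoint[OF U[OF i] UU'[OF i]] C(2))
  have adjU': "cadjoint C (U' i x) = U' i (cadjoint C x)"
    if i: "i \<in> I" and C: "nonexpansive C" "\<And>x. C (U i x) = U i (C x)" for C i x
    by (rule cinner_ext) (simp add: cinner_adjoint'[OF nonexpansive_bounded_clinear[OF C(1)]]
        isometric_inverse_adjoint[OF U'[OF i] U'U[OF i]] C(2))
  have DU: "D (U i x) = U i (D x)" if i: "i \<in> I" for i x
    using D(3)[of "U i" x] isometricD(1)[OF U[OF i]] by (simp add: AU[OF i] adjU[OF i A AU'[OF i]])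
  have DU': "D (U' i x) = U' i (D x)" if i: "i \<in> I" for i x
    using D(3)[of "U' i" x] isometricD(1)[OF U'[OF i]] by (simp add: AU'[OF i] adjU'[OF i A AU[OF i]])
  have FU: "F (U i x) = U i (F x)" if i: "i \<in> I" for i x
    using F(3)[of "U i" x] isometricD(1)[OF U[OF i]] by (simp add: BU[OF i] adjU[OF i B BU'[OF i]])
  have FU': "F (U' i x) = U' i (F x)" if i: "i \<in> I" for i x
    using F(3)[of "U' i" x] isometricD(1)[OF U'[OF i]] by (simp add: BU'[OF i] adjU'[OF i B BU[OF i]])
  obtain \<tau> :: "ell2 \<times> ell2 \<Rightarrow> ell2 \<times> ell2" where \<tau>: "nonexpansive \<tau>"
    and \<tau>eq: "\<And>x. \<tau> (D x, F (A x)) = (D (B x), F x)"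
    and \<tau>U: "\<And>i p. i \<in> I \<Longrightarrow> \<tau> (U i (fst p), U i (snd p)) = (U i (fst (\<tau> p)), U i (snd (\<tau> p)))"
    using colligation_exists[OF bA bB D(1) F(1) AB D(2) F(2), of I U U', OF U U' UU' AU AU' BU DU DU' FU FU']
    by blast
  obtain L where L: "isometric L" "\<And>x. (\<lambda>N. \<Sum>k<N. block k (D ((A ^^ k) x))) \<longlonglongrightarrow> L x"
    "\<And>k x. component k (L x) = D ((A ^^ k) x)"
    using pure_embedding_exists[OF bA D(1,2) pure] by blast
  define \<theta> where "\<theta> = transfer_coeff \<tau>"
  obtain G where G: "nonexpansive G" "\<And>i x. G (block i x) = (\<Sum>k\<le>i. block k (\<theta> (i - k) x))"
    using transfer_operator_exists[OF \<tau>] unfolding \<theta>_def by blast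
  note bG = nonexpansive_bounded_clinear[OF G(1)]
  have \<tau>Ui: "\<tau> (U i x, U i y) = (U i (fst (\<tau> (x, y))), U i (snd (\<tau> (x, y))))" if i: "i \<in> I" for i x y
    using \<tau>U[OF i, of "(x, y)"] by simp
  define d where "d y = snd (\<tau> (0, y))" for y
  have U0: "U i 0 = 0" if "i \<in> I" for i by (rule bounded_clinearD(4)[OF isometricD(1)[OF U[OF that]]])
  have dU: "(d ^^ k) (U i y) = U i ((d ^^ k) y)" if i: "i \<in> I" for i k y
    using \<tau>Ui[OF i, of 0] U0[OF i] by (induction k) (simp_all add: d_def)
  have \<theta>Suc: "\<theta> (Suc k) x = fst (\<tau> (0, (d ^^ k) (snd (\<tau> (x, 0)))))" for k x
    by (simp add: \<theta>_def d_def[abs_def])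
  have \<theta>0: "\<theta> 0 x = fst (\<tau> (x, 0))" for x by (simp add: \<theta>_def)
  have \<theta>U: "\<theta> k (U i x) = U i (\<theta> k x)" if i: "i \<in> I" for i k x
  proof (cases k)
    case 0
    then show ?thesis using \<tau>Ui[OF i, of x 0] U0[OF i] by (simp add: \<theta>0)
  next
    case (Suc j)
    have "snd (\<tau> (U i x, 0)) = U i (snd (\<tau> (x, 0)))" using \<tau>Ui[OF i, of x 0] U0[OF i] by simp
    moreover have "fst (\<tau> (0, U i y)) = U i (fst (\<tau> (0, y)))" for y using \<tau>Ui[OF i, of 0 y] U0[OF i] by simp
    ultimately show ?thesis by (simp add: Suc \<theta>Suc dU[OF i])
  qed
  have bMa: "bounded_clinear (cadjoint M)"
    by (rule nonexpansive_bounded_clinear[OF nonexpansive_adjoint[OF isometric_nonexpansive[OF M(1)]]])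
  have bWa: "bounded_clinear (cadjoint (W i))" if "i \<in> I" for i
    by (rule nonexpansive_bounded_clinear[OF nonexpansive_adjoint[OF isometric_nonexpansive[OF W[OF that]]]])
  have Ma0: "cadjoint M (block 0 x) = 0" for x
    by (rule component_eqI) (simp add: comp_M component_block componentD)
  have MaS: "cadjoint M (block (Suc k) x) = block k x" for k x
    by (rule component_eqI) (simp add: comp_M component_block)
  have Wa: "cadjoint (W i) (block k x) = block k (U i x)" if i: "i \<in> I" for i k x
    by (rule component_eqI) (simp add: comp_W[OF i] component_block U0[OF i])
  \<comment> \<open>The matrix of \<open>G\<close> is an upper triangular Toeplitz matrix, hence
    commutes with the backward shift, the adjoint of \<open>M\<close>.\<close>
  have GM: "G (cadjoint M f) = cadjoint M (G f)" for f
  proof (rule eqI[OF bounded_clinear_compose[OF bG bMa] bounded_clinear_compose[OF bMa bG]])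
    show "G (cadjoint M (block k x)) = cadjoint M (G (block k x))" for k x
    proof (cases k)
      case 0
      then show ?thesis by (simp add: Ma0 G bounded_clinearD[OF bG])
    next
      case (Suc j)
      have "cadjoint M (\<Sum>k\<le>Suc j. block k (\<theta> (Suc j - k) x)) = (\<Sum>k\<le>j. block k (\<theta> (j - k) x))"
        unfolding sum.atMost_Suc_shift bounded_clinearD(1)[OF bMa] bounded_clinear_sum[OF bMa]
        by (simp add: Ma0 MaS)
      then show ?thesis by (simp add: Suc MaS G)
    qed
  qed
  have GW: "G (cadjoint (W i) f) = cadjoint (W i) (G f)" if i: "i \<in> I" for i f
    by (rule eqI[OF bounded_clinear_compose[OF bG bWa[OF i]] bounded_clinear_compose[OF bWa[OF i] bG]])
      (simp add: Wa[OF i] G bounded_clinear_sum[OF bWa[OF i]] \<theta>U[OF i])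
  have WM: "W i (M x) = M (W i x)" if i: "i \<in> I" for i x
    by (rule eqI[OF bounded_clinear_compose[OF bW[OF i] bM] bounded_clinear_compose[OF bM bW[OF i]]])
      (simp add: W_block[OF i] M_block)
  have WW: "W i (W j x) = W j (W i x)" if i: "i \<in> I" and j: "j \<in> I" for i j x
    by (rule eqI[OF bounded_clinear_compose[OF bW[OF i] bW[OF j]] bounded_clinear_compose[OF bW[OF j] bW[OF i]]])
      (simp add: W_block[OF i] W_block[OF j] U'comm[OF i j])
  have YM: "cadjoint G (M x) = M (cadjoint G x)" for x
  proof (rule cinner_ext)
    fix y
    show "cinner (cadjoint G (M x)) y = cinner (M (cadjoint G x)) y"
      by (simp add: cinner_adjoint'[OF bG] cinner_adjoint[OF bM] GM)
  qed
  have YW: "cadjoint G (W i x) = W i (cadjoint G x)" if i: "i \<in> I" for i x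
  proof (rule cinner_ext)
    fix y
    show "cinner (cadjoint G (W i x)) y = cinner (W i (cadjoint G x)) y"
      by (simp add: cinner_adjoint'[OF bG] cinner_adjoint[OF bW[OF i]] GW[OF i])
  qed
  have M_L: "cadjoint M (L x) = L (A x)" for x
    by (rule component_eqI) (simp add: comp_M L funpow_swap1)
  have Ak_U: "(A ^^ k) (U i x) = U i ((A ^^ k) x)" if "i \<in> I" for i k x
    by (induction k) (simp_all add: AU[OF that])
  have WL: "cadjoint (W i) (L x) = L (U i x)" if i: "i \<in> I" for i x
    by (rule component_eqI) (simp add: comp_W[OF i] L Ak_U[OF i] DU[OF i])
  \<comment> \<open>The colligation identity at \<open>z\<close> rewrites
    \<open>\<tau> (D z, 0)\<close>, so that each coefficient applied to the defect vector is a
    difference of consecutive remainders. The sum telescopes to the wanted \<open>D (B y)\<close>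
    and one remainder.\<close>
  have series: "(\<Sum>l<Suc m. \<theta> l (D ((A ^^ l) y))) = D (B y) - fst (\<tau> (0, (d ^^ m) (F ((A ^^ Suc m) y))))" for m y
  proof -
    have split: "\<tau> (D z, 0) = (D (B z) - fst (\<tau> (0, F (A z))), F z - d (F (A z)))" for z
      using nonexpansiveD(3)[OF \<tau>, of "(D z, F (A z))" "(0, F (A z))"] \<tau>eq[of z]
      by (simp add: d_def prod_eq_iff)
    have "d (y - z) = d y - d z" for y z
      using nonexpansiveD(3)[OF \<tau>, of "(0, y)" "(0, z)"] by (simp add: d_def)
    then have d_diff: "(d ^^ m) (y - z) = (d ^^ m) y - (d ^^ m) z" for m y z
      by (induction m) simp_all
    have b_diff: "fst (\<tau> (0, y - z)) = fst (\<tau> (0, y)) - fst (\<tau> (0, z))" for y z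
      using nonexpansiveD(3)[OF \<tau>, of "(0, y)" "(0, z)"] by simp
    show ?thesis
    proof (induction m)
      case 0
      then show ?case by (simp add: \<theta>0 split)
    next
      case (Suc m)
      have "\<theta> (Suc m) (D ((A ^^ Suc m) y))
        = fst (\<tau> (0, (d ^^ m) (F ((A ^^ Suc m) y)))) - fst (\<tau> (0, (d ^^ Suc m) (F ((A ^^ Suc (Suc m)) y))))"
        unfolding \<theta>Suc split by (simp add: d_diff b_diff funpow_swap1)
      with Suc show ?case unfolding sum.lessThan_Suc[of _ "Suc m"] by simp
    qed
  qed
  have GL: "G (L x) = L (B x)" for x
  proof (rule component_eqI)
    fix k
    define y where "y = (A ^^ k) x"
    define P where "P N = (\<Sum>i<N. block i (D ((A ^^ i) x)))" for N
    have lim: "(\<lambda>N. component k (G (P N))) \<longlonglongrightarrow> component k (G (L x))"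
      unfolding P_def
      by (rule bounded_linear.tendsto[OF componentD(6) bounded_linear.tendsto[OF bounded_clinearD(6)[OF bG] L(2)]])
    have eq: "component k (G (P (Suc (k + m)))) = D (B y) - fst (\<tau> (0, (d ^^ m) (F ((A ^^ Suc m) y))))" for m
    proof -
      have "component k (G (P (Suc (k + m)))) = (\<Sum>i<Suc (k + m). if k \<le> i then \<theta> (i - k) (D ((A ^^ i) x)) else 0)"
        unfolding P_def bounded_clinear_sum[OF bG] component_sum
        by (intro sum.cong refl) (simp add: G component_sum component_block)
      also have "\<dots> = (\<Sum>i\<in>{k..<Suc (k + m)}. \<theta> (i - k) (D ((A ^^ i) x)))"
        by (rule sum.mono_neutral_cong_right) auto
      also have "\<dots> = (\<Sum>l<Suc m. \<theta> l (D ((A ^^ (l + k)) x)))"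
        using sum.shift_bounds_nat_ivl[of "\<lambda>i. \<theta> (i - k) (D ((A ^^ i) x))" 0 k "Suc m"]
        by (simp add: atLeast0LessThan add.commute)
      also have "\<dots> = D (B y) - fst (\<tau> (0, (d ^^ m) (F ((A ^^ Suc m) y))))"
        using series[where m = m and y = y]
        by (simp add: y_def funpow_add del: sum.lessThan_Suc)
      finally show ?thesis .
    qed
    \<comment> \<open>All factors of the remainder are contractive, so it is bounded by the orbit of
      \<open>A\<close>. This is where purity replaces unitarity of the colligation.\<close>
    have small: "norm (fst (\<tau> (0, (d ^^ m) (F ((A ^^ Suc m) y))))) \<le> norm ((A ^^ Suc m) y)" for m
    proof -
      have "norm ((0 :: ell2), z) = norm z" for z :: ell2 by (simp add: norm_prod_def)
      then have \<tau>_le: "norm (\<tau> (0, z)) \<le> norm z" for z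
        using nonexpansive_norm[OF \<tau>, of "(0, z)"] by simp
      have fst_le: "norm (fst (\<tau> (0, z))) \<le> norm z" for z
        using norm_fst_le[of "fst (\<tau> (0, z))" "snd (\<tau> (0, z))"] \<tau>_le[of z] by simp
      have "norm (d z) \<le> norm z" for z
        using norm_snd_le[of "snd (\<tau> (0, z))" "fst (\<tau> (0, z))"] \<tau>_le[of z] by (simp add: d_def)
      then have dm: "norm ((d ^^ m) z) \<le> norm z" for z by (induction m) (auto intro: order_trans)
      have "(norm (F z))\<^sup>2 \<le> (norm z)\<^sup>2" for z by (simp add: F(2))
      then have "norm (F z) \<le> norm z" for z by (meson norm_ge_zero power2_le_imp_le)
      then show ?thesis using fst_le dm by (meson order_trans)
    qed
    have "(\<lambda>m. norm ((A ^^ Suc m) y)) \<longlonglongrightarrow> 0"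
      using LIMSEQ_Suc[OF pure[of y]] by (simp only: tendsto_norm_zero)
    then have "(\<lambda>m. fst (\<tau> (0, (d ^^ m) (F ((A ^^ Suc m) y))))) \<longlonglongrightarrow> 0"
      by (rule Lim_null_comparison[OF always_eventually[OF allI[OF small]]])
    then have "(\<lambda>m. component k (G (P (Suc (k + m))))) \<longlonglongrightarrow> D (B y) - 0"
      unfolding eq by (intro tendsto_diff tendsto_const)
    moreover have "(\<lambda>m. component k (G (P (Suc (k + m))))) \<longlonglongrightarrow> component k (G (L x))"
      using LIMSEQ_ignore_initial_segment[OF lim, of "Suc k"] by (simp add: add.commute)
    ultimately have "component k (G (L x)) = D (B y)" using LIMSEQ_unique by fastforce
    moreover have "(A ^^ k) (B x) = B y" unfolding y_def by (induction k) (simp_all add: AB)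
    ultimately show "component k (G (L x)) = component k (L (B x))" by (simp add: L)
  qed
  show ?thesis
    using L(1) G(1) M(1) W WM WW YM YW M_L WL GL unfolding lift_model_def
    by (intro exI[of _ L] exI[of _ G] exI[of _ M] exI[of _ W]) blast
qed

section \<open>The asymptotic form of a contraction\<close>

definition asymptotic_form :: "('a::complex_hilbert_space \<Rightarrow> 'a) \<Rightarrow> 'a \<Rightarrow> 'a \<Rightarrow> complex"
  where "asymptotic_form R h g = lim (\<lambda>k. cinner ((R ^^ k) h) ((R ^^ k) g))"

lemma convergent_norm_squared_funpow:
  fixes R :: "'a::complex_hilbert_space \<Rightarrow> 'a"
  assumes R: "nonexpansive R"
  shows "convergent (\<lambda>k. (norm ((R ^^ k) h))\<^sup>2)"
proof (rule decseq_convergent[of _ 0])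
  show "decseq (\<lambda>k. (norm ((R ^^ k) h))\<^sup>2)"
    by (rule decseq_SucI) (simp add: nonexpansive_norm[OF R] power_mono)
qed (auto simp: convergent_def)

text \<open>Squared norms along the orbit decrease and therefore converge; polarization transfers
  this to inner products. It gives \<open>lim\<close> in \<open>asymptotic_form\<close> its intended
  value.\<close>

lemma tendsto_asymptotic_form:
  fixes R :: "'a::complex_hilbert_space \<Rightarrow> 'a"
  assumes R: "nonexpansive R"
  shows "(\<lambda>k. cinner ((R ^^ k) h) ((R ^^ k) g)) \<longlonglongrightarrow> asymptotic_form R h g"
proof -
  note Rk = nonexpansive_funpow[OF R]
  have re: "convergent (\<lambda>k. Re (cinner ((R ^^ k) h) ((R ^^ k) g)))" for h g
  proof -
    obtain a b c where "(\<lambda>k. (norm ((R ^^ k) (h + g)))\<^sup>2) \<longlonglongrightarrow> a" "(\<lambda>k. (norm ((R ^^ k) h))\<^sup>2) \<longlonglongrightarrow> b"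
      "(\<lambda>k. (norm ((R ^^ k) g))\<^sup>2) \<longlonglongrightarrow> c"
      using convergent_norm_squared_funpow[OF R] unfolding convergent_def by metis
    then have "(\<lambda>k. ((norm ((R ^^ k) (h + g)))\<^sup>2 - (norm ((R ^^ k) h))\<^sup>2 - (norm ((R ^^ k) g))\<^sup>2) / 2) \<longlonglongrightarrow> (a - b - c) / 2"
      by (intro tendsto_intros) simp_all
    moreover have "((norm ((R ^^ k) (h + g)))\<^sup>2 - (norm ((R ^^ k) h))\<^sup>2 - (norm ((R ^^ k) g))\<^sup>2) / 2
      = Re (cinner ((R ^^ k) h) ((R ^^ k) g))" for k
      by (simp add: nonexpansiveD[OF Rk] norm_add_squared)
    ultimately show ?thesis unfolding convergent_def by auto
  qed
  obtain a where a: "(\<lambda>k. Re (cinner ((R ^^ k) h) ((R ^^ k) g))) \<longlonglongrightarrow> a" using re unfolding convergent_def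
    by blast
  obtain b where "(\<lambda>k. Re (cinner ((R ^^ k) h) ((R ^^ k) (\<i> *\<^sub>C g)))) \<longlonglongrightarrow> b" using re unfolding convergent_def
    by blast
  then have b: "(\<lambda>k. Im (cinner ((R ^^ k) h) ((R ^^ k) g))) \<longlonglongrightarrow> b"
    by (simp add: nonexpansiveD[OF Rk] cinner_simps)
  have "(\<lambda>k. cinner ((R ^^ k) h) ((R ^^ k) g)) \<longlonglongrightarrow> Complex a b" using a b by (simp add: tendsto_complex_iff)
  then show ?thesis unfolding asymptotic_form_def by (simp add: limI)
qed

lemma psd_kernel_limit:
  assumes k: "\<And>n. psd_kernel (k n)" and lim: "\<And>x y. (\<lambda>n. k n x y) \<longlonglongrightarrow> K x y"
  shows "psd_kernel K"
  unfolding psd_kernel_def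
proof (intro conjI allI)
  fix x y
  have "(\<lambda>n. k n x y) = (\<lambda>n. cnj (k n y x))" using psd_kernelD(1)[OF k] by blast
  then have "(\<lambda>n. k n x y) \<longlonglongrightarrow> cnj (K y x)" using tendsto_cnj[OF lim[of y x]] by simp
  then show "K x y = cnj (K y x)" using lim LIMSEQ_unique by blast
next
  fix xs
  have 1: "(\<lambda>n. kernel_form (k n) [(1, x)] ys) \<longlonglongrightarrow> kernel_form K [(1, x)] ys" for x ys
  proof (induction ys)
    case (Cons a ys)
    obtain d y where a: "a = (d, y)" by (cases a)
    show ?case
      unfolding a kernel_form_Cons_right[of _ _ d y ys] kernel_form_single
      by (intro tendsto_intros lim Cons)
  qed simp
  have "(\<lambda>n. kernel_form (k n) zs xs) \<longlonglongrightarrow> kernel_form K zs xs" for zs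
  proof (induction zs)
    case (Cons a zs)
    obtain c x where a: "a = (c, x)" by (cases a)
    show ?case
      unfolding a kernel_form_Cons_left[of _ c x zs]
      by (intro tendsto_intros 1 Cons)
  qed simp
  then have "(\<lambda>n. Re (kernel_form (k n) xs xs)) \<longlonglongrightarrow> Re (kernel_form K xs xs)" by (rule tendsto_Re)
  then show "0 \<le> Re (kernel_form K xs xs)"
    by (rule LIMSEQ_le_const) (use psd_kernelD(2)[OF k] in blast)
qed

lemma psd_kernel_cinner: "psd_kernel (\<lambda>x y. cinner (f x) (f y))"
  unfolding psd_kernel_def kernel_form_cinner using cinner_commute by (auto simp: cinner_self)

lemma commuting_funpow:
  fixes R C :: "'a \<Rightarrow> 'a"
  assumes "\<And>x. C (R x) = R (C x)"
  shows "C ((R ^^ k) x) = (R ^^ k) (C x)"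
  by (induction k) (simp_all add: assms)

section \<open>Invariance and monotonicity of the asymptotic form\<close>

context
  fixes R :: "'a::complex_hilbert_space \<Rightarrow> 'a" and p
  assumes R: "nonexpansive R"
  defines "p \<equiv> asymptotic_form R"
begin

lemmas p_lim = tendsto_asymptotic_form[OF R, folded p_def]

lemma asymptotic_form_eqI:
  assumes "(\<lambda>k. cinner ((R ^^ k) h) ((R ^^ k) g)) \<longlonglongrightarrow> z"
  shows "p h g = z"
  using LIMSEQ_unique[OF p_lim assms] .

lemma asymptotic_form_add_left: "p (h + h') g = p h g + p h' g"
  by (rule asymptotic_form_eqI)
    (use tendsto_add[OF p_lim[of h g] p_lim[of h' g]] in \<open>simp add: nonexpansiveD[OF nonexpansive_funpow[OF R]] cinner_simps\<close>)

lemma asymptotic_form_scale_left: "p (c *\<^sub>C h) g = c * p h g"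
  by (rule asymptotic_form_eqI)
    (use tendsto_mult[OF tendsto_const p_lim[of h g], of c] in \<open>simp add: nonexpansiveD[OF nonexpansive_funpow[OF R]] cinner_simps\<close>)

lemma asymptotic_form_commute: "p h g = cnj (p g h)"
proof (rule asymptotic_form_eqI)
  have "(\<lambda>k. cnj (cinner ((R ^^ k) g) ((R ^^ k) h))) \<longlonglongrightarrow> cnj (p g h)" by (intro tendsto_cnj p_lim)
  then show "(\<lambda>k. cinner ((R ^^ k) h) ((R ^^ k) g)) \<longlonglongrightarrow> cnj (p g h)" by (simp flip: cinner_commute)
qed

lemma asymptotic_form_shift: "p (R h) (R g) = p h g"
  by (rule asymptotic_form_eqI) (use LIMSEQ_Suc[OF p_lim[of h g]] in \<open>simp add: funpow_swap1\<close>)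

lemma tendsto_asymptotic_form_norm: "(\<lambda>k. (norm ((R ^^ k) h))\<^sup>2) \<longlonglongrightarrow> Re (p h h)"
  using tendsto_Re[OF p_lim[of h h]] by (simp add: cinner_self)

lemma asymptotic_form_mono:
  assumes "nonexpansive C" "\<And>x. C (R x) = R (C x)"
  shows "Re (p (C h) (C h)) \<le> Re (p h h)"
  by (rule LIMSEQ_le[OF tendsto_asymptotic_form_norm tendsto_asymptotic_form_norm])
    (auto simp: commuting_funpow[of C R, OF assms(2), symmetric] intro!: power_mono nonexpansive_norm assms)

lemma asymptotic_form_le_norm: "Re (p h h) \<le> (norm h)\<^sup>2"
  by (rule LIMSEQ_le_const2[OF tendsto_asymptotic_form_norm])
    (auto intro!: power_mono nonexpansive_norm nonexpansive_funpow R)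

text \<open>Both \<open>S\<close> and \<open>S'\<close> are contractive for \<open>p\<close>, while
  their product \<open>R\<close> preserves it; so neither factor can lose anything. Polarization
  passes from the quadratic form to \<open>p\<close>.\<close>

lemma asymptotic_form_invariant:
  assumes S: "nonexpansive S" "\<And>x. S (R x) = R (S x)" and S': "nonexpansive S'" "\<And>x. S' (R x) = R (S' x)"
    and SS': "\<And>x. S' (S x) = R x"
  shows "p (S h) (S g) = p h g"
proof -
  have re: "Re (p (S h) (S h)) = Re (p h h)" for h
    using asymptotic_form_mono[of S, OF S] asymptotic_form_mono[of S' "S h", OF S']
    by (simp add: SS' asymptotic_form_shift antisym)
  have re2: "Re (p h g) = (Re (p (h + g) (h + g)) - Re (p h h) - Re (p g g)) / 2" for h g
    using asymptotic_form_commute[of h g]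
    by (simp add: asymptotic_form_add_left asymptotic_form_commute[of h "h + g"] asymptotic_form_commute[of g "h + g"])
  have re3: "Re (p (S h) (S g)) = Re (p h g)" for h g
    unfolding re2[of h g] re2[of "S h" "S g"] nonexpansiveD(1)[OF S(1), symmetric] re ..
  have "p h (\<i> *\<^sub>C g) = - \<i> * p h g" for h g
    using asymptotic_form_commute[of h "\<i> *\<^sub>C g"] asymptotic_form_commute[of h g]
    by (simp add: asymptotic_form_scale_left)
  then have im: "Im (p h g) = Re (p h (\<i> *\<^sub>C g))" for h g by simp
  show ?thesis
    by (rule complex_eqI) (simp_all only: re3 im nonexpansiveD(2)[OF S(1), symmetric])
qed

end

text \<open>Contractivity carries strong convergence from the span to its closure. The complement
  dies at the first application of \<open>A\<close>, so the powers are considered from exponent one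
  on.\<close>

lemma pure_from_generators:
  fixes A :: "'h::complex_hilbert_space \<Rightarrow> 'h" and v :: "'x \<Rightarrow> 'h"
  assumes A: "nonexpansive A" and v: "\<And>x. (\<lambda>k. (A ^^ k) (v x)) \<longlonglongrightarrow> 0"
    and perp: "\<And>u. (\<And>x. cinner u (v x) = 0) \<Longrightarrow> A u = 0"
  shows "(\<lambda>k. (A ^^ k) y) \<longlonglongrightarrow> 0"
proof -
  note Ak = nonexpansive_funpow[OF A]
  obtain X u where X: "(\<lambda>n. lin_comb v (X n)) \<longlonglongrightarrow> y - u" and u: "\<And>x. cinner u (v x) = 0"
    using lin_comb_decomposition[of v y] by metis
  have lc: "(\<lambda>k. (A ^^ k) (lin_comb v xs)) \<longlonglongrightarrow> 0" for xs
  proof (induction xs)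
    case Nil
    then show ?case by (simp add: nonexpansiveD[OF Ak])
  next
    case (Cons a xs)
    obtain c x where a: "a = (c, x)" by (cases a)
    have "(\<lambda>k. c *\<^sub>C (A ^^ k) (v x) + (A ^^ k) (lin_comb v xs)) \<longlonglongrightarrow> c *\<^sub>C 0 + 0"
      by (intro tendsto_add Cons bounded_linear.tendsto[OF bounded_linear_scaleC v])
    then show ?case by (simp add: a nonexpansiveD[OF Ak])
  qed
  have Au: "(A ^^ Suc k) u = 0" for k
    using perp[OF u] nonexpansiveD(4)[OF Ak] by (simp add: funpow_swap1)
  have "(\<lambda>k. (A ^^ Suc k) y) \<longlonglongrightarrow> 0"
  proof (rule LIMSEQ_I)
    fix r :: real assume r: "0 < r"
    obtain n where n: "norm (lin_comb v (X n) - (y - u)) < r / 2"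
      using LIMSEQ_D[OF X, of "r / 2"] r by auto
    obtain K where K: "\<And>k. k \<ge> K \<Longrightarrow> norm ((A ^^ k) (lin_comb v (X n))) < r / 2"
      using LIMSEQ_D[OF lc, of "r / 2"] r by auto
    have "norm ((A ^^ Suc k) y - 0) < r" if "k \<ge> K" for k
    proof -
      have "(A ^^ Suc k) y = (A ^^ Suc k) (lin_comb v (X n)) - (A ^^ Suc k) (lin_comb v (X n) - (y - u))"
        unfolding nonexpansiveD(3)[OF Ak] Au by simp
      also have "norm \<dots> \<le> norm ((A ^^ Suc k) (lin_comb v (X n))) + norm ((A ^^ Suc k) (lin_comb v (X n) - (y - u)))"
        by (rule norm_triangle_ineq4)
      also have "\<dots> < r / 2 + r / 2"
        using K[of "Suc k"] that n nonexpansive_norm[OF Ak, of "Suc k" "lin_comb v (X n) - (y - u)"]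
        by (intro add_strict_mono) auto
      finally show ?thesis by simp
    qed
    then show "\<exists>K. \<forall>k\<ge>K. norm ((A ^^ Suc k) y - 0) < r" by blast
  qed
  then show ?thesis by (rule LIMSEQ_imp_Suc)
qed

section \<open>Making the factors of \<open>R\<close> unitary\<close>

lemma separable_spaceE:
  assumes "separable_space (euclidean :: 'a::metric_space topology)"
  obtains D :: "'a::metric_space set" where "countable D" "\<And>x e. e > 0 \<Longrightarrow> \<exists>d\<in>D. dist x d < e"
proof -
  from assms obtain D :: "'a::metric_space set" where D: "countable D" "closure D = UNIV"
    unfolding separable_space_def by (auto simp: euclidean_closure_of)
  have "\<exists>d\<in>D. dist x d < e" if "e > 0" for x e
    using D(2) that by (metis UNIV_I closure_approachable dist_commute)
  with D(1) show thesis by (rule that)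
qed

definition unitary_model :: "'i set \<Rightarrow> ('a::complex_hilbert_space \<Rightarrow> 'a) \<Rightarrow> ('a \<Rightarrow> 'a) \<Rightarrow> ('a \<Rightarrow> 'a) \<Rightarrow> ('i \<Rightarrow> 'a \<Rightarrow> 'a) \<Rightarrow>
    ('a \<Rightarrow> 'k::complex_hilbert_space) \<Rightarrow> ('k \<Rightarrow> 'k) \<Rightarrow> ('k \<Rightarrow> 'k) \<Rightarrow> ('i \<Rightarrow> 'k \<Rightarrow> 'k) \<Rightarrow> ('i \<Rightarrow> 'k \<Rightarrow> 'k) \<Rightarrow> bool"
  where "unitary_model I R A B S J A' B' U U' \<longleftrightarrow> bounded_clinear J \<and> (\<forall>h g. cinner (J h) (J g) = asymptotic_form R h g) \<and>
    nonexpansive A' \<and> nonexpansive B' \<and> (\<forall>i\<in>I. isometric (U i) \<and> isometric (U' i)) \<and>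
    (\<forall>i\<in>I. \<forall>x. U i (U' i x) = x \<and> U' i (U i x) = x) \<and>
    (\<forall>x. A' (B' x) = B' (A' x)) \<and> (\<forall>i\<in>I. \<forall>x. A' (U i x) = U i (A' x) \<and> B' (U i x) = U i (B' x)) \<and>
    (\<forall>i\<in>I. \<forall>j\<in>I. \<forall>x. U i (U j x) = U j (U i x)) \<and> (\<forall>x. (\<lambda>k. (A' ^^ k) x) \<longlonglongrightarrow> 0) \<and>
    (\<forall>h. A' (J h) = J (A h)) \<and> (\<forall>h. B' (J h) = J (B h)) \<and> (\<forall>i\<in>I. \<forall>h. U i (J h) = J (S i h))"

text \<open>The completion of the direct system given by \<open>R\<close>: \<open>v (l, h)\<close> plays the role of \<open>R\<^sup>-\<^sup>l h\<close>. All
  factors \<open>S i\<close> of \<open>R\<close> become unitary there.\<close>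

lemma unitary_extension:
  fixes R A B :: "'a::complex_hilbert_space \<Rightarrow> 'a" and S S' :: "'i \<Rightarrow> 'a \<Rightarrow> 'a"
  assumes sep: "separable_space (euclidean :: 'a topology)"
    and R: "nonexpansive R" and A: "nonexpansive A" and B: "nonexpansive B"
    and S: "\<And>i. i \<in> I \<Longrightarrow> nonexpansive (S i)" and S': "\<And>i. i \<in> I \<Longrightarrow> nonexpansive (S' i)"
    and AR: "\<And>x. A (R x) = R (A x)" and BR: "\<And>x. B (R x) = R (B x)" and AB: "\<And>x. A (B x) = B (A x)"
    and SR: "\<And>i x. i \<in> I \<Longrightarrow> S i (R x) = R (S i x)" and S'R: "\<And>i x. i \<in> I \<Longrightarrow> S' i (R x) = R (S' i x)"
    and SS': "\<And>i x. i \<in> I \<Longrightarrow> S i (S' i x) = R x" and S'S: "\<And>i x. i \<in> I \<Longrightarrow> S' i (S i x) = R x"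
    and AS: "\<And>i x. i \<in> I \<Longrightarrow> A (S i x) = S i (A x)" and BS: "\<And>i x. i \<in> I \<Longrightarrow> B (S i x) = S i (B x)"
    and SS: "\<And>i j x. i \<in> I \<Longrightarrow> j \<in> I \<Longrightarrow> S i (S j x) = S j (S i x)"
    and pure: "\<And>h. (\<lambda>k. Re (asymptotic_form R ((A ^^ k) h) ((A ^^ k) h))) \<longlonglongrightarrow> 0"
  shows "\<exists>(J :: 'a \<Rightarrow> ell2) A' B' U U'. unitary_model I R A B S J A' B' U U'"
proof -
  define p where "p = asymptotic_form R"
  note Rk = nonexpansive_funpow[OF R]
  note p_add = asymptotic_form_add_left[OF R, folded p_def] and p_scale = asymptotic_form_scale_left[OF R, folded p_def]
    and p_comm = asymptotic_form_commute[OF R, folded p_def] and p_R = asymptotic_form_shift[OF R, folded p_def]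
    and p_mono = asymptotic_form_mono[OF R, folded p_def] and p_le = asymptotic_form_le_norm[OF R, folded p_def]
    and p_lim = tendsto_asymptotic_form[OF R, folded p_def]
  have p_Rk: "p ((R ^^ k) h) ((R ^^ k) g) = p h g" for k h g
    by (induction k) (simp_all add: p_R)
  have p_add2: "p h (g + g') = p h g + p h g'" for h g g'
    using p_comm[of h "g + g'"] p_comm[of h g] p_comm[of h g'] by (simp add: p_add)
  have p_scale2: "p h (c *\<^sub>C g) = cnj c * p h g" for c h g
    using p_comm[of h "c *\<^sub>C g"] p_comm[of h g] by (simp add: p_scale)
  have p_diff: "p (h - h') g = p h g - p h' g" for h h' g
    using p_add[of "h - h'" h' g] by simp
  have p_diff2: "p h (g - g') = p h g - p h g'" for h g g'
    using p_add2[of h "g - g'" g'] by simp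
  \<comment> \<open>The inner product of the formal vectors \<open>R^(-l) h\<close> and
    \<open>R^(-m) g\<close>, computed by applying \<open>R^(l + m)\<close> to both, under which
    \<open>p\<close> is invariant.\<close>
  define K where "K = (\<lambda>(l, h) (m, g). p ((R ^^ m) h) ((R ^^ l) g))"
  have K: "K (l, h) (m, g) = p ((R ^^ m) h) ((R ^^ l) g)" for l m h g by (simp add: K_def)
  have "psd_kernel K"
  proof (rule psd_kernel_limit)
    \<comment> \<open>Positivity of \<open>K\<close> comes from genuine Gram kernels: the formal
      inverse is shifted away by \<open>R^N\<close>. The truncated difference is harmless, since
      only \<open>N \<ge> l + m\<close> enters the limit.\<close>
    define f where "f N = (\<lambda>(l, h). (R ^^ (N - l)) h)" for N :: nat
    show "psd_kernel (\<lambda>x y. cinner (f N x) (f N y))" for N by (rule psd_kernel_cinner)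
    fix x y :: "nat \<times> 'a"
    obtain l h m g where xy: "x = (l, h)" "y = (m, g)" by (cases x, cases y)
    have "cinner (f (k + (l + m)) x) (f (k + (l + m)) y) = cinner ((R ^^ k) ((R ^^ m) h)) ((R ^^ k) ((R ^^ l) g))" for k
    proof -
      have "k + (l + m) - l = k + m" "k + (l + m) - m = k + l" by auto
      then show ?thesis by (simp add: f_def xy funpow_add)
    qed
    then have "(\<lambda>k. cinner (f (k + (l + m)) x) (f (k + (l + m)) y)) \<longlonglongrightarrow> K x y"
      using p_lim by (simp add: xy K)
    then show "(\<lambda>N. cinner (f N x) (f N y)) \<longlonglongrightarrow> K x y" by (rule LIMSEQ_offset)
  qed
  obtain D where D: "countable D" "\<And>x e. e > 0 \<Longrightarrow> \<exists>d\<in>D. dist (x::'a) d < e"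
    using separable_spaceE[OF sep] by metis
  \<comment> \<open>At a fixed level \<open>l\<close> the distance of the kernel is bounded by the
    norm of the original space, so one countable dense set serves all levels.\<close>
  have dense: "\<exists>d\<in>UNIV \<times> D. Re (K x x) + Re (K d d) - 2 * Re (K x d) < e" if "e > 0" for x e
  proof -
    obtain l h where x: "x = (l, h)" by (cases x)
    obtain d where d: "d \<in> D" "dist h d < sqrt e" using D(2)[of "sqrt e" h] \<open>e > 0\<close> by auto
    have "Re (K x x) + Re (K (l, d) (l, d)) - 2 * Re (K x (l, d)) = Re (p (h - d) (h - d))"
      using p_comm[of h d] by (simp add: x K p_Rk p_diff p_diff2)
    also have "\<dots> \<le> (norm (h - d))\<^sup>2" by (rule p_le)
    also have "\<dots> < (sqrt e)\<^sup>2" using d by (intro power_strict_mono) (auto simp: dist_norm)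
    finally show ?thesis using d \<open>e > 0\<close> by (intro bexI[of _ "(l, d)"]) auto
  qed
  obtain v :: "nat \<times> 'a \<Rightarrow> ell2" where "\<And>x y. cinner (v x) (v y) = K x y"
    using kernel_representation[OF \<open>psd_kernel K\<close> countable_SIGMA[OF countableI_type D(1)] dense] by blast
  then have v: "cinner (v (l, h)) (v (m, g)) = p ((R ^^ m) h) ((R ^^ l) g)" for l m h g by (simp add: K)
  have v_add: "v (l, h + g) = v (l, h) + v (l, g)" for l h g
  proof -
    have "cinner (v (l, h + g) - (v (l, h) + v (l, g))) (v (m, k)) = 0" for m k
      by (simp add: cinner_simps v nonexpansiveD[OF Rk] p_add)
    then have "cinner (v (l, h + g) - (v (l, h) + v (l, g))) (v (l, h + g) - (v (l, h) + v (l, g))) = 0"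
      by (simp only: cinner_diff_right cinner_add_right) simp
    then show ?thesis by (simp add: cinner_self)
  qed
  have v_scale: "v (l, c *\<^sub>C h) = c *\<^sub>C v (l, h)" for l c h
  proof -
    have "cinner (v (l, c *\<^sub>C h) - c *\<^sub>C v (l, h)) (v (m, k)) = 0" for m k
      by (simp add: cinner_simps v nonexpansiveD[OF Rk] p_scale)
    then have "cinner (v (l, c *\<^sub>C h) - c *\<^sub>C v (l, h)) (v (l, c *\<^sub>C h) - c *\<^sub>C v (l, h)) = 0"
      by (simp only: cinner_diff_right cinner_scaleC_right) simp
    then show ?thesis by (simp add: cinner_self)
  qed
  have v_R: "v (Suc l, R h) = v (l, h)" for l h
  proof -
    have "cinner (v (Suc l, R h) - v (l, h)) (v (m, k)) = 0" for m k
      by (simp add: cinner_simps v p_R funpow_swap1)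
        (metis funpow_swap1 p_R)
    then have "cinner (v (Suc l, R h) - v (l, h)) (v (Suc l, R h) - v (l, h)) = 0"
      by (simp only: cinner_diff_right) simp
    then show ?thesis by (simp add: cinner_self)
  qed
  have v_Rk: "v (l + k, (R ^^ k) h) = v (l, h)" for l k h
    by (induction k) (simp_all add: v_R)
  have norm_v: "(norm (v (l, h)))\<^sup>2 = Re (p h h)" for l h
    using v[of l h l h] by (simp add: p_Rk cinner_self) (metis Re_complex_of_real of_real_power)
  \<comment> \<open>Reduction to a common denominator: a combination of formal vectors equals a
    single one, by the same \<open>N\<close> and \<open>u\<close> for every operator commuting with
    \<open>R\<close>. Contractivity on combinations thus becomes monotonicity of \<open>p\<close> at
    one vector.\<close>
  have collect: "\<exists>N u. lin_comb v xs = v (N, u) \<and> (\<forall>C. bounded_clinear C \<and> (\<forall>x. C (R x) = R (C x)) \<longrightarrow>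
      lin_comb (\<lambda>(l, h). v (l, C h)) xs = v (N, C u))" for xs
  proof -
    have "\<exists>N u. \<forall>C. bounded_clinear C \<and> (\<forall>x. C (R x) = R (C x)) \<longrightarrow>
      lin_comb (\<lambda>(l, h). v (l, C h)) xs = v (N, C u)"
    proof (induction xs)
      case Nil
      have "v (0, 0) = 0" using v_scale[of 0 0 0] by simp
      then show ?case by (intro exI[of _ 0]) (auto simp: bounded_clinearD)
    next
      case (Cons a xs)
      obtain c l h where a: "a = (c, l, h)" by (cases a)
      obtain N u where u: "\<And>C. bounded_clinear C \<Longrightarrow> (\<And>x. C (R x) = R (C x)) \<Longrightarrow>
        lin_comb (\<lambda>(l, h). v (l, C h)) xs = v (N, C u)" using Cons by blast
      have "lin_comb (\<lambda>(l, h). v (l, C h)) (a # xs) = v (l + N, C ((R ^^ N) (c *\<^sub>C h) + (R ^^ l) u))"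
        if C: "bounded_clinear C" "\<And>x. C (R x) = R (C x)" for C
      proof -
        have "lin_comb (\<lambda>(l, h). v (l, C h)) (a # xs) = v (l, C (c *\<^sub>C h)) + v (N, C u)"
          using u[OF C] by (simp add: a bounded_clinearD[OF C(1)] v_scale)
        also have "\<dots> = v (l + N, (R ^^ N) (C (c *\<^sub>C h))) + v (N + l, (R ^^ l) (C u))" by (simp only: v_Rk)
        also have "\<dots> = v (l + N, C ((R ^^ N) (c *\<^sub>C h) + (R ^^ l) u))"
          by (simp add: v_add bounded_clinearD(1)[OF C(1)] commuting_funpow[of C R, OF C(2)] add.commute)
        finally show ?thesis .
      qed
      then show ?case by blast
    qed
    then obtain N u where u: "\<forall>C. bounded_clinear C \<and> (\<forall>x. C (R x) = R (C x)) \<longrightarrow>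
      lin_comb (\<lambda>(l, h). v (l, C h)) xs = v (N, C u)" by blast
    have "lin_comb v xs = v (N, u)" using u[rule_format, of "\<lambda>x. x"]
      by (simp add: bounded_clinear_ident case_prod_unfold)
    with u show ?thesis by blast
  qed
  have ext: "\<exists>C'. nonexpansive C' \<and> (\<forall>l h. C' (v (l, h)) = v (l, C h)) \<and> (\<forall>u. (\<forall>x. cinner u (v x) = 0) \<longrightarrow> C' u = 0)"
    if C: "nonexpansive C" "\<And>x. C (R x) = R (C x)" for C
  proof -
    have "norm (lin_comb (\<lambda>(l, h). v (l, C h)) xs) \<le> norm (lin_comb v xs)" for xs
    proof -
      obtain N u where u: "lin_comb v xs = v (N, u)" "lin_comb (\<lambda>(l, h). v (l, C h)) xs = v (N, C u)"
        using collect[of xs] C nonexpansive_bounded_clinear[OF C(1)] by blast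
      have "(norm (v (N, C u)))\<^sup>2 \<le> (norm (v (N, u)))\<^sup>2" unfolding norm_v by (rule p_mono[OF C])
      then show ?thesis unfolding u by (rule power2_le_imp_le) simp
    qed
    from contraction_extension[OF this] show ?thesis by auto
  qed
  obtain A'
    where A': "nonexpansive A'" "\<And>l h. A' (v (l, h)) = v (l, A h)" "\<And>u. (\<And>x. cinner u (v x) = 0) \<Longrightarrow> A' u = 0"
    using ext[OF A AR] by blast
  obtain B'
    where B': "nonexpansive B'" "\<And>l h. B' (v (l, h)) = v (l, B h)" "\<And>u. (\<And>x. cinner u (v x) = 0) \<Longrightarrow> B' u = 0"
    using ext[OF B BR] by blast
  have p_S: "p (S i h) (S i g) = p h g" and p_S': "p (S' i h) (S' i g) = p h g" if i: "i \<in> I" for i h g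
    using asymptotic_form_invariant[OF R S[OF i] SR[OF i] S'[OF i] S'R[OF i] S'S[OF i]]
      asymptotic_form_invariant[OF R S'[OF i] S'R[OF i] S[OF i] SR[OF i] SS'[OF i]]
    unfolding p_def by auto
  have "\<exists>U. isometric U \<and> (\<forall>l h. U (v (l, h)) = v (l, S i h)) \<and> (\<forall>u. (\<forall>x. cinner u (v x) = 0) \<longrightarrow> U u = u)"
    if i: "i \<in> I" for i
  proof -
    have "cinner (v (map_prod id (S i) x)) (v (map_prod id (S i) y)) = cinner (v x) (v y)" for x y
      by (cases x; cases y) (simp add: v p_S[OF i] commuting_funpow[of "S i" R, OF SR[OF i], symmetric])
    from isometric_extension[of v, OF this] show ?thesis by auto
  qed
  then obtain U where U: "\<And>i. i \<in> I \<Longrightarrow> isometric (U i)" "\<And>i l h. i \<in> I \<Longrightarrow> U i (v (l, h)) = v (l, S i h)"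
    "\<And>i u. i \<in> I \<Longrightarrow> (\<And>x. cinner u (v x) = 0) \<Longrightarrow> U i u = u" by metis
  \<comment> \<open>The inverse of \<open>S i\<close> is \<open>S' i\<close> followed by the formal
    inverse of \<open>R\<close>, which raises the level by one. Both directions are the identity off
    the span, so they are inverse to each other everywhere.\<close>
  have "\<exists>U. isometric U \<and> (\<forall>l h. U (v (l, h)) = v (Suc l, S' i h)) \<and> (\<forall>u. (\<forall>x. cinner u (v x) = 0) \<longrightarrow> U u = u)"
    if i: "i \<in> I" for i
  proof -
    have "cinner (v (map_prod Suc (S' i) x)) (v (map_prod Suc (S' i) y)) = cinner (v x) (v y)" for x y
      by (cases x; cases y) (simp add: v p_S'[OF i] p_R commuting_funpow[of "S' i" R, OF S'R[OF i], symmetric] S'R[OF i, symmetric])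
    from isometric_extension[of v, OF this] show ?thesis by auto
  qed
  then obtain U'
    where U': "\<And>i. i \<in> I \<Longrightarrow> isometric (U' i)" "\<And>i l h. i \<in> I \<Longrightarrow> U' i (v (l, h)) = v (Suc l, S' i h)"
    "\<And>i u. i \<in> I \<Longrightarrow> (\<And>x. cinner u (v x) = 0) \<Longrightarrow> U' i u = u" by metis
  note bU = isometricD(1)[OF U(1)] and bU' = isometricD(1)[OF U'(1)]
  note bA = nonexpansive_bounded_clinear[OF A'(1)] and bB = nonexpansive_bounded_clinear[OF B'(1)]
  have eqI: "P y = Q y" if "bounded_clinear P" "bounded_clinear Q" "\<And>l h. P (v (l, h)) = Q (v (l, h))"
    "\<And>u. (\<And>x. cinner u (v x) = 0) \<Longrightarrow> P u = Q u" for P Q :: "ell2 \<Rightarrow> ell2" and y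
    by (rule bounded_clinear_eqI[where v = v, OF that(1,2)]) (use that(3,4) in auto)
  have UU': "U i (U' i x) = x" if i: "i \<in> I" for i x
    by (rule eqI[OF bounded_clinear_compose[OF bU[OF i] bU'[OF i]] bounded_clinear_ident])
      (simp_all add: U(2,3)[OF i] U'(2,3)[OF i] SS'[OF i] v_R)
  have U'U: "U' i (U i x) = x" if i: "i \<in> I" for i x
    by (rule eqI[OF bounded_clinear_compose[OF bU'[OF i] bU[OF i]] bounded_clinear_ident])
      (simp_all add: U(2,3)[OF i] U'(2,3)[OF i] S'S[OF i] v_R)
  have A'B': "A' (B' x) = B' (A' x)" for x
    by (rule eqI[OF bounded_clinear_compose[OF bA bB] bounded_clinear_compose[OF bB bA]])
      (simp_all add: A' B' AB bounded_clinearD(4)[OF bA] bounded_clinearD(4)[OF bB])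
  have A'U: "A' (U i x) = U i (A' x)" if i: "i \<in> I" for i x
    by (rule eqI[OF bounded_clinear_compose[OF bA bU[OF i]] bounded_clinear_compose[OF bU[OF i] bA]])
      (simp_all add: A' U(2,3)[OF i] AS[OF i] bounded_clinearD(4)[OF bU[OF i]])
  have B'U: "B' (U i x) = U i (B' x)" if i: "i \<in> I" for i x
    by (rule eqI[OF bounded_clinear_compose[OF bB bU[OF i]] bounded_clinear_compose[OF bU[OF i] bB]])
      (simp_all add: B' U(2,3)[OF i] BS[OF i] bounded_clinearD(4)[OF bU[OF i]])
  have UU: "U i (U j x) = U j (U i x)" if i: "i \<in> I" and j: "j \<in> I" for i j x
    by (rule eqI[OF bounded_clinear_compose[OF bU[OF i] bU[OF j]] bounded_clinear_compose[OF bU[OF j] bU[OF i]]])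
      (simp_all add: U(2,3)[OF i] U(2,3)[OF j] SS[OF i j])
  have A'k: "(A' ^^ k) (v (l, h)) = v (l, (A ^^ k) h)" for k l h
    by (induction k) (simp_all add: A')
  have "(\<lambda>k. (A' ^^ k) (v x)) \<longlonglongrightarrow> 0" for x
  proof -
    obtain l h where x: "x = (l, h)" by (cases x)
    have "(\<lambda>k. sqrt ((norm ((A' ^^ k) (v x)))\<^sup>2)) \<longlonglongrightarrow> sqrt 0"
      unfolding x A'k norm_v p_def by (intro tendsto_real_sqrt pure)
    then show ?thesis by (simp add: tendsto_norm_zero_iff)
  qed
  then have pure': "(\<lambda>k. (A' ^^ k) x) \<longlonglongrightarrow> 0" for x
    by (rule pure_from_generators[of A' v, OF A'(1) _ A'(3)])
  define J where "J h = v (0, h)" for h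
  have norm_J: "norm (J h) \<le> 1 * norm h" for h
  proof -
    have "(norm (J h))\<^sup>2 \<le> (norm h)\<^sup>2" unfolding J_def norm_v by (rule p_le)
    then have "norm (J h) \<le> norm h" by (rule power2_le_imp_le) simp
    then show ?thesis by simp
  qed
  have J: "bounded_clinear J" by (rule bounded_clinearI[OF _ _ norm_J]) (simp_all add: J_def v_add v_scale)
  have JJ: "cinner (J h) (J g) = asymptotic_form R h g" for h g by (simp add: J_def v p_def)
  have inter: "A' (J h) = J (A h)" "B' (J h) = J (B h)" for h by (simp_all add: J_def A' B')
  have interU: "U i (J h) = J (S i h)" if "i \<in> I" for i h by (simp add: J_def U(2)[OF that])
  show ?thesis
    by (rule exI[of _ J], rule exI[of _ A'], rule exI[of _ B'], rule exI[of _ U], rule exI[of _ U'],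
        unfold unitary_model_def, intro conjI ballI allI)
      (rule J JJ A'(1) B'(1) A'B' pure' inter | (rule U(1) U'(1) UU' U'U A'U B'U UU interU; assumption))+
qed

text \<open>The unitary extension followed by the commutant lifting. As \<open>L\<close> is
  isometric, the composed map still realizes the asymptotic form.\<close>

lemma isometric_model:
  fixes R A B :: "'a::complex_hilbert_space \<Rightarrow> 'a" and S S' :: "'i \<Rightarrow> 'a \<Rightarrow> 'a"
  assumes sep: "separable_space (euclidean :: 'a topology)"
    and R: "nonexpansive R" and A: "nonexpansive A" and B: "nonexpansive B"
    and S: "\<And>i. i \<in> I \<Longrightarrow> nonexpansive (S i)" and S': "\<And>i. i \<in> I \<Longrightarrow> nonexpansive (S' i)"
    and AR: "\<And>x. A (R x) = R (A x)" and BR: "\<And>x. B (R x) = R (B x)" and AB: "\<And>x. A (B x) = B (A x)"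
    and SR: "\<And>i x. i \<in> I \<Longrightarrow> S i (R x) = R (S i x)" and S'R: "\<And>i x. i \<in> I \<Longrightarrow> S' i (R x) = R (S' i x)"
    and SS': "\<And>i x. i \<in> I \<Longrightarrow> S i (S' i x) = R x" and S'S: "\<And>i x. i \<in> I \<Longrightarrow> S' i (S i x) = R x"
    and AS: "\<And>i x. i \<in> I \<Longrightarrow> A (S i x) = S i (A x)" and BS: "\<And>i x. i \<in> I \<Longrightarrow> B (S i x) = S i (B x)"
    and SS: "\<And>i j x. i \<in> I \<Longrightarrow> j \<in> I \<Longrightarrow> S i (S j x) = S j (S i x)"
    and pure: "\<And>h. (\<lambda>k. Re (asymptotic_form R ((A ^^ k) h) ((A ^^ k) h))) \<longlonglongrightarrow> 0"
  shows "\<exists>(\<Lambda> :: 'a \<Rightarrow> ell2) G M W. bounded_clinear \<Lambda> \<and>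
    (\<forall>h g. cinner (\<Lambda> h) (\<Lambda> g) = asymptotic_form R h g) \<and> lift_model I A B S \<Lambda> G M W"
proof -
  obtain J :: "'a \<Rightarrow> ell2" and A' B' U U' where ext: "unitary_model I R A B S J A' B' U U'"
    using unitary_extension[of R A B I S S', OF assms, simplified triv_forall_equality True_implies_equals implies_True_equals]
    by (elim exE)
  have J: "bounded_clinear J" "\<And>h g. cinner (J h) (J g) = asymptotic_form R h g" using ext
    unfolding unitary_model_def by blast+
  have A'B': "nonexpansive A'" "nonexpansive B'" "\<And>x. A' (B' x) = B' (A' x)" "\<And>x. (\<lambda>k. (A' ^^ k) x) \<longlonglongrightarrow> 0"
    using ext unfolding unitary_model_def by blast+
  have U: "\<And>i. i \<in> I \<Longrightarrow> isometric (U i)" "\<And>i. i \<in> I \<Longrightarrow> isometric (U' i)"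
      "\<And>i x. i \<in> I \<Longrightarrow> U i (U' i x) = x" "\<And>i x. i \<in> I \<Longrightarrow> U' i (U i x) = x"
      "\<And>i x. i \<in> I \<Longrightarrow> A' (U i x) = U i (A' x)" "\<And>i x. i \<in> I \<Longrightarrow> B' (U i x) = U i (B' x)"
      "\<And>i j x. i \<in> I \<Longrightarrow> j \<in> I \<Longrightarrow> U i (U j x) = U j (U i x)"
    using ext unfolding unitary_model_def by blast+
  have inter: "\<And>h. A' (J h) = J (A h)" "\<And>h. B' (J h) = J (B h)" "\<And>i h. i \<in> I \<Longrightarrow> U i (J h) = J (S i h)"
    using ext unfolding unitary_model_def by blast+
  obtain L :: "ell2 \<Rightarrow> ell2" and G M W where L: "isometric L" and lift: "lift_model I A' B' U L G M W"
    using commutant_lifting[of A' B' I U U', OF A'B' U, simplified triv_forall_equality True_implies_equals implies_True_equals]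
    by (elim exE conjE)
  have "lift_model I A B S (\<lambda>h. L (J h)) G M W"
    using lift unfolding lift_model_def by (simp flip: inter)
  moreover have "bounded_clinear (\<lambda>h. L (J h))" by (rule bounded_clinear_compose[OF isometricD(1)[OF L] J(1)])
  ultimately show ?thesis
    by (intro exI[of _ "\<lambda>h. L (J h)"] exI[of _ G] exI[of _ M] exI[of _ W]) (simp add: isometric_cinner[OF L] J(2))
qed

section \<open>Dilations from positive semidefinite kernels\<close>

lemma psd_kernel_zero: "psd_kernel (\<lambda>x y. 0)"
  using psd_kernel_cinner[of "\<lambda>_. 0 :: ell2"] by simp

lemma psd_kernel_add:
  assumes k: "psd_kernel k" and l: "psd_kernel l"
  shows "psd_kernel (\<lambda>x y. k x y + l x y)"
proof -
  have "kernel_form (\<lambda>x y. k x y + l x y) xs ys = kernel_form k xs ys + kernel_form l xs ys" for xs ys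
    by (simp add: kernel_form_def case_prod_unfold distrib_left sum_list_addf)
  then show ?thesis
    unfolding psd_kernel_def using psd_kernelD[OF k] psd_kernelD[OF l]
    by (metis complex_cnj_add plus_complex.sel(1) add_nonneg_nonneg)
qed

lemma psd_kernel_sum: "(\<And>i. i \<in> I \<Longrightarrow> psd_kernel (k i)) \<Longrightarrow> psd_kernel (\<lambda>x y. \<Sum>i\<in>I. k i x y)"
  by (induction I rule: infinite_finite_induct) (auto intro: psd_kernel_zero psd_kernel_add)

text \<open>The Gram kernel of the Schaeffer isometric dilation of \<open>Y\<close>; in each pair of truncated
  differences at most one is nonzero.\<close>

definition power_kernel :: "('k::complex_hilbert_space \<Rightarrow> 'k) \<Rightarrow> nat \<times> 'k \<Rightarrow> nat \<times> 'k \<Rightarrow> complex"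
  where "power_kernel Y = (\<lambda>(m, x) (q, y). cinner ((Y ^^ (m - q)) x) ((Y ^^ (q - m)) y))"

text \<open>The Schaeffer isometry sends \<open>x\<close> to \<open>(Y x, D x, 0, ...)\<close> and
  shifts the defect coordinates. The approximants \<open>k N\<close> are Gram kernels of the vectors
  so obtained, cut off after \<open>N\<close> defect coordinates; their sums telescope and are
  eventually constant.\<close>

lemma psd_power_kernel:
  fixes Y :: "'k::complex_hilbert_space \<Rightarrow> 'k"
  assumes Y: "nonexpansive Y"
  shows "psd_kernel (power_kernel Y)"
proof -
  obtain D :: "'k \<Rightarrow> 'k" where D: "bounded_clinear D" "\<And>x. (norm (D x))\<^sup>2 = (norm x)\<^sup>2 - (norm (Y x))\<^sup>2"
    using defect_operator_exists[OF Y] by blast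
  have DD: "cinner (D x) (D y) = cinner x y - cinner (Y x) (Y y)" for x y
  proof -
    have S: "bounded_clinear (\<lambda>x. (D x, Y x))"
      using D(1) nonexpansive_bounded_clinear[OF Y] unfolding bounded_clinear_def
      by (auto intro!: bounded_linear_Pair simp: scaleC_prod_def)
    have "(norm (D u, Y u))\<^sup>2 = (norm u)\<^sup>2" for u by (simp add: norm_prod_squared D)
    then have "norm (D u, Y u) = norm u" for u by (metis norm_ge_zero power2_eq_iff_nonneg)
    from cinner_polarization_eq[OF this S bounded_clinear_ident]
    have "cinner (D x, Y x) (D y, Y y) = cinner x y" .
    then show ?thesis by (simp add: cinner_prod_def algebra_simps)
  qed
  \<comment> \<open>Before \<open>D\<close> is applied, \<open>a l\<close> is the entry in the
    defect coordinate \<open>l\<close> of the m-th power of the Schaeffer isometry at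
    \<open>x\<close>.\<close>
  define a where "a l = (\<lambda>(m, x). if l < m then (Y ^^ (m - Suc l)) x else 0)" for l :: nat
  define k
    where "k N p r = cinner ((Y ^^ fst p) (snd p)) ((Y ^^ fst r) (snd r)) + (\<Sum>l<N. cinner (D (a l p)) (D (a l r)))"
    for N :: nat and p r :: "nat \<times> 'k"
  have psd: "psd_kernel (k N)" for N
    unfolding k_def by (intro psd_kernel_add psd_kernel_sum psd_kernel_cinner)
  have lim: "(\<lambda>N. k N p r) \<longlonglongrightarrow> power_kernel Y p r" for p r
  proof -
    obtain m x q y where pr: "p = (m, x)" "r = (q, y)" by (cases p, cases r)
    have "k N p r = power_kernel Y p r" if "N \<ge> m + q" for N
    proof -
      define t where "t l = cinner ((Y ^^ (m - l)) x) ((Y ^^ (q - l)) y)" for l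
      have "cinner (D (a l p)) (D (a l r)) = (if l < min m q then t (Suc l) - t l else 0)" for l
      proof (cases "l < min m q")
        case True
        then have "m - l = Suc (m - Suc l)" "q - l = Suc (q - Suc l)" by auto
        then have "t l = cinner (Y ((Y ^^ (m - Suc l)) x)) (Y ((Y ^^ (q - Suc l)) y))" unfolding t_def by simp
        with True show ?thesis by (simp add: DD a_def pr t_def)
      next
        case False
        then show ?thesis by (auto simp: a_def pr bounded_clinearD(4)[OF D(1)])
      qed
      then have "(\<Sum>l<N. cinner (D (a l p)) (D (a l r))) = (\<Sum>l<min m q. t (Suc l) - t l)"
        using that by (intro sum.mono_neutral_cong_right) auto
      also have "\<dots> = t (min m q) - t 0" by (rule sum_lessThan_telescope)
      finally have "k N p r = t (min m q)" by (simp add: k_def pr t_def)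
      also have "m - min m q = m - q" "q - min m q = q - m" by auto
      then have "t (min m q) = power_kernel Y p r" by (simp add: t_def power_kernel_def pr)
      finally show ?thesis .
    qed
    then show ?thesis
      by (intro tendsto_eventually) (auto simp: eventually_sequentially)
  qed
  show ?thesis by (rule psd_kernel_limit[OF psd lim])
qed

section \<open>From a kernel to an isometric dilation\<close>

lemma isometric_if_cinner_preserving:
  assumes J: "\<And>h g. cinner (J h) (J g) = cinner h g"
  shows "isometric J"
proof -
  have norm_J: "norm (J h) = norm h" for h by (rule norm_eq_cinner[OF J])
  have "cinner (J (h + g) - (J h + J g)) (J (h + g) - (J h + J g)) = 0" for h g
    by (simp add: cinner_simps J)
  then have add: "J (h + g) = J h + J g" for h g by (simp add: cinner_self)
  have "cinner (J (c *\<^sub>C h) - c *\<^sub>C J h) (J (c *\<^sub>C h) - c *\<^sub>C J h) = 0" for c h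
    by (simp add: cinner_simps J)
  then have "J (c *\<^sub>C h) = c *\<^sub>C J h" for c h by (simp add: cinner_self)
  with add have "bounded_clinear J" by (rule bounded_clinearI[where B = 1]) (simp add: norm_J)
  with norm_J show ?thesis by (simp add: isometric_def)
qed

lemma orth_proj_eqI:
  assumes J: "isometric J" and orth: "\<And>g. cinner (x - J z) (J g) = 0"
  shows "orth_proj (range J) x = J z"
  unfolding orth_proj_def
proof (rule the_equality)
  show "J z \<in> range J \<and> (\<forall>s\<in>range J. cinner (x - J z) s = 0)" using orth by blast
  fix y assume y: "y \<in> range J \<and> (\<forall>s\<in>range J. cinner (x - y) s = 0)"
  then obtain u where u: "y = J u" by blast
  have "cinner (x - J u) (J (z - u)) = 0" using y unfolding u by blast
  then have "cinner ((x - J u) - (x - J z)) (J (z - u)) = 0"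
    unfolding cinner_diff_left[of "x - J u"] orth by simp
  moreover have "(x - J u) - (x - J z) = J (z - u)"
    by (simp add: bounded_clinearD(3)[OF isometricD(1)[OF J]])
  ultimately have "cinner (J (z - u)) (J (z - u)) = 0" by simp
  then have "J (z - u) = 0" by (simp add: cinner_self)
  then show "y = J z" by (simp add: u bounded_clinearD(3)[OF isometricD(1)[OF J]])
qed

lemma isometric_isometry_on: "isometric V \<Longrightarrow> isometry_on UNIV V"
  unfolding isometry_on_def by (simp add: isometricD bounded_clinearD[OF isometricD(1)])

text \<open>The compression identity is stated weakly, by inner products. This form can be read off
  a kernel, and it serves both the projection formula and the norm estimate.\<close>

definition isometric_lift :: "nat \<Rightarrow> (nat \<Rightarrow> 'a::complex_hilbert_space \<Rightarrow> 'a) \<Rightarrow>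
    ('a \<Rightarrow> 'k::complex_hilbert_space) \<Rightarrow> (nat \<Rightarrow> 'k \<Rightarrow> 'k) \<Rightarrow> bool"
  where "isometric_lift m T J V \<longleftrightarrow> isometric J \<and> (\<forall>i\<in>{1..m}. isometric (V i)) \<and>
    (\<forall>i\<in>{1..m}. \<forall>j\<in>{1..m}. \<forall>x. V i (V j x) = V j (V i x)) \<and>
    (\<forall>\<alpha> h g. cinner (op_monomial m V \<alpha> (J h)) (J g) = cinner (op_monomial m T \<alpha> h) g)"

lemma isometric_lift_has_dilation:
  fixes J :: "'a::complex_hilbert_space \<Rightarrow> ell2"
  assumes lift: "isometric_lift m T J V"
  shows "has_isometric_dilation m T"
proof -
  have J: "isometric J" and V: "\<And>i. i \<in> {1..m} \<Longrightarrow> isometric (V i)"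
    and VV: "\<And>i j x. i \<in> {1..m} \<Longrightarrow> j \<in> {1..m} \<Longrightarrow> V i (V j x) = V j (V i x)"
    and compress: "\<And>\<alpha> h g. cinner (op_monomial m V \<alpha> (J h)) (J g) = cinner (op_monomial m T \<alpha> h) g"
    using lift unfolding isometric_lift_def by blast+
  have "J (op_monomial m T \<alpha> h) = orth_proj (range J) (op_monomial m V \<alpha> (J h))" for \<alpha> h
    by (rule orth_proj_eqI[OF J, symmetric]) (simp add: cinner_diff_left isometric_cinner[OF J] compress)
  moreover have "commuting_isometries m UNIV V"
    unfolding commuting_isometries_def using VV isometric_isometry_on[OF V] by blast
  moreover have "closed_csubspace (UNIV :: ell2 set)" by (simp add: closed_csubspace_def)
  ultimately have "isometric_dilation_on m T UNIV J V"
    unfolding isometric_dilation_on_def using isometric_isometry_on[OF J] by blast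
  then show ?thesis unfolding has_isometric_dilation_def by blast
qed

text \<open>\<open>\<kappa>\<close> prescribes the inner products of the vectors that the monomials
  in \<open>V\<close> produce from \<open>J h\<close> and \<open>J g\<close>. Invariance under a
  common shift makes each \<open>V i\<close> isometric, and \<open>diag\<close> makes
  \<open>J\<close> isometric.\<close>

lemma isometric_lift_from_kernel:
  fixes T :: "nat \<Rightarrow> 'a::complex_hilbert_space \<Rightarrow> 'a" and \<kappa> :: "(nat \<Rightarrow> nat) \<times> 'a \<Rightarrow> (nat \<Rightarrow> nat) \<times> 'a \<Rightarrow> complex"
  assumes sep: "separable_space (euclidean :: 'a topology)" and psd: "psd_kernel \<kappa>"
    and shift: "\<And>i \<alpha> \<beta> h g. i \<in> {1..m} \<Longrightarrow>
      \<kappa> (\<alpha>(i := Suc (\<alpha> i)), h) (\<beta>(i := Suc (\<beta> i)), g) = \<kappa> (\<alpha>, h) (\<beta>, g)"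
    and cong: "\<And>\<alpha> \<alpha>' h y. (\<And>i. i \<in> {1..m} \<Longrightarrow> \<alpha> i = \<alpha>' i) \<Longrightarrow> \<kappa> (\<alpha>, h) y = \<kappa> (\<alpha>', h) y"
    and diag: "\<And>\<alpha> h g. \<kappa> (\<alpha>, h) (\<alpha>, g) = cinner h g"
    and compress: "\<And>\<alpha> h g. \<kappa> (\<alpha>, h) (\<lambda>_. 0, g) = cinner (op_monomial m T \<alpha> h) g"
  shows "\<exists>(J :: 'a \<Rightarrow> ell2) V. isometric_lift m T J V"
proof -
  obtain D where D: "countable D" "\<And>x e. e > 0 \<Longrightarrow> \<exists>d\<in>D. dist (x::'a) d < e"
    using separable_spaceE[OF sep] by metis
  have cong2: "\<kappa> x (\<alpha>, h) = \<kappa> x (\<alpha>', h)" if "\<And>i. i \<in> {1..m} \<Longrightarrow> \<alpha> i = \<alpha>' i" for \<alpha> \<alpha>' h x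
  proof -
    have "\<kappa> x (\<alpha>, h) = cnj (\<kappa> (\<alpha>, h) x)" by (rule psd_kernelD(1)[OF psd])
    also have "\<kappa> (\<alpha>, h) x = \<kappa> (\<alpha>', h) x" by (rule cong) (rule that)
    also have "cnj (\<kappa> (\<alpha>', h) x) = \<kappa> x (\<alpha>', h)" by (rule psd_kernelD(1)[OF psd, symmetric])
    finally show ?thesis .
  qed
  \<comment> \<open>All exponent functions form an uncountable set; by \<open>cong\<close> those
    restricted to the finitely many relevant indices suffice.\<close>
  have "countable (PiE {1..m} (\<lambda>_. UNIV :: nat set))" by (rule countable_PiE) auto
  then have countable: "countable (PiE {1..m} (\<lambda>_. UNIV :: nat set) \<times> D)" using D(1) by blast
  have dense: "\<exists>d\<in>PiE {1..m} (\<lambda>_. UNIV) \<times> D. Re (\<kappa> x x) + Re (\<kappa> d d) - 2 * Re (\<kappa> x d) < e" if "e > 0" for x e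
  proof -
    obtain \<alpha> h where x: "x = (\<alpha>, h)" by (cases x)
    obtain d where d: "d \<in> D" "dist h d < sqrt e" using D(2)[of "sqrt e" h] \<open>e > 0\<close> by auto
    have c: "\<kappa> (\<alpha>, h) (restrict \<alpha> {1..m}, d) = \<kappa> (\<alpha>, h) (\<alpha>, d)" by (rule cong2) simp
    have "Re (\<kappa> x x) + Re (\<kappa> (restrict \<alpha> {1..m}, d) (restrict \<alpha> {1..m}, d)) - 2 * Re (\<kappa> x (restrict \<alpha> {1..m}, d))
      = (norm (h - d))\<^sup>2"
      unfolding x c diag norm_diff_squared by (simp add: cinner_self)
    also have "\<dots> < (sqrt e)\<^sup>2" using d by (intro power_strict_mono) (auto simp: dist_norm)
    finally show ?thesis using d \<open>e > 0\<close> by (intro bexI[of _ "(restrict \<alpha> {1..m}, d)"]) auto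
  qed
  obtain v :: "(nat \<Rightarrow> nat) \<times> 'a \<Rightarrow> ell2" where v: "\<And>x y. cinner (v x) (v y) = \<kappa> x y"
    using kernel_representation[OF psd countable dense] by blast
  have v_cong: "v (\<alpha>, h) = v (\<alpha>', h)" if "\<And>i. i \<in> {1..m} \<Longrightarrow> \<alpha> i = \<alpha>' i" for \<alpha> \<alpha>' h
  proof -
    have "cinner (v (\<alpha>, h) - v (\<alpha>', h)) (v (\<alpha>, h) - v (\<alpha>', h)) = 0"
      using cong[OF that] cong2[OF that] by (simp add: cinner_simps v)
    then show ?thesis by (simp add: cinner_self)
  qed
  define J where "J h = v (\<lambda>_. 0, h)" for h
  have J: "isometric J" by (rule isometric_if_cinner_preserving) (simp add: J_def v diag)
  define \<sigma> where "\<sigma> i = (\<lambda>(\<alpha> :: nat \<Rightarrow> nat, h :: 'a). (\<alpha>(i := Suc (\<alpha> i)), h))" for i :: nat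
  have "\<exists>V. isometric V \<and> (\<forall>x. V (v x) = v (\<sigma> i x)) \<and> (\<forall>u. (\<forall>x. cinner u (v x) = 0) \<longrightarrow> V u = u)"
    if i: "i \<in> {1..m}" for i
  proof (rule isometric_extension)
    show "cinner (v (\<sigma> i x)) (v (\<sigma> i y)) = cinner (v x) (v y)" for x y
      by (cases x; cases y) (simp add: \<sigma>_def v shift[OF i])
  qed
  then obtain V where V: "\<And>i. i \<in> {1..m} \<Longrightarrow> isometric (V i)" "\<And>i x. i \<in> {1..m} \<Longrightarrow> V i (v x) = v (\<sigma> i x)"
    "\<And>i u. i \<in> {1..m} \<Longrightarrow> (\<And>x. cinner u (v x) = 0) \<Longrightarrow> V i u = u" by metis
  note bV = isometricD(1)[OF V(1)]
  have VV: "V i (V j x) = V j (V i x)" if i: "i \<in> {1..m}" and j: "j \<in> {1..m}" for i j x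
  proof (rule bounded_clinear_eqI[where v = v, OF bounded_clinear_compose[OF bV[OF i] bV[OF j]] bounded_clinear_compose[OF bV[OF j] bV[OF i]]])
    show "V i (V j (v x)) = V j (V i (v x))" for x
      by (cases "i = j"; cases x) (simp_all add: V(2)[OF i] V(2)[OF j] \<sigma>_def fun_upd_twist)
  qed (simp add: V(3)[OF i] V(3)[OF j])
  have Vk: "(V i ^^ c) (v (\<beta>, h)) = v (\<beta>(i := \<beta> i + c), h)" if i: "i \<in> {1..m}" for i c \<beta> h
    by (induction c) (simp_all add: V(2)[OF i] \<sigma>_def fun_upd_def cong: if_cong)
  have mono: "op_monomial k V \<alpha> (v (\<beta>, h)) = v (\<lambda>i. if i \<in> {1..k} then \<beta> i + \<alpha> i else \<beta> i, h)"
    if "k \<le> m" for k \<alpha> \<beta> h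
    using that
  proof (induction k arbitrary: \<beta>)
    case (Suc k)
    have "op_monomial (Suc k) V \<alpha> (v (\<beta>, h)) = op_monomial k V \<alpha> (v (\<beta>(Suc k := \<beta> (Suc k) + \<alpha> (Suc k)), h))"
      using Suc.prems by (simp add: Vk)
    also have "\<dots> = v (\<lambda>i. if i \<in> {1..k} then (\<beta>(Suc k := \<beta> (Suc k) + \<alpha> (Suc k))) i + \<alpha> i else (\<beta>(Suc k := \<beta> (Suc k) + \<alpha> (Suc k))) i, h)"
      using Suc by simp
    also have "(\<lambda>i. if i \<in> {1..k} then (\<beta>(Suc k := \<beta> (Suc k) + \<alpha> (Suc k))) i + \<alpha> i else (\<beta>(Suc k := \<beta> (Suc k) + \<alpha> (Suc k))) i)
      = (\<lambda>i. if i \<in> {1..Suc k} then \<beta> i + \<alpha> i else \<beta> i)"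
      by (auto simp: fun_eq_iff)
    finally show ?case .
  qed simp
  have "cinner (op_monomial m V \<alpha> (J h)) (J g) = cinner (op_monomial m T \<alpha> h) g" for \<alpha> h g
  proof -
    have "op_monomial m V \<alpha> (J h) = v (\<alpha>, h)"
      unfolding J_def mono[OF order_refl] by (rule v_cong) simp
    then show ?thesis by (simp add: J_def v compress)
  qed
  then have "isometric_lift m T J V" unfolding isometric_lift_def using J V(1) VV by blast
  then show ?thesis by blast
qed

section \<open>Products of commuting operators\<close>

lemma foldr_commute:
  assumes "\<And>i x. i \<in> set is \<Longrightarrow> T (S i x) = S i (T x)"
  shows "T (foldr S is x) = foldr S is (T x)"
  using assms by (induction "is") simp_all

lemma foldr_remove1:
  assumes "\<And>i j x. i \<in> set is \<Longrightarrow> j \<in> set is \<Longrightarrow> S i (S j x) = S j (S i x)" and "i \<in> set is"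
  shows "S i (foldr S (remove1 i is) x) = foldr S is x"
  using assms
proof (induction "is")
  case (Cons a "is")
  then show ?case by (cases "a = i") simp_all
qed simp

lemma nonexpansive_foldr:
  fixes S :: "'i \<Rightarrow> 'a::complex_hilbert_space \<Rightarrow> 'a"
  assumes "\<And>i. i \<in> set is \<Longrightarrow> nonexpansive (S i)"
  shows "nonexpansive (foldr S is)"
  using assms
proof (induction "is")
  case Nil
  show ?case by (rule nonexpansiveI) simp_all
next
  case (Cons a "is")
  then show ?case using nonexpansive_compose[of "S a" "foldr S is"] by (simp add: o_def)
qed

lemma funpow_compose_commute:
  fixes f g :: "'a \<Rightarrow> 'a"
  assumes "\<And>x. f (g x) = g (f x)"
  shows "((\<lambda>x. f (g x)) ^^ N) x = (f ^^ N) ((g ^^ N) x)"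
proof (induction N arbitrary: x)
  case (Suc N)
  have "(f ^^ N) (g y) = g ((f ^^ N) y)" for y by (induction N) (simp_all add: assms)
  with Suc show ?case by simp
qed simp

lemma funpow_foldr:
  fixes S :: "'i \<Rightarrow> 'a \<Rightarrow> 'a"
  assumes "\<And>i j x. i \<in> set is \<Longrightarrow> j \<in> set is \<Longrightarrow> S i (S j x) = S j (S i x)"
  shows "(foldr S is ^^ N) x = foldr (\<lambda>i. S i ^^ N) is x"
  using assms
proof (induction "is")
  case Nil
  show ?case by (induction N) simp_all
next
  case (Cons a "is")
  have "(foldr S (a # is) ^^ N) x = ((\<lambda>x. S a (foldr S is x)) ^^ N) x" by (simp add: o_def)
  also have "\<dots> = (S a ^^ N) ((foldr S is ^^ N) x)"
    by (rule funpow_compose_commute, rule foldr_commute) (use Cons.prems in auto)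
  also have "\<dots> = (S a ^^ N) (foldr (\<lambda>i. S i ^^ N) is x)" using Cons by simp
  finally show ?case by (simp add: o_def)
qed

text \<open>Adjoints reverse the order of the factors, hence \<open>rev\<close>.\<close>

lemma cinner_op_monomial:
  fixes T :: "nat \<Rightarrow> 'a::complex_hilbert_space \<Rightarrow> 'a"
  assumes "\<And>i x y. i \<in> {1..m} \<Longrightarrow> cinner (T i x) y = cinner x (S i y)"
  shows "cinner (op_monomial m T \<alpha> x) y = cinner x (foldr (\<lambda>i. S i ^^ \<alpha> i) (rev [1..<Suc m]) y)"
  using assms
proof (induction m arbitrary: x y)
  case (Suc m)
  have pow: "cinner ((T (Suc m) ^^ k) x) y = cinner x ((S (Suc m) ^^ k) y)" for k x y
  proof (induction k arbitrary: x y)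
    case (Suc k)
    then show ?case using Suc.prems \<open>\<And>i x y. i \<in> {1..Suc m} \<Longrightarrow> cinner (T i x) y = cinner x (S i y)\<close>
      by (simp add: funpow_swap1)
  qed simp
  have "cinner (op_monomial (Suc m) T \<alpha> x) y
    = cinner ((T (Suc m) ^^ \<alpha> (Suc m)) x) (foldr (\<lambda>i. S i ^^ \<alpha> i) (rev [1..<Suc m]) y)"
    using Suc by simp
  also have "\<dots> = cinner x (foldr (\<lambda>i. S i ^^ \<alpha> i) (rev [1..<Suc (Suc m)]) y)"
    by (simp add: pow)
  finally show ?case .
qed simp

section \<open>The dilation\<close>

text \<open>By \<open>inv\<close> the loss under \<open>S i\<close> is unaffected by the other
  factors, and by iteration so is the loss under a power. The loss under the whole product, split
  factor by factor, therefore becomes a sum of losses at the same vector \<open>h\<close>.\<close>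

lemma norm_foldr_powers:
  fixes S :: "'i \<Rightarrow> 'a::complex_hilbert_space \<Rightarrow> 'a"
  assumes "distinct is"
    and comm: "\<And>i j x. i \<in> set is \<Longrightarrow> j \<in> set is \<Longrightarrow> S i (S j x) = S j (S i x)"
    and inv: "\<And>i j x. i \<in> set is \<Longrightarrow> j \<in> set is \<Longrightarrow> i \<noteq> j \<Longrightarrow>
      (norm (S j x))\<^sup>2 - (norm (S i (S j x)))\<^sup>2 = (norm x)\<^sup>2 - (norm (S i x))\<^sup>2"
  shows "(norm h)\<^sup>2 - (norm (foldr (\<lambda>i. S i ^^ N) is h))\<^sup>2 = (\<Sum>i\<in>set is. (norm h)\<^sup>2 - (norm ((S i ^^ N) h))\<^sup>2)"
  using assms
proof (induction "is")
  case (Cons a "is")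
  have inv1: "(norm (S j x))\<^sup>2 - (norm ((S a ^^ k) (S j x)))\<^sup>2 = (norm x)\<^sup>2 - (norm ((S a ^^ k) x))\<^sup>2"
    if j: "j \<in> set is" for j k x
  proof (induction k)
    case (Suc k)
    have "a \<noteq> j" using Cons.prems(1) j by auto
    moreover have "(S a ^^ k) (S j x) = S j ((S a ^^ k) x)"
      using Cons.prems(2) j by (induction k) auto
    ultimately show ?case using Suc Cons.prems(3)[of a j "(S a ^^ k) x"] j by simp
  qed simp
  have inv2: "(norm ((S j ^^ l) x))\<^sup>2 - (norm ((S a ^^ k) ((S j ^^ l) x)))\<^sup>2 = (norm x)\<^sup>2 - (norm ((S a ^^ k) x))\<^sup>2"
    if j: "j \<in> set is" for j k l x
    by (induction l) (simp_all add: inv1[OF j])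
  have "(norm (foldr (\<lambda>i. S i ^^ N) js h))\<^sup>2 - (norm ((S a ^^ N) (foldr (\<lambda>i. S i ^^ N) js h)))\<^sup>2
    = (norm h)\<^sup>2 - (norm ((S a ^^ N) h))\<^sup>2" if "set js \<subseteq> set is" for js
    using that by (induction js) (simp_all add: inv2)
  from this[of "is"] Cons show ?case by simp
qed simp

definition summand_model :: "nat \<Rightarrow> (nat \<Rightarrow> 'a::complex_hilbert_space \<Rightarrow> 'a) \<Rightarrow> ('a \<Rightarrow> 'a) \<Rightarrow>
    ('a \<Rightarrow> 'k::complex_hilbert_space) \<Rightarrow> ('k \<Rightarrow> 'k) \<Rightarrow> (nat \<Rightarrow> 'k \<Rightarrow> 'k) \<Rightarrow> bool"
  where "summand_model n S R \<Lambda> G V \<longleftrightarrow> bounded_clinear \<Lambda> \<and>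
    (\<forall>h g. cinner (\<Lambda> h) (\<Lambda> g) = asymptotic_form R h g) \<and>
    nonexpansive G \<and> (\<forall>i\<in>{1..n}. isometric (V i)) \<and>
    (\<forall>i\<in>{1..n}. \<forall>k\<in>{1..n}. \<forall>x. V i (V k x) = V k (V i x)) \<and>
    (\<forall>i\<in>{1..n}. \<forall>x. cadjoint G (V i x) = V i (cadjoint G x)) \<and>
    (\<forall>i\<in>{1..n}. \<forall>h. cadjoint (V i) (\<Lambda> h) = \<Lambda> (S i h)) \<and>
    (\<forall>h. G (\<Lambda> h) = \<Lambda> (S (Suc n) h))"

text \<open>\<open>S j\<close> goes to the adjoint of the shift \<open>M\<close>, and the factors of
  \<open>R\<close> go to the adjoints of the \<open>W i\<close>; together they give the isometries
  \<open>V 1\<close> to \<open>V n\<close>. The last operator stays a contraction.\<close>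

lemma isometric_summand:
  fixes S :: "nat \<Rightarrow> 'a::complex_hilbert_space \<Rightarrow> 'a"
  assumes sep: "separable_space (euclidean :: 'a topology)"
    and S: "\<And>i. i \<in> {1..Suc n} \<Longrightarrow> nonexpansive (S i)"
    and comm: "\<And>i j x. i \<in> {1..Suc n} \<Longrightarrow> j \<in> {1..Suc n} \<Longrightarrow> S i (S j x) = S j (S i x)"
    and j: "j \<in> {1..n}"
    and R_def: "R = foldr S (remove1 j [1..<Suc n])"
    and pure: "\<And>h. (\<lambda>k. Re (asymptotic_form R ((S j ^^ k) h) ((S j ^^ k) h))) \<longlonglongrightarrow> 0"
  shows "\<exists>(\<Lambda> :: 'a \<Rightarrow> ell2) G V. summand_model n S R \<Lambda> G V"
proof -
  define I where "I = {1..n} - {j}"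
  \<comment> \<open>The product \<open>R\<close> with the factor \<open>S i\<close> left out, which
    serves as the inverse of \<open>S i\<close> up to \<open>R\<close>.\<close>
  define S' where "S' i = foldr S (remove1 i (remove1 j [1..<Suc n]))" for i
  have set_R: "set (remove1 j [1..<Suc n]) = I" by (auto simp: I_def)
  have I: "i \<in> {1..Suc n}" if "i \<in> I" for i using that by (auto simp: I_def)
  have j': "j \<in> {1..Suc n}" using j by auto
  have sub: "set (remove1 i (remove1 j [1..<Suc n])) \<subseteq> {1..Suc n}" for i
    using set_remove1_subset[of i "remove1 j [1..<Suc n]"] set_R I by blast
  have c: "T (foldr S is x) = foldr S is (T x)"
    if "\<And>i x. i \<in> {1..Suc n} \<Longrightarrow> T (S i x) = S i (T x)" "set is \<subseteq> {1..Suc n}" for T "is" x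
    using that by (intro foldr_commute) auto
  have subR: "set (remove1 j [1..<Suc n]) \<subseteq> {1..Suc n}" using set_R I by blast
  have R: "nonexpansive R" unfolding R_def using S subR by (intro nonexpansive_foldr) auto
  have S': "nonexpansive (S' i)" for i unfolding S'_def using S sub by (intro nonexpansive_foldr) auto
  have SR: "S i (R x) = R (S i x)" if "i \<in> {1..Suc n}" for i x
    unfolding R_def using subR comm[OF that] by (intro c) auto
  have SS'c: "S k (S' i x) = S' i (S k x)" if "k \<in> {1..Suc n}" for i k x
    unfolding S'_def using sub comm[OF that] by (intro c) auto
  have S'R: "S' i (R x) = R (S' i x)" for i x
    unfolding R_def using subR SS'c by (intro c) auto
  have SS': "S i (S' i x) = R x" if "i \<in> I" for i x
    unfolding S'_def R_def using that set_R subR comm by (intro foldr_remove1) auto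
  have S'S: "S' i (S i x) = R x" if "i \<in> I" for i x
    using SS'[OF that] SS'c[OF I[OF that]] by simp
  have n: "Suc n \<in> {1..Suc n}" by simp
  have "\<exists>(\<Lambda> :: 'a \<Rightarrow> ell2) G M W. bounded_clinear \<Lambda> \<and>
    (\<forall>h g. cinner (\<Lambda> h) (\<Lambda> g) = asymptotic_form R h g) \<and> lift_model I (S j) (S (Suc n)) S \<Lambda> G M W"
    by (rule isometric_model[of R "S j" "S (Suc n)" I S S', OF sep R S[OF j'] S[OF n] S[OF I] S' SR[OF j'] SR[OF n]
          comm[OF j' n] SR[OF I] S'R SS' S'S comm[OF j' I] comm[OF n I] comm[OF I I] pure])
  then obtain \<Lambda> :: "'a \<Rightarrow> ell2" and G M W where \<Lambda>: "bounded_clinear \<Lambda>"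
      "\<forall>h g. cinner (\<Lambda> h) (\<Lambda> g) = asymptotic_form R h g"
    and M': "lift_model I (S j) (S (Suc n)) S \<Lambda> G M W"
    by (elim exE conjE)
  note M = M'[unfolded lift_model_def]
  define V where "V i = (if i = j then M else W i)" for i
  have VI: "V i = W i" "i \<in> I" if "i \<in> {1..n}" "i \<noteq> j" for i using that by (auto simp: V_def I_def)
  have Vj: "V j = M" by (simp add: V_def)
  have "isometric (V i)" if "i \<in> {1..n}" for i
    using M VI[OF that] Vj by (cases "i = j") auto
  moreover have "V i (V k x) = V k (V i x)" if "i \<in> {1..n}" "k \<in> {1..n}" for i k x
    using M VI[OF that(1)] VI[OF that(2)] Vj by (cases "i = j"; cases "k = j") auto
  moreover have "cadjoint G (V i x) = V i (cadjoint G x)" if "i \<in> {1..n}" for i x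
    using M VI[OF that] Vj by (cases "i = j") auto
  moreover have "cadjoint (V i) (\<Lambda> h) = \<Lambda> (S i h)" if "i \<in> {1..n}" for i h
    using M VI[OF that] Vj by (cases "i = j") auto
  ultimately show ?thesis
    unfolding summand_model_def using M \<Lambda> by (intro exI[of _ \<Lambda>] exI[of _ G] exI[of _ V]) simp
qed

lemma op_monomial_commute:
  assumes "\<And>i x. i \<in> {1..m} \<Longrightarrow> C (V i x) = V i (C x)"
  shows "C (op_monomial m V \<alpha> x) = op_monomial m V \<alpha> (C x)"
  using assms
proof (induction m arbitrary: x)
  case (Suc m)
  have "C ((V (Suc m) ^^ k) y) = (V (Suc m) ^^ k) (C y)" for k y
    by (induction k) (simp_all add: Suc.prems)
  then show ?case using Suc by simp
qed simp

lemma op_monomial_isometric: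
  fixes V :: "nat \<Rightarrow> 'k::complex_hilbert_space \<Rightarrow> 'k"
  assumes "\<And>i. i \<in> {1..m} \<Longrightarrow> isometric (V i)"
  shows "isometric (op_monomial m V \<alpha>)"
  using assms
proof (induction m)
  case 0
  then show ?case by (simp add: isometric_def id_def bounded_clinear_ident)
next
  case (Suc m)
  have comp: "isometric (\<lambda>x. f (g x))" if "isometric f" "isometric g" for f g :: "'k \<Rightarrow> 'k"
    using that by (simp add: isometric_def bounded_clinear_compose)
  have "isometric (V (Suc m) ^^ k)" for k
  proof (induction k)
    case 0
    then show ?case by (simp add: isometric_def id_def bounded_clinear_ident)
  next
    case (Suc k)
    then show ?case using comp[of "V (Suc m)" "V (Suc m) ^^ k"] \<open>\<And>i. i \<in> {1..Suc m} \<Longrightarrow> isometric (V i)\<close>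
      by (simp add: o_def)
  qed
  then show ?case using comp[of "op_monomial m V \<alpha>" "V (Suc m) ^^ \<alpha> (Suc m)"] Suc by (simp add: o_def)
qed

lemma op_monomial_cong:
  "(\<And>i. i \<in> {1..m} \<Longrightarrow> \<alpha> i = \<beta> i) \<Longrightarrow> op_monomial m V \<alpha> x = op_monomial m V \<beta> x"
  by (induction m arbitrary: x) auto

lemma op_monomial_shift:
  assumes comm: "\<And>i k x. i \<in> {1..m} \<Longrightarrow> k \<in> {1..m} \<Longrightarrow> V i (V k x) = V k (V i x)" and i: "i \<in> {1..m}"
  shows "op_monomial m V (\<alpha>(i := Suc (\<alpha> i))) x = V i (op_monomial m V \<alpha> x)"
  using assms
proof (induction m arbitrary: x)
  case (Suc m)
  show ?case
  proof (cases "i = Suc m")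
    case True
    have "op_monomial (Suc m) V (\<alpha>(i := Suc (\<alpha> i))) x
      = op_monomial m V (\<alpha>(i := Suc (\<alpha> i))) (V (Suc m) ((V (Suc m) ^^ \<alpha> (Suc m)) x))" using True by simp
    also have "\<dots> = op_monomial m V \<alpha> (V (Suc m) ((V (Suc m) ^^ \<alpha> (Suc m)) x))"
      by (rule op_monomial_cong) (use True in auto)
    also have "\<dots> = V (Suc m) (op_monomial m V \<alpha> ((V (Suc m) ^^ \<alpha> (Suc m)) x))"
      using Suc.prems by (intro op_monomial_commute[symmetric]) auto
    finally show ?thesis unfolding True op_monomial.simps o_apply .
  next
    case False
    then show ?thesis using Suc by simp
  qed
qed simp

lemma isometric_lift_exists:
  fixes T :: "nat \<Rightarrow> 'a::complex_hilbert_space \<Rightarrow> 'a" and n :: nat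
  assumes separable: "separable_space (euclidean :: 'a topology)"
    and contractions: "commuting_contractions (n + 1) T"
    and B0: "T \<in> class_B0 n"
  shows "\<exists>(J :: 'a \<Rightarrow> ell2) V. isometric_lift (n + 1) T J V"
proof -
  define S where "S i = cadjoint (T i)" for i
  have T: "nonexpansive (T i)" if "i \<in> {1..Suc n}" for i
    using contractions that by (simp add: commuting_contractions_def contraction_iff_nonexpansive)
  have TT: "T i (T j x) = T j (T i x)" if "i \<in> {1..Suc n}" "j \<in> {1..Suc n}" for i j x
    using contractions that unfolding commuting_contractions_def by (auto simp: fun_eq_iff)
  have S: "nonexpansive (S i)" if "i \<in> {1..Suc n}" for i
    unfolding S_def by (rule nonexpansive_adjoint[OF T[OF that]])
  have adj: "cinner (T i x) y = cinner x (S i y)" if "i \<in> {1..Suc n}" for i x y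
    unfolding S_def by (rule cinner_adjoint[OF nonexpansive_bounded_clinear[OF T[OF that]]])
  have comm: "S i (S j x) = S j (S i x)" if "i \<in> {1..Suc n}" "j \<in> {1..Suc n}" for i j x
    unfolding S_def using that
    by (intro commuting_adjoints nonexpansive_bounded_clinear[OF T] TT)
  \<comment> \<open>The defining relation paired with \<open>x\<close>, read as a statement about
    norms lost.\<close>
  have inv: "(norm (S j x))\<^sup>2 - (norm (S i (S j x)))\<^sup>2 = (norm x)\<^sup>2 - (norm (S i x))\<^sup>2"
    if i: "i \<in> {1..n}" and j: "j \<in> {1..n}" and ij: "i \<noteq> j" for i j x
  proof -
    have i': "i \<in> {1..Suc n}" and j': "j \<in> {1..Suc n}" using i j by auto
    have "x - T i (S i x) - T j (S j x) + T i (T j (S i (S j x))) = 0"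
      using B0 i j ij unfolding class_B0_def S_def by blast
    then have "cinner (x - T i (S i x) - T j (S j x) + T i (T j (S i (S j x)))) x = 0" by simp
    then have "cinner x x - cinner (S i x) (S i x) - cinner (S j x) (S j x) + cinner (S i (S j x)) (S i (S j x)) = 0"
      by (simp add: cinner_simps adj[OF i'] adj[OF j'] comm[OF j' i'])
    then have "complex_of_real ((norm x)\<^sup>2 - (norm (S i x))\<^sup>2 - (norm (S j x))\<^sup>2 + (norm (S i (S j x)))\<^sup>2) = 0"
      by (simp add: cinner_self)
    then show ?thesis unfolding of_real_eq_0_iff by linarith
  qed
  \<comment> \<open>The total norm lost under the powers of \<open>S i\<close>; it will turn out to
    be the quadratic form of the i-th summand.\<close>
  define s where "s i h = (norm h)\<^sup>2 - Re (asymptotic_form (S i) h h)" for i h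
  have lim_s: "(\<lambda>N. (norm h)\<^sup>2 - (norm ((S i ^^ N) h))\<^sup>2) \<longlonglongrightarrow> s i h" if "i \<in> {1..Suc n}" for i h
    unfolding s_def by (intro tendsto_intros tendsto_asymptotic_form_norm[OF S[OF that]])
  have lim_foldr: "(\<lambda>N. (norm h)\<^sup>2 - (norm ((foldr S is ^^ N) h))\<^sup>2) \<longlonglongrightarrow> (\<Sum>i\<in>set is. s i h)"
    if "distinct is" "set is \<subseteq> {1..n}" for "is" h
  proof -
    have 1: "(norm h)\<^sup>2 - (norm ((foldr S is ^^ N) h))\<^sup>2 = (\<Sum>i\<in>set is. (norm h)\<^sup>2 - (norm ((S i ^^ N) h))\<^sup>2)" for N
    proof -
      have sub: "i \<in> {1..Suc n}" "i \<in> {1..n}" if "i \<in> set is" for i using that \<open>set is \<subseteq> {1..n}\<close> by fastforce+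
      have "(foldr S is ^^ N) h = foldr (\<lambda>i. S i ^^ N) is h"
        by (rule funpow_foldr) (use sub comm in blast)
      then show ?thesis
        using norm_foldr_powers[of "is" S h N, OF \<open>distinct is\<close>] comm[OF sub(1) sub(1)] inv[OF sub(2) sub(2)]
        by simp
    qed
    show ?thesis
      unfolding 1 using \<open>set is \<subseteq> {1..n}\<close> by (intro tendsto_sum lim_s) auto
  qed
  define R where "R j = foldr S (remove1 j [1..<Suc n])" for j
  have sub_R: "set (remove1 j [1..<Suc n]) \<subseteq> {1..n}" for j
    using set_remove1_subset[of j "[1..<Suc n]"] by auto
  have R: "nonexpansive (R j)" for j
    unfolding R_def using S sub_R[of j] by (intro nonexpansive_foldr) fastforce
  \<comment> \<open>Purity of the product means that its powers lose the whole norm, and the loss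
    splits into the \<open>s i\<close>.\<close>
  have total: "(\<Sum>i\<in>{1..n}. s i h) = (norm h)\<^sup>2" for h
  proof -
    define P where "P = foldr S (rev [1..<Suc n])"
    have "cadjoint (op_monomial n T (\<lambda>_. 1)) = P"
    proof (rule cadjoint_eqI)
      fix x y
      have "cinner (op_monomial n T (\<lambda>_. 1) x) y = cinner x (foldr (\<lambda>i. S i ^^ 1) (rev [1..<Suc n]) y)"
        by (rule cinner_op_monomial) (rule adj, simp)
      then show "cinner (op_monomial n T (\<lambda>_. 1) x) y = cinner x (P y)" by (simp add: P_def)
    qed
    then have "(\<lambda>k. (P ^^ k) h) \<longlonglongrightarrow> 0"
      using B0 unfolding class_B0_def pure_contraction_def by auto
    then have "(\<lambda>N. (norm h)\<^sup>2 - (norm ((P ^^ N) h))\<^sup>2) \<longlonglongrightarrow> (norm h)\<^sup>2 - (norm (0 :: 'a))\<^sup>2"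
      by (intro tendsto_intros)
    moreover have set: "set (rev [1..<Suc n]) = {1..n}" by auto
    have "distinct (rev [1..<Suc n])" by (simp only: distinct_rev distinct_upt)
    from lim_foldr[OF this, of h] have "(\<lambda>N. (norm h)\<^sup>2 - (norm ((P ^^ N) h))\<^sup>2) \<longlonglongrightarrow> (\<Sum>i\<in>{1..n}. s i h)"
      unfolding set P_def by blast
    ultimately show ?thesis using LIMSEQ_unique by fastforce
  qed
  \<comment> \<open>The product without the factor \<open>j\<close> loses every \<open>s i\<close>
    except \<open>s j\<close>; compared with \<open>total\<close>, what it retains is
    \<open>s j\<close>.\<close>
  have form_R: "Re (asymptotic_form (R j) h h) = s j h" if j: "j \<in> {1..n}" for j h
  proof -
    have "(\<lambda>N. (norm h)\<^sup>2 - (norm ((R j ^^ N) h))\<^sup>2) \<longlonglongrightarrow> (norm h)\<^sup>2 - Re (asymptotic_form (R j) h h)"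
      by (intro tendsto_intros tendsto_asymptotic_form_norm R)
    moreover have "(\<lambda>N. (norm h)\<^sup>2 - (norm ((R j ^^ N) h))\<^sup>2) \<longlonglongrightarrow> (\<Sum>i\<in>{1..n} - {j}. s i h)"
    proof -
      have set: "set (remove1 j [1..<Suc n]) = {1..n} - {j}" by auto
      have "distinct (remove1 j [1..<Suc n])" by (intro distinct_remove1 distinct_upt)
      from lim_foldr[OF this sub_R, of h] show ?thesis unfolding set R_def .
    qed
    ultimately have "(norm h)\<^sup>2 - Re (asymptotic_form (R j) h h) = (\<Sum>i\<in>{1..n} - {j}. s i h)"
      by (rule LIMSEQ_unique)
    also have "\<dots> = (\<Sum>i\<in>{1..n}. s i h) - s j h" using j by (simp add: sum_diff1)
    finally show ?thesis unfolding total by linarith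
  qed
  \<comment> \<open>The form at the k-th iterate is its squared norm minus the asymptotic norm of
    \<open>S j\<close>. The latter is constant along the orbit and is the limit of the
    former.\<close>
  have pure: "(\<lambda>k. Re (asymptotic_form (R j) ((S j ^^ k) h) ((S j ^^ k) h))) \<longlonglongrightarrow> 0" if j: "j \<in> {1..n}" for j h
  proof -
    have j': "j \<in> {1..Suc n}" using j by auto
    define q where "q = asymptotic_form (S j) h h"
    have "asymptotic_form (S j) ((S j ^^ k) h) ((S j ^^ k) h) = q" for k
      unfolding q_def by (induction k) (simp_all add: asymptotic_form_shift[OF S[OF j']])
    then have "Re (asymptotic_form (R j) ((S j ^^ k) h) ((S j ^^ k) h)) = (norm ((S j ^^ k) h))\<^sup>2 - Re q" for k
      by (simp add: form_R[OF j] s_def)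
    moreover have "(\<lambda>k. (norm ((S j ^^ k) h))\<^sup>2 - Re q) \<longlonglongrightarrow> Re q - Re q"
      unfolding q_def by (intro tendsto_intros tendsto_asymptotic_form_norm S j')
    ultimately show ?thesis by simp
  qed
  have "\<forall>j\<in>{1..n}. \<exists>(\<Lambda> :: 'a \<Rightarrow> ell2) G V. summand_model n S (R j) \<Lambda> G V"
    using isometric_summand[OF separable S comm _ R_def pure] by blast
  then obtain \<Lambda> :: "nat \<Rightarrow> 'a \<Rightarrow> ell2" and G V
    where summand: "\<forall>j\<in>{1..n}. summand_model n S (R j) (\<Lambda> j) (G j) (V j)"
    by (simp only: bchoice_iff) (elim exE)
  have \<Lambda>: "bounded_clinear (\<Lambda> j)" and \<Lambda>\<Lambda>: "\<And>h g. cinner (\<Lambda> j h) (\<Lambda> j g) = asymptotic_form (R j) h g"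
    and G: "nonexpansive (G j)" and V: "\<And>i. i \<in> {1..n} \<Longrightarrow> isometric (V j i)"
    and VV: "\<And>i k x. i \<in> {1..n} \<Longrightarrow> k \<in> {1..n} \<Longrightarrow> V j i (V j k x) = V j k (V j i x)"
    and YV: "\<And>i x. i \<in> {1..n} \<Longrightarrow> cadjoint (G j) (V j i x) = V j i (cadjoint (G j) x)"
    and V\<Lambda>: "\<And>i h. i \<in> {1..n} \<Longrightarrow> cadjoint (V j i) (\<Lambda> j h) = \<Lambda> j (S i h)"
    and G\<Lambda>: "\<And>h. G j (\<Lambda> j h) = \<Lambda> j (S (Suc n) h)" if "j \<in> {1..n}" for j
    using bspec[OF summand that] unfolding summand_model_def by blast+
  \<comment> \<open>The maps \<open>\<Lambda> j\<close> are combined into one isometry into the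
    direct sum, and polarization turns the norm identity \<open>total\<close> into the identity for
    inner products.\<close>
  have sum_\<Lambda>: "(\<Sum>j\<in>{1..n}. cinner (\<Lambda> j h) (\<Lambda> j g)) = cinner h g" for h g
  proof -
    define Z where "Z h = (\<Sum>j\<in>{1..n}. block j (\<Lambda> j h))" for h
    have "(norm (Z h))\<^sup>2 = (norm h)\<^sup>2" for h
    proof -
      have "(norm (Z h))\<^sup>2 = (\<Sum>j\<in>{1..n}. (norm (\<Lambda> j h))\<^sup>2)" unfolding Z_def by (rule norm_block_sum)
      also have "\<dots> = (\<Sum>j\<in>{1..n}. s j h)"
      proof (rule sum.cong[OF refl])
        fix j assume j: "j \<in> {1..n}"
        have "(norm (\<Lambda> j h))\<^sup>2 = Re (cinner (\<Lambda> j h) (\<Lambda> j h))" by (simp add: cinner_self)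
        then show "(norm (\<Lambda> j h))\<^sup>2 = s j h" by (simp only: \<Lambda>\<Lambda>[OF j] form_R[OF j])
      qed
      finally show ?thesis by (simp only: total)
    qed
    then have norm_Z: "norm (Z h) = norm h" for h by simp
    have "bounded_clinear Z"
    proof (rule bounded_clinearI[where B = 1])
      show "Z (x + y) = Z x + Z y" for x y
        by (simp add: Z_def bounded_clinearD(1)[OF \<Lambda>] blockD sum.distrib)
      show "Z (c *\<^sub>C x) = c *\<^sub>C Z x" for c x
        by (simp add: Z_def bounded_clinearD(2)[OF \<Lambda>] blockD linear_sum[OF bounded_linear.linear[OF bounded_linear_scaleC]])
    qed (simp add: norm_Z)
    then have "cinner (Z h) (Z g) = cinner h g" using norm_Z
      by (intro isometric_cinner) (simp add: isometric_def)
    moreover have "cinner (Z h) (Z g) = (\<Sum>j\<in>{1..n}. cinner (\<Lambda> j h) (\<Lambda> j g))"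
      unfolding Z_def cinner_sum_left cinner_block_left component_sum
      by (intro sum.cong refl) (simp add: component_block)
    ultimately show ?thesis by simp
  qed
  define Y where "Y j = cadjoint (G j)" for j
  have Y: "nonexpansive (Y j)" if "j \<in> {1..n}" for j unfolding Y_def
    by (rule nonexpansive_adjoint[OF G[OF that]])
  define f where "f j = (\<lambda>(\<alpha>, h). (\<alpha> (Suc n) :: nat, op_monomial n (V j) \<alpha> (\<Lambda> j h)))" for j
  \<comment> \<open>The Gram kernel in the direct sum of the n Schaeffer dilations: in the j-th one
    the \<open>Suc n\<close>-th exponent counts the powers of the dilation of \<open>Y j\<close>,
    the others those of the \<open>V j i\<close>.\<close>
  define \<kappa> where "\<kappa> x y = (\<Sum>j\<in>{1..n}. power_kernel (Y j) (f j x) (f j y))" for x y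
  have VY: "(Y j ^^ k) (V j i x) = V j i ((Y j ^^ k) x)" if "j \<in> {1..n}" "i \<in> {1..n}" for j i k x
    by (induction k) (simp_all add: YV[OF that, folded Y_def])
  have "\<exists>(J :: 'a \<Rightarrow> ell2) V. isometric_lift (Suc n) T J V"
  proof (rule isometric_lift_from_kernel[OF separable])
    show "psd_kernel \<kappa>"
      unfolding \<kappa>_def
      by (rule psd_kernel_sum, rule psd_kernel_compose[OF psd_power_kernel[OF Y]])
  next
    fix i \<alpha> \<beta> h g assume i: "i \<in> {1..Suc n}"
    have "power_kernel (Y j) (f j (\<alpha>(i := Suc (\<alpha> i)), h)) (f j (\<beta>(i := Suc (\<beta> i)), g)) = power_kernel (Y j) (f j (\<alpha>, h)) (f j (\<beta>, g))"
      if j: "j \<in> {1..n}" for j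
    proof (cases "i = Suc n")
      \<comment> \<open>Raising both last exponents leaves the truncated differences in
        \<open>power_kernel\<close> unchanged.\<close>
      case True
      have "op_monomial n (V j) (\<gamma>(Suc n := c)) x = op_monomial n (V j) \<gamma> x" for \<gamma> c x
        by (rule op_monomial_cong) auto
      then show ?thesis by (simp add: f_def True power_kernel_def)
    next
      case False
      then have i': "i \<in> {1..n}" using i by auto
      have "op_monomial n (V j) (\<gamma>(i := Suc (\<gamma> i))) x = V j i (op_monomial n (V j) \<gamma> x)" for \<gamma> x
        by (rule op_monomial_shift[of n "V j", OF VV[OF j] i'])
      then show ?thesis using False
        by (simp add: f_def power_kernel_def VY[OF j i'] isometric_cinner[OF V[OF j i']])
    qed
    then show "\<kappa> (\<alpha>(i := Suc (\<alpha> i)), h) (\<beta>(i := Suc (\<beta> i)), g) = \<kappa> (\<alpha>, h) (\<beta>, g)"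
      unfolding \<kappa>_def by (intro sum.cong refl)
  next
    fix \<alpha> \<alpha>' :: "nat \<Rightarrow> nat" and h :: 'a and y assume eq: "\<And>i. i \<in> {1..Suc n} \<Longrightarrow> \<alpha> i = \<alpha>' i"
    have "f j (\<alpha>, h) = f j (\<alpha>', h)" for j
      using op_monomial_cong[of n \<alpha> \<alpha>'] eq by (simp add: f_def)
    then show "\<kappa> (\<alpha>, h) y = \<kappa> (\<alpha>', h) y" by (simp add: \<kappa>_def)
  next
    fix \<alpha> h g
    have "power_kernel (Y j) (f j (\<alpha>, h)) (f j (\<alpha>, g)) = cinner (\<Lambda> j h) (\<Lambda> j g)" if j: "j \<in> {1..n}" for j
    proof -
      have "isometric (op_monomial n (V j) \<alpha>)" by (rule op_monomial_isometric) (rule V[OF j])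
      then show ?thesis by (simp add: f_def power_kernel_def isometric_cinner)
    qed
    then show "\<kappa> (\<alpha>, h) (\<alpha>, g) = cinner h g"
      unfolding \<kappa>_def sum_\<Lambda>[symmetric] by (intro sum.cong refl)
  next
    fix \<alpha> h g
    define k where "k = (S (Suc n) ^^ \<alpha> (Suc n)) g"
    define P where "P = foldr (\<lambda>i. S i ^^ \<alpha> i) (rev [1..<Suc n])"
    have n1: "Suc n \<in> {1..Suc n}" by simp
    \<comment> \<open>Against exponent zero all operators move to the right-hand entry. There
      \<open>G j\<close> and the adjoints of the \<open>V j i\<close> act on the range of
      \<open>\<Lambda> j\<close> as the corresponding \<open>S\<close> operators.\<close>
    have "power_kernel (Y j) (f j (\<alpha>, h)) (f j (\<lambda>_. 0, g)) = cinner (\<Lambda> j h) (\<Lambda> j (P k))"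
      if j: "j \<in> {1..n}" for j
    proof -
      have zero: "op_monomial l (V j) (\<lambda>_. 0) x = x" for l x by (induction l arbitrary: x) auto
      have Gk: "(G j ^^ l) (\<Lambda> j x) = \<Lambda> j ((S (Suc n) ^^ l) x)" for l x
        by (induction l) (simp_all add: G\<Lambda>[OF j])
      have Yk: "cinner ((Y j ^^ l) x) y = cinner x ((G j ^^ l) y)" for l x y
        by (induction l arbitrary: x y)
          (simp_all add: Y_def cinner_adjoint'[OF nonexpansive_bounded_clinear[OF G[OF j]]] funpow_swap1)
      have V\<Lambda>k: "(cadjoint (V j i) ^^ l) (\<Lambda> j x) = \<Lambda> j ((S i ^^ l) x)" if "i \<in> {1..n}" for i l x
        by (induction l) (simp_all add: V\<Lambda>[OF j that])
      have fold: "foldr (\<lambda>i. cadjoint (V j i) ^^ \<alpha> i) is (\<Lambda> j x) = \<Lambda> j (foldr (\<lambda>i. S i ^^ \<alpha> i) is x)"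
        if "set is \<subseteq> {1..n}" for "is" x
        using that by (induction "is") (simp_all add: V\<Lambda>k)
      have "power_kernel (Y j) (f j (\<alpha>, h)) (f j (\<lambda>_. 0, g)) = cinner (op_monomial n (V j) \<alpha> (\<Lambda> j h)) (\<Lambda> j k)"
        by (simp add: f_def power_kernel_def zero Yk Gk k_def)
      also have "\<dots> = cinner (\<Lambda> j h) (foldr (\<lambda>i. cadjoint (V j i) ^^ \<alpha> i) (rev [1..<Suc n]) (\<Lambda> j k))"
        by (rule cinner_op_monomial) (rule cinner_adjoint[OF isometricD(1)[OF V[OF j]]])
      also have "\<dots> = cinner (\<Lambda> j h) (\<Lambda> j (P k))"
        unfolding P_def by (subst fold) auto
      finally show ?thesis .
    qed
    then have "\<kappa> (\<alpha>, h) (\<lambda>_. 0, g) = cinner h (P k)"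
      unfolding \<kappa>_def sum_\<Lambda>[of h "P k", symmetric] by (intro sum.cong refl)
    also have "P k = foldr (\<lambda>i. S i ^^ \<alpha> i) (rev [1..<Suc (Suc n)]) g"
    proof -
      have 1: "S i ((S (Suc n) ^^ l) x) = (S (Suc n) ^^ l) (S i x)" if "i \<in> {1..Suc n}" for i l x
        by (induction l) (simp_all add: comm[OF that n1])
      have "(S (Suc n) ^^ \<alpha> (Suc n)) ((S i ^^ l) x) = (S i ^^ l) ((S (Suc n) ^^ \<alpha> (Suc n)) x)"
        if "i \<in> {1..Suc n}" for i l x
        by (induction l) (simp_all add: 1[OF that, symmetric])
      then have "(S (Suc n) ^^ \<alpha> (Suc n)) (P g) = P k"
        unfolding P_def k_def by (intro foldr_commute) auto
      then show ?thesis by (simp add: P_def)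
    qed
    also have "cinner h (foldr (\<lambda>i. S i ^^ \<alpha> i) (rev [1..<Suc (Suc n)]) g) = cinner (op_monomial (Suc n) T \<alpha> h) g"
      by (rule cinner_op_monomial[symmetric]) (rule adj)
    finally show "\<kappa> (\<alpha>, h) (\<lambda>_. 0, g) = cinner (op_monomial (Suc n) T \<alpha> h) g" .
  qed
  then show ?thesis by simp
qed

section \<open>The von Neumann inequality for commuting isometries\<close>

lemma op_monomial_add:
  assumes "\<And>i k x. i \<in> {1..m} \<Longrightarrow> k \<in> {1..m} \<Longrightarrow> V i (V k x) = V k (V i x)"
  shows "op_monomial m V (\<lambda>i. \<alpha> i + \<beta> i) x = op_monomial m V \<alpha> (op_monomial m V \<beta> x)"
  using assms
proof (induction m arbitrary: x)
  case (Suc m)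
  have pow: "(V (Suc m) ^^ k) (V i x) = V i ((V (Suc m) ^^ k) x)" if "i \<in> {1..m}" for i k x
    by (induction k) (use that Suc.prems in simp_all)
  have "(V (Suc m) ^^ k) (op_monomial m V \<beta> x) = op_monomial m V \<beta> ((V (Suc m) ^^ k) x)" for k x
    by (rule op_monomial_commute) (rule pow)
  then show ?case using Suc by (simp add: funpow_add)
qed simp

lemma scaleC_sum_left: "(\<Sum>i\<in>A. f i) *\<^sub>C (x::'a::complex_hilbert_space) = (\<Sum>i\<in>A. f i *\<^sub>C x)"
  by (induction A rule: infinite_finite_induct) (auto simp: scaleC_add_left)

section \<open>Averaging over roots of unity\<close>

definition root_of_unity_point :: "nat \<Rightarrow> nat \<Rightarrow> (nat \<Rightarrow> nat) \<Rightarrow> nat \<Rightarrow> complex"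
  where "root_of_unity_point m L k = restrict (\<lambda>i. cis (2 * pi * k i / L)) {1..m}"

definition power_at :: "nat \<Rightarrow> (nat \<Rightarrow> complex) \<Rightarrow> (nat \<Rightarrow> nat) \<Rightarrow> complex"
  where "power_at m z \<alpha> = (\<Prod>i\<in>{1..m}. z i ^ \<alpha> i)"

lemma sum_roots_of_unity:
  fixes a b L :: nat
  assumes "a < L" "b < L"
  shows "(\<Sum>k<L. cis (2 * pi * k / L) ^ a * cnj (cis (2 * pi * k / L) ^ b)) = (if a = b then of_nat L else 0)"
proof -
  define w where "w = cis (2 * pi * (real a - real b) / L)"
  have L: "L > 0" using assms by simp
  have summand: "cis (2 * pi * k / L) ^ a * cnj (cis (2 * pi * k / L) ^ b) = w ^ k" for k :: nat
  proof -
    have "cis (2 * pi * k / L) ^ a * cnj (cis (2 * pi * k / L) ^ b)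
      = cis (real a * (2 * pi * k / L)) * cis (- (real b * (2 * pi * k / L)))"
      by (simp only: complex_cnj_power cis_cnj Complex.DeMoivre mult_minus_right)
    also have "\<dots> = cis (real k * (2 * pi * (real a - real b) / L))"
      by (simp add: cis_mult algebra_simps diff_divide_distrib)
    finally show ?thesis by (simp add: w_def Complex.DeMoivre)
  qed
  show ?thesis
  proof (cases "a = b")
    case True
    then show ?thesis unfolding summand by (simp add: w_def)
  next
    case False
    have "w ^ L = cis (2 * pi * of_int (int a - int b))"
      using L by (simp add: w_def Complex.DeMoivre)
    then have "w ^ L = 1" by (simp only: cis_multiple_2pi Ints_of_int)
    have "w \<noteq> 1"
    proof
      assume "w = 1"
      then have "\<exists>n::int. 2 * pi * (real a - real b) / L = of_int n * (2 * pi)"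
        unfolding w_def by (simp add: complex_eq_iff) (metis cos_one_2pi_int mult.commute mult.left_commute)
      then obtain n :: int where "2 * pi * (real a - real b) / L = of_int n * (2 * pi)" by blast
      then have "2 * pi * (real a - real b) = 2 * pi * (of_int n * real L)" using L by (simp add: field_simps)
      then have "real a - real b = of_int n * real L" by (rule mult_left_cancel[THEN iffD1, rotated]) simp
      then have "of_int (int a - int b) = (of_int (n * int L) :: real)" by simp
      then have eq: "int a - int b = n * int L" by (simp only: of_int_eq_iff)
      have "\<bar>int a - int b\<bar> < int L" using assms by auto
      then have "\<bar>n\<bar> * int L < 1 * int L" by (simp add: eq abs_mult)
      then have "n = 0" using L by (simp only: mult_less_cancel_right) auto
      with eq False show False by simp
    qed
    then show ?thesis using False geometric_sum[of w L] \<open>w ^ L = 1\<close> unfolding summand by simp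
  qed
qed

text \<open>Orthogonality of the characters of the m-fold product of the cyclic group of order
  \<open>L\<close>. Exponents below \<open>L\<close> are distinct modulo \<open>L\<close>, so
  nothing is aliased.\<close>

lemma parseval_roots_of_unity:
  fixes c :: "(nat \<Rightarrow> nat) \<Rightarrow> 'k::complex_hilbert_space"
  assumes \<Gamma>: "\<Gamma> \<subseteq> PiE {1..m} (\<lambda>_. {..<L})"
  shows "(\<Sum>k\<in>PiE {1..m} (\<lambda>_. {..<L}). (norm (\<Sum>\<gamma>\<in>\<Gamma>. power_at m (root_of_unity_point m L k) \<gamma> *\<^sub>C c \<gamma>))\<^sup>2)
    = real L ^ m * (\<Sum>\<gamma>\<in>\<Gamma>. (norm (c \<gamma>))\<^sup>2)"
proof -
  define X where "X = PiE {1..m} (\<lambda>_. {..<L})"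
  define \<xi> where "\<xi> k \<gamma> = power_at m (root_of_unity_point m L k) \<gamma>" for k \<gamma>
  have fin: "finite \<Gamma>" by (rule finite_subset[OF \<Gamma>]) (simp add: finite_PiE)
  have orth: "(\<Sum>k\<in>X. \<xi> k \<gamma> * cnj (\<xi> k \<delta>)) = (if \<gamma> = \<delta> then of_nat L ^ m else 0)"
    if \<gamma>: "\<gamma> \<in> \<Gamma>" and \<delta>: "\<delta> \<in> \<Gamma>" for \<gamma> \<delta>
  proof -
    have "(\<Sum>k\<in>X. \<xi> k \<gamma> * cnj (\<xi> k \<delta>))
      = (\<Sum>k\<in>X. \<Prod>i\<in>{1..m}. cis (2 * pi * k i / L) ^ \<gamma> i * cnj (cis (2 * pi * k i / L) ^ \<delta> i))"
      by (simp add: \<xi>_def power_at_def root_of_unity_point_def prod.distrib)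
    also have "\<dots> = (\<Prod>i\<in>{1..m}. \<Sum>k<L. cis (2 * pi * k / L) ^ \<gamma> i * cnj (cis (2 * pi * k / L) ^ \<delta> i))"
      unfolding X_def by (rule prod_sum_PiE[symmetric]) auto
    also have "\<dots> = (\<Prod>i\<in>{1..m}. if \<gamma> i = \<delta> i then of_nat L else 0)"
      using \<gamma> \<delta> \<Gamma> by (intro prod.cong refl sum_roots_of_unity) (auto simp: PiE_iff)
    also have "\<dots> = (if \<gamma> = \<delta> then of_nat L ^ m else 0)"
    proof (cases "\<gamma> = \<delta>")
      case False
      have "\<gamma> \<in> PiE {1..m} (\<lambda>_. {..<L})" "\<delta> \<in> PiE {1..m} (\<lambda>_. {..<L})" using \<gamma> \<delta> \<Gamma> by auto
      from PiE_ext[OF this] False obtain i where "i \<in> {1..m}" "\<gamma> i \<noteq> \<delta> i" by blast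
      then show ?thesis using False by (auto intro!: prod_zero)
    qed simp
    finally show ?thesis .
  qed
  have "complex_of_real (\<Sum>k\<in>X. (norm (\<Sum>\<gamma>\<in>\<Gamma>. \<xi> k \<gamma> *\<^sub>C c \<gamma>))\<^sup>2)
    = (\<Sum>k\<in>X. \<Sum>\<gamma>\<in>\<Gamma>. \<Sum>\<delta>\<in>\<Gamma>. (\<xi> k \<gamma> * cnj (\<xi> k \<delta>)) * cinner (c \<gamma>) (c \<delta>))"
    unfolding of_real_sum cinner_self[symmetric] cinner_sum_left
    unfolding cinner_sum_right cinner_scaleC_left cinner_scaleC_right by (simp add: mult_ac)
  also have "\<dots> = (\<Sum>\<gamma>\<in>\<Gamma>. \<Sum>\<delta>\<in>\<Gamma>. (\<Sum>k\<in>X. \<xi> k \<gamma> * cnj (\<xi> k \<delta>)) * cinner (c \<gamma>) (c \<delta>))"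
    unfolding sum_distrib_right
    by (subst sum.swap) (intro sum.cong refl sum.swap)
  also have "\<dots> = (\<Sum>\<gamma>\<in>\<Gamma>. of_nat L ^ m * cinner (c \<gamma>) (c \<gamma>))"
  proof (rule sum.cong[OF refl])
    fix \<gamma> assume \<gamma>: "\<gamma> \<in> \<Gamma>"
    have "(\<Sum>\<delta>\<in>\<Gamma>. (\<Sum>k\<in>X. \<xi> k \<gamma> * cnj (\<xi> k \<delta>)) * cinner (c \<gamma>) (c \<delta>))
      = (\<Sum>\<delta>\<in>\<Gamma>. if \<gamma> = \<delta> then of_nat L ^ m * cinner (c \<gamma>) (c \<gamma>) else 0)"
      by (intro sum.cong refl) (simp add: orth[OF \<gamma>])
    then show "(\<Sum>\<delta>\<in>\<Gamma>. (\<Sum>k\<in>X. \<xi> k \<gamma> * cnj (\<xi> k \<delta>)) * cinner (c \<gamma>) (c \<delta>)) = of_nat L ^ m * cinner (c \<gamma>) (c \<gamma>)"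
      using fin \<gamma> by simp
  qed
  also have "\<dots> = complex_of_real (real L ^ m * (\<Sum>\<gamma>\<in>\<Gamma>. (norm (c \<gamma>))\<^sup>2))"
    by (simp add: cinner_self sum_distrib_left)
  finally show ?thesis unfolding \<xi>_def X_def of_real_eq_iff .
qed

text \<open>A Folner-type averaging that needs no unitary extension. A polynomial \<open>g\<close>
  with vector coefficients carries \<open>V^\<alpha> x\<close> at the reversed exponent
  \<open>N - \<alpha>\<close>, so a central coefficient of the product of \<open>p\<close> with
  \<open>g\<close> gathers all terms of \<open>p(V) x\<close> under one isometric monomial. By
  Parseval, the \<open>(N + 1 - d)^m\<close> central coefficients are bounded by \<open>M^2\<close>
  times the energy of the \<open>(N + 1)^m\<close> coefficients of \<open>g\<close>. The ratio of
  these counts tends to \<open>1\<close>.\<close>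

lemma von_neumann_isometries:
  fixes V :: "nat \<Rightarrow> 'k::complex_hilbert_space \<Rightarrow> 'k"
  assumes V: "\<And>i. i \<in> {1..m} \<Longrightarrow> isometric (V i)"
    and comm: "\<And>i j x. i \<in> {1..m} \<Longrightarrow> j \<in> {1..m} \<Longrightarrow> V i (V j x) = V j (V i x)"
    and M: "\<And>z. z \<in> closed_polydisc m \<Longrightarrow> cmod (poly_eval m p z) \<le> M"
  shows "norm (poly_op m p V x) \<le> M * norm x"
proof -
  define ks where "ks = Poly_Mapping.keys p"
  define a where "a = Poly_Mapping.lookup p"
  define e where "e = (Poly_Mapping.lookup :: (nat \<Rightarrow>\<^sub>0 nat) \<Rightarrow> nat \<Rightarrow> nat)"
  have fin_ks: "finite ks" by (simp add: ks_def)
  define y where "y = poly_op m p V x"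
  have y: "y = (\<Sum>\<beta>\<in>ks. a \<beta> *\<^sub>C op_monomial m V (e \<beta>) x)" by (simp add: y_def poly_op_def ks_def a_def e_def)
  define d where "d = (\<Sum>\<beta>\<in>ks. \<Sum>i\<in>{1..m}. e \<beta> i)"
  have d: "e \<beta> i \<le> d" if "\<beta> \<in> ks" "i \<in> {1..m}" for \<beta> i
  proof -
    have "e \<beta> i \<le> (\<Sum>i\<in>{1..m}. e \<beta> i)" using that(2) by (intro member_le_sum) auto
    also have "\<dots> \<le> d" unfolding d_def using that(1) fin_ks by (intro member_le_sum[of \<beta>]) auto
    finally show ?thesis .
  qed
  have mono: "isometric (op_monomial m V \<alpha>)" for \<alpha> by (rule op_monomial_isometric) (rule V)
  have add: "op_monomial m V (\<lambda>i. \<alpha> i + \<beta> i) u = op_monomial m V \<alpha> (op_monomial m V \<beta> u)" for \<alpha> \<beta> u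
    by (rule op_monomial_add) (rule comm)
  have main: "real (N + 1 - d) ^ m * (norm y)\<^sup>2 \<le> M\<^sup>2 * (real (N + 1) ^ m * (norm x)\<^sup>2)" if "N \<ge> d" for N
  proof -
    \<comment> \<open>The product of \<open>p\<close> and \<open>g\<close> has exponents up to
      \<open>N + d\<close>, all below \<open>L\<close>.\<close>
    define L where "L = N + d + 1"
    define X where "X = PiE {1..m} (\<lambda>_. {..<L})"
    define z where "z k = root_of_unity_point m L k" for k
    define \<xi> where "\<xi> k \<gamma> = power_at m (z k) \<gamma>" for k \<gamma>
    define Bx where "Bx = PiE {1..m} (\<lambda>_. {..N})"
    txt \<open>The coefficient of \<open>p * g\<close> at every exponent \<open>\<gamma>\<close> in \<open>[d, N]\<^sup>m\<close> is an isometric image of \<open>p(V) x\<close>.\<close>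
    define g where "g k = (\<Sum>\<alpha>\<in>Bx. \<xi> k (restrict (\<lambda>i. N - \<alpha> i) {1..m}) *\<^sub>C op_monomial m V \<alpha> x)" for k
    define flip where "flip \<alpha> = restrict (\<lambda>i. N - \<alpha> i) {1..m}" for \<alpha> :: "nat \<Rightarrow> nat"
    define \<phi> where "\<phi> = (\<lambda>(\<beta>, \<alpha>). restrict (\<lambda>i. e \<beta> i + (N - \<alpha> i)) {1..m})"
    define c where "c \<gamma> = (\<Sum>q | q \<in> ks \<times> Bx \<and> \<phi> q = \<gamma>. a (fst q) *\<^sub>C op_monomial m V (snd q) x)" for \<gamma>
    have fin_B: "finite Bx" unfolding Bx_def by (intro finite_PiE) auto
    have fin_X: "finite X" unfolding X_def by (intro finite_PiE) auto
    have z_mem: "z k \<in> closed_polydisc m" for k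
      by (auto simp: z_def root_of_unity_point_def closed_polydisc_def)
    have flip_B: "flip \<alpha> \<in> Bx" if "\<alpha> \<in> Bx" for \<alpha> by (auto simp: flip_def Bx_def)
    have flip_flip: "flip (flip \<alpha>) = \<alpha>" if "\<alpha> \<in> Bx" for \<alpha>
    proof (rule PiE_ext[of _ "{1..m}" "\<lambda>_. {..N}"])
      show "flip (flip \<alpha>) i = \<alpha> i" if "i \<in> {1..m}" for i
        using \<open>\<alpha> \<in> Bx\<close> that by (auto simp: flip_def Bx_def PiE_iff)
    qed (use that flip_B[OF flip_B[OF that]] in \<open>auto simp: Bx_def\<close>)
    have B_X: "Bx \<subseteq> X" unfolding Bx_def X_def L_def by (intro PiE_mono) auto
    have g_flip: "g k = (\<Sum>\<gamma>\<in>Bx. \<xi> k \<gamma> *\<^sub>C op_monomial m V (flip \<gamma>) x)" for k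
      unfolding g_def flip_def[symmetric]
      by (rule sum.reindex_bij_witness[of _ flip flip]) (simp_all add: flip_B flip_flip)
    have card_B: "card Bx = (N + 1) ^ m" unfolding Bx_def by (simp add: card_PiE)
    have sum_g: "(\<Sum>k\<in>X. (norm (g k))\<^sup>2) = real L ^ m * (real (N + 1) ^ m * (norm x)\<^sup>2)"
      unfolding g_flip X_def \<xi>_def z_def
      using parseval_roots_of_unity[of Bx m L "\<lambda>\<gamma>. op_monomial m V (flip \<gamma>) x"] B_X
      by (simp add: X_def isometricD(2)[OF mono] card_B)
    have \<xi>_mult: "power_at m (z k) (e \<beta>) * \<xi> k (restrict (\<lambda>i. N - \<alpha> i) {1..m}) = \<xi> k (\<phi> (\<beta>, \<alpha>))" for k \<beta> \<alpha>
      by (simp add: \<xi>_def \<phi>_def power_at_def power_add flip: prod.distrib)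
    have \<phi>_X: "\<phi> q \<in> X" if "q \<in> ks \<times> Bx" for q
    proof -
      obtain \<beta> \<alpha> where q: "q = (\<beta>, \<alpha>)" "\<beta> \<in> ks" using \<open>q \<in> ks \<times> Bx\<close> by auto
      have "e \<beta> i + (N - \<alpha> i) < L" if "i \<in> {1..m}" for i using d[OF q(2) that] unfolding L_def by simp
      then show ?thesis by (auto simp: q \<phi>_def X_def)
    qed
    have pg: "poly_eval m p (z k) *\<^sub>C g k = (\<Sum>\<gamma>\<in>X. \<xi> k \<gamma> *\<^sub>C c \<gamma>)" for k
    proof -
      have "poly_eval m p (z k) *\<^sub>C g k
        = (\<Sum>\<beta>\<in>ks. \<Sum>\<alpha>\<in>Bx. (a \<beta> * power_at m (z k) (e \<beta>) * \<xi> k (restrict (\<lambda>i. N - \<alpha> i) {1..m})) *\<^sub>C op_monomial m V \<alpha> x)"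
      proof -
        have "poly_eval m p (z k) = (\<Sum>\<beta>\<in>ks. a \<beta> * power_at m (z k) (e \<beta>))"
          by (simp add: poly_eval_def power_at_def ks_def a_def e_def)
        then have "poly_eval m p (z k) *\<^sub>C g k = (\<Sum>\<beta>\<in>ks. (a \<beta> * power_at m (z k) (e \<beta>)) *\<^sub>C g k)"
          by (simp only: scaleC_sum_left)
        then show ?thesis
          unfolding g_def linear_sum[OF bounded_linear.linear[OF bounded_linear_scaleC]] scaleC_scaleC .
      qed
      also have "\<dots> = (\<Sum>q\<in>ks \<times> Bx. \<xi> k (\<phi> q) *\<^sub>C a (fst q) *\<^sub>C op_monomial m V (snd q) x)"
        unfolding sum.cartesian_product
        by (intro sum.cong refl) (auto simp: scaleC_scaleC mult_ac simp flip: \<xi>_mult)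
      also have "\<dots> = (\<Sum>\<gamma>\<in>X. \<Sum>q | q \<in> ks \<times> Bx \<and> \<phi> q = \<gamma>. \<xi> k (\<phi> q) *\<^sub>C a (fst q) *\<^sub>C op_monomial m V (snd q) x)"
        by (rule sum.group[symmetric]) (use fin_ks fin_B fin_X \<phi>_X in auto)
      also have "\<dots> = (\<Sum>\<gamma>\<in>X. \<xi> k \<gamma> *\<^sub>C c \<gamma>)"
        unfolding c_def linear_sum[OF bounded_linear.linear[OF bounded_linear_scaleC]]
        by (intro sum.cong refl) auto
      finally show ?thesis .
    qed
    have sum_pg: "(\<Sum>k\<in>X. (norm (poly_eval m p (z k) *\<^sub>C g k))\<^sup>2) = real L ^ m * (\<Sum>\<gamma>\<in>X. (norm (c \<gamma>))\<^sup>2)"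
      unfolding pg unfolding \<xi>_def z_def using parseval_roots_of_unity[of X m L c] by (simp add: X_def)
    define Mid where "Mid = PiE {1..m} (\<lambda>_. {d..N})"
    have card_Mid: "card Mid = (N + 1 - d) ^ m" unfolding Mid_def by (simp add: card_PiE)
    have Mid_X: "Mid \<subseteq> X" unfolding Mid_def X_def L_def by (intro PiE_mono) auto
    have c_Mid: "norm (c \<gamma>) = norm y" if \<gamma>: "\<gamma> \<in> Mid" for \<gamma>
    proof -
      have \<gamma>i: "d \<le> \<gamma> i" "\<gamma> i \<le> N" if "i \<in> {1..m}" for i using \<gamma> that by (auto simp: Mid_def)
      define \<psi> where "\<psi> \<beta> = (\<beta>, restrict (\<lambda>i. e \<beta> i + (N - \<gamma> i)) {1..m})" for \<beta>
      have "{q. q \<in> ks \<times> Bx \<and> \<phi> q = \<gamma>} = \<psi> ` ks"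
      proof (intro equalityI subsetI)
        fix q assume "q \<in> {q. q \<in> ks \<times> Bx \<and> \<phi> q = \<gamma>}"
        then obtain \<beta> \<alpha> where q: "q = (\<beta>, \<alpha>)" "\<beta> \<in> ks" "\<alpha> \<in> Bx" "\<phi> (\<beta>, \<alpha>) = \<gamma>" by auto
        have "\<alpha> = restrict (\<lambda>i. e \<beta> i + (N - \<gamma> i)) {1..m}"
        proof (rule extensionalityI[of _ "{1..m}"])
          fix i assume i: "i \<in> {1..m}"
          have "\<gamma> i = e \<beta> i + (N - \<alpha> i)" using q(4) i by (auto simp: \<phi>_def)
          moreover have "\<alpha> i \<le> N" using q(3) i by (auto simp: Bx_def)
          ultimately show "\<alpha> i = restrict (\<lambda>i. e \<beta> i + (N - \<gamma> i)) {1..m} i"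
            using \<gamma>i[OF i] d[OF q(2) i] i by simp
        qed (use q(3) in \<open>auto simp: Bx_def PiE_def\<close>)
        then show "q \<in> \<psi> ` ks" using q by (auto simp: \<psi>_def)
      next
        fix q assume "q \<in> \<psi> ` ks"
        then obtain \<beta> where \<beta>: "\<beta> \<in> ks" "q = \<psi> \<beta>" by blast
        have le: "e \<beta> i + (N - \<gamma> i) \<le> N" if "i \<in> {1..m}" for i
          using d[OF \<beta>(1) that] \<gamma>i[OF that] by simp
        have "\<phi> (\<psi> \<beta>) = \<gamma>"
        proof (rule extensionalityI[of _ "{1..m}"])
          fix i assume i: "i \<in> {1..m}"
          then show "\<phi> (\<psi> \<beta>) i = \<gamma> i"
            using d[OF \<beta>(1) i] \<gamma>i[OF i] by (simp add: \<phi>_def \<psi>_def)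
        qed (use \<gamma> in \<open>auto simp: \<phi>_def \<psi>_def Mid_def PiE_def\<close>)
        then show "q \<in> {q. q \<in> ks \<times> Bx \<and> \<phi> q = \<gamma>}" using \<beta> le by (auto simp: \<psi>_def Bx_def)
      qed
      then have "c \<gamma> = (\<Sum>q\<in>\<psi> ` ks. a (fst q) *\<^sub>C op_monomial m V (snd q) x)" by (simp add: c_def)
      also have "\<dots> = (\<Sum>\<beta>\<in>ks. a \<beta> *\<^sub>C op_monomial m V (restrict (\<lambda>i. e \<beta> i + (N - \<gamma> i)) {1..m}) x)"
        by (subst sum.reindex) (auto simp: inj_on_def \<psi>_def)
      also have "\<dots> = (\<Sum>\<beta>\<in>ks. a \<beta> *\<^sub>C op_monomial m V (\<lambda>i. (N - \<gamma> i) + e \<beta> i) x)"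
        by (intro sum.cong refl arg_cong2[where f = scaleC] op_monomial_cong) simp
      also have "\<dots> = (\<Sum>\<beta>\<in>ks. op_monomial m V (\<lambda>i. N - \<gamma> i) (a \<beta> *\<^sub>C op_monomial m V (e \<beta>) x))"
        by (intro sum.cong refl) (simp add: add bounded_clinearD(2)[OF isometricD(1)[OF mono]])
      also have "\<dots> = op_monomial m V (\<lambda>i. N - \<gamma> i) y"
        unfolding y by (rule bounded_clinear_sum[OF isometricD(1)[OF mono], symmetric])
      finally show ?thesis by (simp add: isometricD(2)[OF mono])
    qed
    have "real L ^ m * (real (N + 1 - d) ^ m * (norm y)\<^sup>2) = real L ^ m * (\<Sum>\<gamma>\<in>Mid. (norm (c \<gamma>))\<^sup>2)"
      by (simp add: c_Mid card_Mid)
    also have "\<dots> \<le> real L ^ m * (\<Sum>\<gamma>\<in>X. (norm (c \<gamma>))\<^sup>2)"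
      by (intro mult_left_mono sum_mono2 fin_X Mid_X) auto
    also have "\<dots> = (\<Sum>k\<in>X. (cmod (poly_eval m p (z k)))\<^sup>2 * (norm (g k))\<^sup>2)"
      unfolding sum_pg[symmetric] norm_scaleC power_mult_distrib ..
    also have "\<dots> \<le> (\<Sum>k\<in>X. M\<^sup>2 * (norm (g k))\<^sup>2)"
      by (intro sum_mono mult_right_mono power_mono M z_mem) auto
    also have "\<dots> = real L ^ m * (M\<^sup>2 * (real (N + 1) ^ m * (norm x)\<^sup>2))"
      unfolding sum_distrib_left[symmetric] sum_g by (simp add: mult_ac)
    finally show ?thesis unfolding L_def by (simp add: mult_le_cancel_left)
  qed
  have z0: "restrict (\<lambda>_. 0) {1..m} \<in> closed_polydisc m" by (auto simp: closed_polydisc_def)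
  have M0: "0 \<le> M" using M[OF z0] norm_ge_zero order_trans by blast
  \<comment> \<open>The ratio of the two counts at \<open>N = j + d\<close>.\<close>
  have "(\<lambda>j. (real (j + 1) / real (j + d + 1)) ^ m * (norm y)\<^sup>2) \<longlonglongrightarrow> 1 ^ m * (norm y)\<^sup>2"
  proof (intro tendsto_intros)
    have "(\<lambda>j. 1 - real d * (1 / real (j + (d + 1)))) \<longlonglongrightarrow> 1 - real d * 0"
      by (intro tendsto_intros LIMSEQ_ignore_initial_segment lim_1_over_n)
    moreover have "1 - real d * (1 / real (j + (d + 1))) = real (j + 1) / real (j + d + 1)" for j
      by (simp add: field_simps)
    ultimately show "(\<lambda>j. real (j + 1) / real (j + d + 1)) \<longlonglongrightarrow> 1" by simp
  qed
  moreover have "(real (j + 1) / real (j + d + 1)) ^ m * (norm y)\<^sup>2 \<le> M\<^sup>2 * (norm x)\<^sup>2" for j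
    using main[of "j + d"] by (simp add: field_simps power_divide)
  ultimately have "(norm y)\<^sup>2 \<le> M\<^sup>2 * (norm x)\<^sup>2" by (intro LIMSEQ_le_const2) auto
  then have "(norm y)\<^sup>2 \<le> (M * norm x)\<^sup>2" by (simp add: power_mult_distrib)
  then show ?thesis unfolding y_def by (rule power2_le_imp_le) (simp add: M0)
qed

text \<open>Boundedness is what makes the real supremum over the polydisc an upper bound for the
  values.\<close>

lemma poly_eval_bounded:
  assumes "z \<in> closed_polydisc m"
  shows "cmod (poly_eval m p z) \<le> (\<Sum>\<alpha>\<in>Poly_Mapping.keys p. cmod (Poly_Mapping.lookup p \<alpha>))"
  unfolding poly_eval_def
proof (rule sum_norm_le)
  fix \<alpha>
  have "cmod (\<Prod>i\<in>{1..m}. z i ^ Poly_Mapping.lookup \<alpha> i) \<le> 1"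
    unfolding prod_norm[symmetric]
    by (rule prod_le_1) (use assms in \<open>auto simp: closed_polydisc_def norm_power PiE_iff intro!: power_le_one\<close>)
  then show "cmod (Poly_Mapping.lookup p \<alpha> * (\<Prod>i\<in>{1..m}. z i ^ Poly_Mapping.lookup \<alpha> i)) \<le> cmod (Poly_Mapping.lookup p \<alpha>)"
    by (simp add: norm_mult mult_left_le)
qed

text \<open>Testing \<open>q = p(T) h\<close> against itself expresses its squared norm by
  \<open>p(V)\<close> in the dilation space, and one factor \<open>norm q\<close> cancels.\<close>

lemma isometric_lift_von_neumann:
  fixes J :: "'a::complex_hilbert_space \<Rightarrow> 'k::complex_hilbert_space"
  assumes lift: "isometric_lift m T J V"
  shows "onorm (poly_op m p T) \<le> (SUP z\<in>closed_polydisc m. cmod (poly_eval m p z))"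
proof -
  define M where "M = (SUP z\<in>closed_polydisc m. cmod (poly_eval m p z))"
  have J: "isometric J" and V: "\<And>i. i \<in> {1..m} \<Longrightarrow> isometric (V i)"
    and VV: "\<And>i j x. i \<in> {1..m} \<Longrightarrow> j \<in> {1..m} \<Longrightarrow> V i (V j x) = V j (V i x)"
    and compress: "\<And>\<alpha> h g. cinner (op_monomial m V \<alpha> (J h)) (J g) = cinner (op_monomial m T \<alpha> h) g"
    using lift unfolding isometric_lift_def by blast+
  have M: "cmod (poly_eval m p z) \<le> M" if "z \<in> closed_polydisc m" for z
    unfolding M_def by (rule cSUP_upper[OF that]) (auto intro!: bdd_aboveI2 poly_eval_bounded)
  have z0: "restrict (\<lambda>_. 0) {1..m} \<in> closed_polydisc m" by (auto simp: closed_polydisc_def)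
  have M0: "0 \<le> M" using M[OF z0] norm_ge_zero order_trans by blast
  have "norm (poly_op m p T h) \<le> M * norm h" for h
  proof -
    define q where "q = poly_op m p T h"
    have "cinner (poly_op m p V (J h)) (J q) = cinner q q"
      unfolding q_def poly_op_def cinner_sum_left cinner_scaleC_left compress ..
    then have "(norm q)\<^sup>2 = cmod (cinner (poly_op m p V (J h)) (J q))"
      by (simp add: cinner_self norm_power)
    also have "\<dots> \<le> norm (poly_op m p V (J h)) * norm (J q)" by (rule cinner_cauchy_schwarz)
    also have "\<dots> \<le> (M * norm (J h)) * norm (J q)"
      by (intro mult_right_mono von_neumann_isometries V VV M) auto
    finally have "norm q * norm q \<le> (M * norm h) * norm q"
      by (simp add: isometricD(2)[OF J] power2_eq_square)
    then show ?thesis unfolding q_def[symmetric] using M0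
      by (cases "norm q = 0") auto
  qed
  then show ?thesis unfolding M_def[symmetric] by (intro onorm_bound M0)
qed

theorem theorem1p3:
  fixes T :: "nat \<Rightarrow> 'a::complex_hilbert_space \<Rightarrow> 'a" and n :: nat
  assumes separable: "separable_space (euclidean :: 'a topology)"
    and n: "n \<ge> 2"
    and contractions: "commuting_contractions (n + 1) T"
    and B0: "T \<in> class_B0 n"
  shows "has_isometric_dilation (n + 1) T \<and>
    (\<forall>p\<in>polynomials (n + 1).
      onorm (poly_op (n + 1) p T) \<le> (SUP z\<in>closed_polydisc (n + 1). cmod (poly_eval (n + 1) p z)))"
proof -
  obtain J :: "'a \<Rightarrow> ell2" and V where lift: "isometric_lift (n + 1) T J V"
    using isometric_lift_exists[OF separable contractions B0] by blast
  show ?thesis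
    using isometric_lift_has_dilation[OF lift] isometric_lift_von_neumann[OF lift] by blast
qed

end
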